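(* The $\mathbb{Z}_2$-algebra $\mathcal{J}_2$ is generated by $\{Jq^{2^n}\}_{n\ge0}$.
   Context: $\mathbb{Z}_2$ is the ring of dyadic ($2$-adic) integers. $\mathbb{Z}_2[\xi_1,\dots,\xi_n]$ is graded by $\deg\xi_i=1$. $Jq$ is the $\mathbb{Z}_2$-algebra endomorphism with $Jq(1)=1$, $Jq(\xi_i)=\xi_i+\xi_i^2$. For $k\ge0$, $Jq^k$ is the $\mathbb{Z}_2$-linear map raising degree by $k$ obtained, on each degree $d$, by restricting $Jq$ to degree $d$ and projecting onto degree $d+k$; $Jq^0=1$. The dyadic Steenrod algebra $\mathcal{J}_2$ is the (non-commutative) $\mathbb{Z}_2$-algebra generated under composition by the $Jq^k$, $k\ge0$, two elements being equal when they agree as operators on $\mathbb{Z}_2[\xi_1,\dots,\xi_n]$ for every $n$. *)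

theory Defs
  imports "HOL-Library.Poly_Mapping" "HOL-Library.FuncSet" "HOL.Hull"
begin

section \<open>The ring of dyadic integers\<close>

text \<open>The inverse limit of the rings of integers modulo \<open>2 ^ n\<close>: the \<open>n\<close>-th entry of a coherent
  sequence is the canonical representative of the residue class modulo \<open>2 ^ n\<close>.\<close>

typedef dyadic = "{x :: nat \<Rightarrow> int. \<forall>n. x n \<in> {0..<2 ^ n} \<and> x (Suc n) mod 2 ^ n = x n}"
  morphisms residue Abs_dyadic
  by (rule exI[of _ "\<lambda>_. 0"]) simp

setup_lifting type_definition_dyadic

lemma coherent_mod:
  fixes z :: "nat \<Rightarrow> int"
  assumes "z (Suc n) mod 2 ^ n = z n mod 2 ^ n"
  shows "z n mod 2 ^ n \<in> {0..<2 ^ n} \<and> (z (Suc n) mod 2 ^ Suc n) mod 2 ^ n = z n mod 2 ^ n"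
  using assms by (auto simp: mod_mod_cancel le_imp_power_dvd simp del: power_Suc)

instantiation dyadic :: comm_ring_1
begin

lift_definition zero_dyadic :: dyadic is "\<lambda>n. 0 mod 2 ^ n"
  by (rule coherent_mod) (rule refl)

lift_definition one_dyadic :: dyadic is "\<lambda>n. 1 mod 2 ^ n"
  by (rule coherent_mod) (rule refl)

lift_definition plus_dyadic :: "dyadic \<Rightarrow> dyadic \<Rightarrow> dyadic"
  is "\<lambda>x y n. (x n + y n) mod 2 ^ n"
  by (rule coherent_mod) (metis mod_add_eq)

lift_definition minus_dyadic :: "dyadic \<Rightarrow> dyadic \<Rightarrow> dyadic"
  is "\<lambda>x y n. (x n - y n) mod 2 ^ n"
  by (rule coherent_mod) (metis mod_diff_eq)

lift_definition uminus_dyadic :: "dyadic \<Rightarrow> dyadic"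
  is "\<lambda>x n. (- x n) mod 2 ^ n"
  by (rule coherent_mod) (metis mod_minus_eq)

lift_definition times_dyadic :: "dyadic \<Rightarrow> dyadic \<Rightarrow> dyadic"
  is "\<lambda>x y n. (x n * y n) mod 2 ^ n"
  by (rule coherent_mod) (metis mod_mult_eq)

instance
proof
  fix a b c :: dyadic
  show "a * b * c = a * (b * c)"
    by transfer (simp add: mod_mult_left_eq mod_mult_right_eq mult.assoc)
  show "a * b = b * a"
    by transfer (simp add: mult.commute)
  show "1 * a = a"
  proof transfer
    fix x :: "nat \<Rightarrow> int"
    assume "\<forall>n. x n \<in> {0..<2 ^ n} \<and> x (Suc n) mod 2 ^ n = x n"
    then have "(1 mod 2 ^ n) * x n mod 2 ^ n = x n" for n
      by (metis mod_mult_left_eq mult_1 mod_pos_pos_trivial atLeastLessThan_iff)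
    then show "(\<lambda>n. (1 mod 2 ^ n) * x n mod 2 ^ n) = x" by blast
  qed
  show "a + b + c = a + (b + c)"
    by transfer (simp add: mod_add_left_eq mod_add_right_eq add.assoc)
  show "a + b = b + a"
    by transfer (simp add: add.commute)
  show "0 + a = a"
    by transfer simp
  show "- a + a = 0"
    by transfer (simp add: mod_add_left_eq)
  show "a - b = a + - b"
    by transfer (simp add: mod_add_right_eq)
  show "(a + b) * c = a * c + b * c"
    by transfer (simp add: mod_mult_left_eq mod_add_eq distrib_right)
  show "(0::dyadic) \<noteq> 1"
  proof
    assume "(0::dyadic) = 1"
    then have "residue 0 1 = residue 1 1" by simp
    then show False by (simp add: zero_dyadic.rep_eq one_dyadic.rep_eq)
  qed
qed

end


section \<open>Polynomials over the dyadic integers\<close>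

text \<open>Monomials are finitely supported exponent functions.  All variables \<open>\<xi> i\<close> with \<open>i\<close> a natural
  number live in one type; \<open>dpolys n\<close> is the polynomial ring in \<open>\<xi> 1, \<dots>, \<xi> n\<close>.\<close>

type_synonym monom = "nat \<Rightarrow>\<^sub>0 nat"
type_synonym dpoly = "monom \<Rightarrow>\<^sub>0 dyadic"

definition dpolys :: "nat \<Rightarrow> dpoly set" where
  "dpolys n = {p. \<forall>m \<in> Poly_Mapping.keys p. Poly_Mapping.keys m \<subseteq> {1..n}}"

definition const :: "dyadic \<Rightarrow> dpoly" where
  "const c = Poly_Mapping.single 0 c"

definition \<xi> :: "nat \<Rightarrow> dpoly" where
  "\<xi> i = Poly_Mapping.single (Poly_Mapping.single i 1) 1"

definition monom_deg :: "monom \<Rightarrow> nat" where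
  "monom_deg m = (\<Sum>i \<in> Poly_Mapping.keys m. Poly_Mapping.lookup m i)"

definition hom_part :: "nat \<Rightarrow> dpoly \<Rightarrow> dpoly" where
  "hom_part d p = (\<Sum>m \<in> {m \<in> Poly_Mapping.keys p. monom_deg m = d}.
     Poly_Mapping.single m (Poly_Mapping.lookup p m))"


section \<open>The total operation and its graded components\<close>

text \<open>The algebra endomorphism with \<open>\<xi> i \<mapsto> \<xi> i + \<xi> i ^ 2\<close>, written out as a substitution; see
  \<open>Jq_total_unique\<close> below for its characterization.\<close>

definition Jq_total :: "dpoly \<Rightarrow> dpoly" where
  "Jq_total p = (\<Sum>m \<in> Poly_Mapping.keys p. const (Poly_Mapping.lookup p m) *
     (\<Prod>i \<in> Poly_Mapping.keys m. (\<xi> i + \<xi> i ^ 2) ^ Poly_Mapping.lookup m i))"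

definition Jq_comp :: "nat \<Rightarrow> dpoly \<Rightarrow> dpoly" where
  "Jq_comp k p = (\<Sum>d \<in> monom_deg ` Poly_Mapping.keys p.
     hom_part (d + k) (Jq_total (hom_part d p)))"


section \<open>Operators and the dyadic Steenrod algebra\<close>

text \<open>An operator is a family consisting, for every \<open>n\<close>, of a linear endomorphism of \<open>dpolys n\<close>.
  The endomorphisms are extensional functions, so two operators are equal iff they
  agree on \<open>dpolys n\<close> for every \<open>n\<close>.\<close>

type_synonym operator = "nat \<Rightarrow> dpoly \<Rightarrow> dpoly"

definition operators :: "operator set" where
  "operators = {f. \<forall>n. f n \<in> dpolys n \<rightarrow>\<^sub>E dpolys n \<and>
     (\<forall>p \<in> dpolys n. \<forall>q \<in> dpolys n. f n (p + q) = f n p + f n q) \<and>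
     (\<forall>c. \<forall>p \<in> dpolys n. f n (const c * p) = const c * f n p)}"

definition op_id :: operator where
  "op_id = (\<lambda>n. \<lambda>p \<in> dpolys n. p)"

definition op_add :: "operator \<Rightarrow> operator \<Rightarrow> operator" where
  "op_add f g = (\<lambda>n. \<lambda>p \<in> dpolys n. f n p + g n p)"

definition op_scale :: "dyadic \<Rightarrow> operator \<Rightarrow> operator" where
  "op_scale c f = (\<lambda>n. \<lambda>p \<in> dpolys n. const c * f n p)"

definition op_comp :: "operator \<Rightarrow> operator \<Rightarrow> operator" where
  "op_comp f g = (\<lambda>n. compose (dpolys n) (f n) (g n))"

text \<open>Unital subalgebras over the dyadic integers, with composition as multiplication.\<close>

definition subalgebra :: "operator set \<Rightarrow> bool" where
  "subalgebra A \<longleftrightarrow> A \<subseteq> operators \<and> op_id \<in> A \<and>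
     (\<forall>f \<in> A. \<forall>g \<in> A. op_add f g \<in> A) \<and>
     (\<forall>c. \<forall>f \<in> A. op_scale c f \<in> A) \<and>
     (\<forall>f \<in> A. \<forall>g \<in> A. op_comp f g \<in> A)"

definition generated_algebra :: "operator set \<Rightarrow> operator set" where
  "generated_algebra S = subalgebra hull S"

definition Jq :: "nat \<Rightarrow> operator" where
  "Jq k = (\<lambda>n. \<lambda>p \<in> dpolys n. Jq_comp k p)"

definition J2 :: "operator set" where
  "J2 = generated_algebra {Jq k | k. k \<ge> 0}"


section \<open>Basic properties\<close>

subsection \<open>Polynomials\<close>

lemma poly_eq_sum_single: "p = (\<Sum>m \<in> Poly_Mapping.keys p. Poly_Mapping.single m (Poly_Mapping.lookup p m))"
  by (rule poly_mapping_eqI)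
    (simp add: lookup_sum lookup_single when_def in_keys_iff)

lemma dpolys_0: "0 \<in> dpolys n"
  by (simp add: dpolys_def)

lemma dpolys_1: "1 \<in> dpolys n"
  by (simp add: dpolys_def)

lemma dpolys_add: "p \<in> dpolys n \<Longrightarrow> q \<in> dpolys n \<Longrightarrow> p + q \<in> dpolys n"
  unfolding dpolys_def using Poly_Mapping.keys_add[of p q] by blast

lemma dpolys_mult:
  assumes "p \<in> dpolys n" "q \<in> dpolys n"
  shows "p * q \<in> dpolys n"
  unfolding dpolys_def
proof (intro CollectI ballI)
  fix m assume "m \<in> Poly_Mapping.keys (p * q)"
  then obtain a b where "m = a + b" "a \<in> Poly_Mapping.keys p" "b \<in> Poly_Mapping.keys q"
    using Poly_Mapping.keys_mult[of p q] by blast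
  then show "Poly_Mapping.keys m \<subseteq> {1..n}"
    using assms Poly_Mapping.keys_add[of a b] unfolding dpolys_def by blast
qed

lemma dpolys_const: "const c \<in> dpolys n"
  by (simp add: dpolys_def const_def)

lemma dpolys_\<xi>: "i \<in> {1..n} \<Longrightarrow> \<xi> i \<in> dpolys n"
  by (simp add: dpolys_def \<xi>_def)

lemma dpolys_power: "p \<in> dpolys n \<Longrightarrow> p ^ k \<in> dpolys n"
  by (induction k) (auto simp: dpolys_1 dpolys_mult)

lemma dpolys_sum: "(\<And>i. i \<in> I \<Longrightarrow> f i \<in> dpolys n) \<Longrightarrow> sum f I \<in> dpolys n"
  by (induction I rule: infinite_finite_induct) (auto simp: dpolys_0 dpolys_add)

lemma dpolys_prod: "(\<And>i. i \<in> I \<Longrightarrow> f i \<in> dpolys n) \<Longrightarrow> prod f I \<in> dpolys n"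
  by (induction I rule: infinite_finite_induct) (auto simp: dpolys_1 dpolys_mult)

lemma lookup_const_mult: "Poly_Mapping.lookup (const c * p) m = c * Poly_Mapping.lookup p m"
  unfolding const_def mult_map_scale_conv_mult[symmetric]
  by (simp add: Poly_Mapping.map.rep_eq when_def)

lemma const_add: "const (a + b) = const a + const b"
  by (simp add: const_def single_add)

lemma const_mult: "const (a * b) = const a * const b"
  by (simp add: const_def mult_single)

lemma lookup_hom_part:
  "Poly_Mapping.lookup (hom_part d p) m = (Poly_Mapping.lookup p m when monom_deg m = d)"
  by (auto simp: hom_part_def lookup_sum lookup_single when_def in_keys_iff)

lemma hom_part_add: "hom_part d (p + q) = hom_part d p + hom_part d q"
  by (rule poly_mapping_eqI) (simp add: lookup_hom_part lookup_add when_def)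

lemma hom_part_const_mult: "hom_part d (const c * p) = const c * hom_part d p"
  by (rule poly_mapping_eqI) (simp add: lookup_hom_part lookup_const_mult when_def)

lemma dpolys_hom_part: "p \<in> dpolys n \<Longrightarrow> hom_part d p \<in> dpolys n"
  by (auto simp: dpolys_def in_keys_iff lookup_hom_part)

subsection \<open>The total operation\<close>

definition Jq_monom :: "monom \<Rightarrow> dpoly" where
  "Jq_monom m = (\<Prod>i \<in> Poly_Mapping.keys m. (\<xi> i + \<xi> i ^ 2) ^ Poly_Mapping.lookup m i)"

lemma Jq_monom_superset:
  assumes "finite A" "Poly_Mapping.keys m \<subseteq> A"
  shows "Jq_monom m = (\<Prod>i \<in> A. (\<xi> i + \<xi> i ^ 2) ^ Poly_Mapping.lookup m i)"
  unfolding Jq_monom_def using assms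
  by (intro prod.mono_neutral_left) (auto simp: in_keys_iff)

lemma Jq_monom_add: "Jq_monom (m + m') = Jq_monom m * Jq_monom m'"
proof -
  let ?A = "Poly_Mapping.keys m \<union> Poly_Mapping.keys m'"
  have "Jq_monom (m + m') = (\<Prod>i \<in> ?A. (\<xi> i + \<xi> i ^ 2) ^ Poly_Mapping.lookup (m + m') i)"
    using Poly_Mapping.keys_add[of m m'] by (intro Jq_monom_superset) auto
  also have "\<dots> = (\<Prod>i \<in> ?A. (\<xi> i + \<xi> i ^ 2) ^ Poly_Mapping.lookup m i) *
      (\<Prod>i \<in> ?A. (\<xi> i + \<xi> i ^ 2) ^ Poly_Mapping.lookup m' i)"
    by (simp add: lookup_add power_add prod.distrib)
  finally show ?thesis
    by (simp add: Jq_monom_superset[of ?A])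
qed

lemma Jq_total_single: "Jq_total (Poly_Mapping.single m c) = const c * Jq_monom m"
  by (cases "c = 0") (simp_all add: Jq_total_def Jq_monom_def const_def)

lemma Jq_total_0 [simp]: "Jq_total 0 = 0"
  by (simp add: Jq_total_def)

lemma Jq_total_add: "Jq_total (p + q) = Jq_total p + Jq_total q"
  unfolding Jq_total_def
  by (rule setsum_keys_plus_distrib) (auto simp: const_add distrib_right, simp add: const_def)

lemma Jq_total_sum: "Jq_total (sum f I) = (\<Sum>i \<in> I. Jq_total (f i))"
  by (induction I rule: infinite_finite_induct) (auto simp: Jq_total_add)

lemma Jq_total_mult: "Jq_total (p * q) = Jq_total p * Jq_total q"
proof -
  have single: "Jq_total (Poly_Mapping.single m c * Poly_Mapping.single m' c') =
      Jq_total (Poly_Mapping.single m c) * Jq_total (Poly_Mapping.single m' c')" for m m' c c'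
    by (simp add: mult_single Jq_total_single const_mult Jq_monom_add mult_ac)
  let ?s = "\<lambda>p m. Poly_Mapping.single m (Poly_Mapping.lookup p m)"
  have "Jq_total ((\<Sum>m \<in> Poly_Mapping.keys p. ?s p m) * (\<Sum>m \<in> Poly_Mapping.keys q. ?s q m)) =
      Jq_total (\<Sum>m \<in> Poly_Mapping.keys p. ?s p m) * Jq_total (\<Sum>m \<in> Poly_Mapping.keys q. ?s q m)"
    by (simp only: sum_product Jq_total_sum single)
  then show ?thesis
    by (simp only: poly_eq_sum_single[symmetric])
qed

lemma Jq_total_const: "Jq_total (const c) = const c"
  by (simp add: const_def Jq_total_single) (simp add: Jq_monom_def const_def)

lemma Jq_total_1: "Jq_total 1 = 1"
  using Jq_total_const[of 1] by (simp add: const_def)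

lemma Jq_total_\<xi>: "Jq_total (\<xi> i) = \<xi> i + \<xi> i ^ 2"
  by (subst \<xi>_def) (simp add: Jq_total_single Jq_monom_def const_def)

lemma single_eq_prod:
  "Poly_Mapping.single m c = const c * (\<Prod>i \<in> Poly_Mapping.keys m. \<xi> i ^ Poly_Mapping.lookup m i)"
proof -
  have pow: "\<xi> i ^ k = Poly_Mapping.single (Poly_Mapping.single i k) 1" for i k
    by (induction k) (simp_all add: \<xi>_def mult_single flip: single_add)
  have "(\<Prod>i \<in> A. \<xi> i ^ f i) = Poly_Mapping.single (\<Sum>i \<in> A. Poly_Mapping.single i (f i)) 1"
    if "finite A" for A and f :: "nat \<Rightarrow> nat"
    using that by (induction A) (simp_all add: pow mult_single)
  moreover have "m = (\<Sum>i \<in> Poly_Mapping.keys m. Poly_Mapping.single i (Poly_Mapping.lookup m i))"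
    by (rule poly_mapping_eqI) (simp add: lookup_sum lookup_single when_def in_keys_iff)
  ultimately show ?thesis
    by (simp add: const_def mult_single)
qed

lemma Jq_total_unique:
  assumes add: "\<And>p q. f (p + q) = f p + f q"
    and mult: "\<And>p q. f (p * q) = f p * f q"
    and const: "\<And>c. f (const c) = const c"
    and var: "\<And>i. f (\<xi> i) = \<xi> i + \<xi> i ^ 2"
  shows "f = Jq_total"
proof
  fix p
  have 0: "f 0 = 0" using const[of 0] by (simp add: const_def)
  have 1: "f 1 = 1" using const[of 1] by (simp add: const_def)
  have sum: "f (sum g I) = (\<Sum>i \<in> I. f (g i))" for g and I :: "monom set"
    by (induction I rule: infinite_finite_induct) (auto simp: 0 add)
  have prod: "f (prod g I) = (\<Prod>i \<in> I. f (g i))" for g and I :: "nat set"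
    by (induction I rule: infinite_finite_induct) (auto simp: 1 mult)
  have power: "f (q ^ k) = f q ^ k" for q k
    by (induction k) (auto simp: 1 mult)
  have "f (Poly_Mapping.single m c) = Jq_total (Poly_Mapping.single m c)" for m c
    unfolding Jq_total_single Jq_monom_def
    by (subst single_eq_prod) (simp add: mult const prod power var)
  then have "f (\<Sum>m \<in> Poly_Mapping.keys p. Poly_Mapping.single m (Poly_Mapping.lookup p m)) =
      Jq_total (\<Sum>m \<in> Poly_Mapping.keys p. Poly_Mapping.single m (Poly_Mapping.lookup p m))"
    by (simp only: sum Jq_total_sum)
  then show "f p = Jq_total p"
    by (simp only: poly_eq_sum_single[symmetric])
qed

lemma dpolys_Jq_total: "p \<in> dpolys n \<Longrightarrow> Jq_total p \<in> dpolys n"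
  unfolding Jq_total_def
  by (intro dpolys_sum dpolys_mult dpolys_const dpolys_prod dpolys_power dpolys_add dpolys_\<xi>)
    (unfold dpolys_def, blast+)

subsection \<open>The graded components\<close>

lemma hom_part_0 [simp]: "hom_part d 0 = 0"
  by (simp add: hom_part_def)

lemma Jq_comp_superset:
  assumes "finite D" "monom_deg ` Poly_Mapping.keys p \<subseteq> D"
  shows "Jq_comp k p = (\<Sum>d \<in> D. hom_part (d + k) (Jq_total (hom_part d p)))"
proof -
  have "hom_part d p = 0" if "d \<notin> monom_deg ` Poly_Mapping.keys p" for d
    using that by (intro poly_mapping_eqI) (auto simp: lookup_hom_part when_def in_keys_iff)
  then show ?thesis
    unfolding Jq_comp_def using assms by (intro sum.mono_neutral_left) auto
qed

lemma Jq_comp_homogeneous: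
  assumes "hom_part d p = p"
  shows "Jq_comp k p = hom_part (d + k) (Jq_total p)"
proof -
  have "monom_deg m = d" if "m \<in> Poly_Mapping.keys p" for m
    using that lookup_hom_part[of d p m] assms by (auto simp: when_def in_keys_iff split: if_splits)
  then show ?thesis
    using Jq_comp_superset[of "{d}" p k] assms by auto
qed

lemma Jq_comp_add: "Jq_comp k (p + q) = Jq_comp k p + Jq_comp k q"
proof -
  let ?D = "monom_deg ` (Poly_Mapping.keys p \<union> Poly_Mapping.keys q)"
  have "monom_deg ` Poly_Mapping.keys (p + q) \<subseteq> ?D"
    using Poly_Mapping.keys_add[of p q] by blast
  then have "Jq_comp k (p + q) = (\<Sum>d \<in> ?D. hom_part (d + k) (Jq_total (hom_part d (p + q))))"
    by (intro Jq_comp_superset) auto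
  also have "\<dots> = (\<Sum>d \<in> ?D. hom_part (d + k) (Jq_total (hom_part d p))) +
      (\<Sum>d \<in> ?D. hom_part (d + k) (Jq_total (hom_part d q)))"
    by (simp add: hom_part_add Jq_total_add sum.distrib)
  also have "\<dots> = Jq_comp k p + Jq_comp k q"
    by (intro arg_cong2[where f = "(+)"] Jq_comp_superset[symmetric]) auto
  finally show ?thesis .
qed

lemma Jq_comp_const_mult: "Jq_comp k (const c * p) = const c * Jq_comp k p"
proof -
  have "monom_deg ` Poly_Mapping.keys (const c * p) \<subseteq> monom_deg ` Poly_Mapping.keys p"
    by (intro image_mono subsetI) (auto simp: in_keys_iff lookup_const_mult)
  then have "Jq_comp k (const c * p) = (\<Sum>d \<in> monom_deg ` Poly_Mapping.keys p.
      hom_part (d + k) (Jq_total (hom_part d (const c * p))))"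
    by (intro Jq_comp_superset) auto
  then show ?thesis
    by (simp add: hom_part_const_mult Jq_total_mult Jq_total_const Jq_comp_def sum_distrib_left)
qed

lemma dpolys_Jq_comp: "p \<in> dpolys n \<Longrightarrow> Jq_comp k p \<in> dpolys n"
  unfolding Jq_comp_def by (intro dpolys_sum dpolys_hom_part dpolys_Jq_total)

lemma monom_deg_superset:
  "finite A \<Longrightarrow> Poly_Mapping.keys m \<subseteq> A \<Longrightarrow> monom_deg m = (\<Sum>i \<in> A. Poly_Mapping.lookup m i)"
  unfolding monom_deg_def by (intro sum.mono_neutral_left) (auto simp: in_keys_iff)

lemma monom_deg_add: "monom_deg (a + b) = monom_deg a + monom_deg b"
proof -
  let ?A = "Poly_Mapping.keys a \<union> Poly_Mapping.keys b"
  have "monom_deg (a + b) = (\<Sum>i \<in> ?A. Poly_Mapping.lookup (a + b) i)"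
    using Poly_Mapping.keys_add[of a b] by (intro monom_deg_superset) auto
  then show ?thesis
    by (simp add: lookup_add sum.distrib monom_deg_superset[of ?A])
qed

definition has_lowest_monom :: "monom \<Rightarrow> dpoly \<Rightarrow> bool" where
  "has_lowest_monom m p \<longleftrightarrow>
     (\<forall>a \<in> Poly_Mapping.keys (p - Poly_Mapping.single m 1). monom_deg m < monom_deg a)"

lemma has_lowest_monom_mult:
  assumes "has_lowest_monom a p" "has_lowest_monom b q"
  shows "has_lowest_monom (a + b) (p * q)"
  unfolding has_lowest_monom_def
proof
  define r s where "r = p - Poly_Mapping.single a 1" and "s = q - Poly_Mapping.single b 1"
  fix m assume m: "m \<in> Poly_Mapping.keys (p * q - Poly_Mapping.single (a + b) 1)"
  have "p * q - Poly_Mapping.single (a + b) 1 =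
      (Poly_Mapping.single a 1 * s + r * Poly_Mapping.single b 1) + r * s"
    by (simp add: r_def s_def algebra_simps mult_single)
  with m have "m \<in> Poly_Mapping.keys (Poly_Mapping.single a 1 * s) \<union>
      Poly_Mapping.keys (r * Poly_Mapping.single b 1) \<union> Poly_Mapping.keys (r * s)"
    using Poly_Mapping.keys_add by (metis (no_types, lifting) UnE UnI1 UnI2 subsetD)
  then obtain x y where xy: "m = x + y"
    "x = a \<and> y \<in> Poly_Mapping.keys s \<or> x \<in> Poly_Mapping.keys r \<and> y = b \<or>
     x \<in> Poly_Mapping.keys r \<and> y \<in> Poly_Mapping.keys s"
    using Poly_Mapping.keys_mult[of "Poly_Mapping.single a 1" s] Poly_Mapping.keys_mult[of r s]
      Poly_Mapping.keys_mult[of r "Poly_Mapping.single b 1"] by fastforce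
  have "x \<in> Poly_Mapping.keys r \<Longrightarrow> monom_deg a < monom_deg x"
    "y \<in> Poly_Mapping.keys s \<Longrightarrow> monom_deg b < monom_deg y"
    using assms by (auto simp: has_lowest_monom_def r_def s_def)
  with xy show "monom_deg (a + b) < monom_deg m"
    by (auto simp: monom_deg_add)
qed

lemma has_lowest_monom_1: "has_lowest_monom 0 1"
  by (simp add: has_lowest_monom_def)

lemma has_lowest_monom_power:
  assumes "has_lowest_monom (Poly_Mapping.single i 1) p"
  shows "has_lowest_monom (Poly_Mapping.single i k) (p ^ k)"
proof (induction k)
  case (Suc k)
  then show ?case
    using has_lowest_monom_mult[OF assms Suc] by (simp flip: single_add)
qed (simp add: has_lowest_monom_1)

lemma has_lowest_monom_prod:
  assumes "finite A" "\<And>i. i \<in> A \<Longrightarrow> has_lowest_monom (e i) (f i)"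
  shows "has_lowest_monom (\<Sum>i \<in> A. e i) (\<Prod>i \<in> A. f i)"
  using assms by (induction A) (auto simp: has_lowest_monom_1 has_lowest_monom_mult)

lemma has_lowest_monom_Jq_monom: "has_lowest_monom m (Jq_monom m)"
proof -
  have "\<xi> i + \<xi> i ^ 2 - Poly_Mapping.single (Poly_Mapping.single i 1) 1 =
      Poly_Mapping.single (Poly_Mapping.single i 2) 1" for i
    by (simp add: \<xi>_def power2_eq_square mult_single numeral_2_eq_2 flip: single_add)
  then have "has_lowest_monom (Poly_Mapping.single i 1) (\<xi> i + \<xi> i ^ 2)" for i
    by (simp add: has_lowest_monom_def monom_deg_def)
  then have "has_lowest_monom
      (\<Sum>i \<in> Poly_Mapping.keys m. Poly_Mapping.single i (Poly_Mapping.lookup m i)) (Jq_monom m)"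
    unfolding Jq_monom_def by (intro has_lowest_monom_prod has_lowest_monom_power) auto
  moreover have "(\<Sum>i \<in> Poly_Mapping.keys m. Poly_Mapping.single i (Poly_Mapping.lookup m i)) = m"
    by (rule poly_mapping_eqI) (simp add: lookup_sum lookup_single when_def in_keys_iff)
  ultimately show ?thesis by simp
qed

lemma Jq_comp_0: "Jq_comp 0 p = p"
proof -
  have single: "Jq_comp 0 (Poly_Mapping.single m c) = Poly_Mapping.single m c" for m c
  proof -
    have "hom_part (monom_deg m) (Jq_monom m) = Poly_Mapping.single m 1"
    proof (rule poly_mapping_eqI)
      fix a
      have "Poly_Mapping.lookup (Jq_monom m) a = Poly_Mapping.lookup (Poly_Mapping.single m 1) a"
        if "monom_deg a = monom_deg m"
      proof -
        have "a \<notin> Poly_Mapping.keys (Jq_monom m - Poly_Mapping.single m 1)"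
          using that has_lowest_monom_Jq_monom[of m] by (force simp: has_lowest_monom_def)
        then show ?thesis
          by (simp add: in_keys_iff lookup_minus)
      qed
      then show "Poly_Mapping.lookup (hom_part (monom_deg m) (Jq_monom m)) a =
          Poly_Mapping.lookup (Poly_Mapping.single m 1) a"
        by (auto simp: lookup_hom_part lookup_single when_def)
    qed
    moreover have "hom_part (monom_deg m) (Poly_Mapping.single m c) = Poly_Mapping.single m c"
      by (rule poly_mapping_eqI) (auto simp: lookup_hom_part lookup_single when_def)
    ultimately show ?thesis
      by (simp add: Jq_comp_homogeneous Jq_total_single hom_part_const_mult)
        (simp add: const_def mult_single)
  qed
  have "Jq_comp 0 0 = 0"
    by (simp add: Jq_comp_def)
  then have sum: "Jq_comp 0 (sum f A) = (\<Sum>i \<in> A. Jq_comp 0 (f i))" for f and A :: "monom set"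
    by (induction A rule: infinite_finite_induct) (auto simp: Jq_comp_add)
  have "Jq_comp 0 (\<Sum>m \<in> Poly_Mapping.keys p. Poly_Mapping.single m (Poly_Mapping.lookup p m)) =
      (\<Sum>m \<in> Poly_Mapping.keys p. Poly_Mapping.single m (Poly_Mapping.lookup p m))"
    by (simp only: sum single)
  then show ?thesis
    by (simp only: poly_eq_sum_single[symmetric])
qed

subsection \<open>Operators\<close>

lemma Jq_0: "Jq 0 = op_id"
  by (simp add: Jq_def op_id_def Jq_comp_0)

lemma Jq_in_operators: "Jq k \<in> operators"
  by (auto simp: operators_def Jq_def dpolys_Jq_comp dpolys_add dpolys_mult dpolys_const
      Jq_comp_add Jq_comp_const_mult)

lemma subalgebra_operators: "subalgebra operators"
  unfolding subalgebra_def
proof (intro conjI ballI allI)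
  show "op_id \<in> operators"
    by (auto simp: operators_def op_id_def dpolys_add dpolys_mult dpolys_const)
next
  fix f g assume "f \<in> operators" "g \<in> operators"
  then show "op_add f g \<in> operators"
    by (auto simp: operators_def op_add_def dpolys_add dpolys_mult dpolys_const distrib_left add_ac
        intro!: dpolys_add dest: PiE_mem)
next
  fix c f assume "f \<in> operators"
  then show "op_scale c f \<in> operators"
    by (auto simp: operators_def op_scale_def dpolys_add dpolys_mult dpolys_const distrib_left mult_ac
        intro!: dpolys_mult dest: PiE_mem)
next
  fix f g assume fg: "f \<in> operators" "g \<in> operators"
  then have "f n p \<in> dpolys n" "g n p \<in> dpolys n" if "p \<in> dpolys n" for n p
    using that by (auto simp: operators_def dest: PiE_mem)
  with fg show "op_comp f g \<in> operators"
    by (auto simp: operators_def op_comp_def compose_def dpolys_add dpolys_mult dpolys_const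
        dest: PiE_mem)
qed simp

lemma subalgebra_generated_algebra:
  assumes "S \<subseteq> operators"
  shows "subalgebra (generated_algebra S)"
proof -
  have "generated_algebra S \<subseteq> operators"
    unfolding generated_algebra_def using assms subalgebra_operators by (rule hull_minimal)
  then show ?thesis
    by (auto simp: subalgebra_def generated_algebra_def hull_def)
qed

end

theory Submission
  imports Defs "HOL-Library.Z2" "HOL-Computational_Algebra.Polynomial"
begin

text \<open>
  Consider the substitutions \<open>\<xi> \<mapsto> \<xi> + \<Sum>k. f k * 2 ^ (k - 1) * \<xi> ^ k / k!\<close>, where \<open>k\<close> runs from \<open>2\<close>.  In the
  coordinates \<open>f 2, f 3, \<dots>\<close> their composition is given by integral polynomials, so the operators \<open>Psi \<gamma>\<close>, the
  coefficients of the monomials \<open>\<gamma>\<close> in the \<open>f k\<close>, span a lattice that is closed under composition, and \<open>Jq n\<close> is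
  the coefficient of \<open>f 2 ^ n\<close>.  By induction on \<open>n\<close> all operators of degree \<open>n\<close> in this lattice lie in the
  algebra generated by the \<open>Jq (2 ^ e)\<close>.  Otherwise, odd integers being invertible, there is a nonzero functional modulo
  two that vanishes on the part of degree \<open>n\<close> of that algebra, in particular on products of operators of lower
  degree.  Such a functional is a polynomial over the field with two elements in the \<open>f k\<close> that is additive under
  composition.  If \<open>k\<close> is the largest index occurring in it, it has the form \<open>Q + f k ^ N\<close>, where \<open>Q\<close> involves
  smaller indices only and \<open>N\<close> is a power of two.  Evaluating at composites of the series \<open>x + s * x ^ a / a!\<close>
  excludes \<open>k > 2\<close>: one compares the two orders of composition if \<open>k + 1\<close> is not a power of two, and uses that
  \<open>x + s * x ^ b / b!\<close> and \<open>x + t * x ^ b / b!\<close> compose to \<open>x + (s + t) * x ^ b / b! + s * t * x ^ k / k! + \<dots>\<close> modulo two if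
  \<open>k = 2 * b - 1\<close> with \<open>b\<close> a power of two.  Hence the polynomial is \<open>f 2 ^ n\<close> with \<open>n\<close> a power of two, which does
  not vanish on \<open>Jq n\<close>.
\<close>

subsection \<open>Ring homomorphisms\<close>

text \<open>A predicate, because the homomorphisms below live on towers of polynomial rings and are
  composed at many different types.\<close>

definition rhom :: "('a::comm_ring_1 \<Rightarrow> 'b::comm_ring_1) \<Rightarrow> bool" where
  "rhom \<phi> \<longleftrightarrow> \<phi> 1 = 1 \<and> (\<forall>x y. \<phi> (x + y) = \<phi> x + \<phi> y) \<and> (\<forall>x y. \<phi> (x * y) = \<phi> x * \<phi> y)"

lemma rhomI:
  "\<phi> 1 = 1 \<Longrightarrow> (\<And>x y. \<phi> (x + y) = \<phi> x + \<phi> y) \<Longrightarrow> (\<And>x y. \<phi> (x * y) = \<phi> x * \<phi> y) \<Longrightarrow> rhom \<phi>"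
  by (simp add: rhom_def)

context
  fixes \<phi> :: "'a::comm_ring_1 \<Rightarrow> 'b::comm_ring_1"
  assumes h: "rhom \<phi>"
begin

lemma rhom_1: "\<phi> 1 = 1" and rhom_add: "\<phi> (x + y) = \<phi> x + \<phi> y" and rhom_mult: "\<phi> (x * y) = \<phi> x * \<phi> y"
  using h by (auto simp: rhom_def)

lemma rhom_0: "\<phi> 0 = 0"
  using rhom_add[of 0 0] by simp

lemma rhom_sum: "\<phi> (sum f A) = (\<Sum>i\<in>A. \<phi> (f i))"
  by (induction A rule: infinite_finite_induct) (auto simp: rhom_0 rhom_add)

lemma rhom_prod: "\<phi> (prod f A) = (\<Prod>i\<in>A. \<phi> (f i))"
  by (induction A rule: infinite_finite_induct) (auto simp: rhom_1 rhom_mult)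

lemma rhom_power: "\<phi> (x ^ k) = \<phi> x ^ k"
  by (induction k) (auto simp: rhom_1 rhom_mult)

lemma rhom_of_nat: "\<phi> (of_nat k) = of_nat k"
  by (induction k) (auto simp: rhom_0 rhom_1 rhom_add)

lemma rhom_of_int: "\<phi> (of_int k) = of_int k"
proof -
  have "\<phi> (- x) = - \<phi> x" for x
    using rhom_add[of x "- x"] rhom_0 by (simp add: eq_neg_iff_add_eq_0 add.commute)
  then show ?thesis
    by (cases k) (simp_all add: rhom_of_nat del: of_nat_Suc)
qed

end

lemma rhom_comp: "rhom \<phi> \<Longrightarrow> rhom \<psi> \<Longrightarrow> rhom (\<lambda>x. \<psi> (\<phi> x))"
  by (simp add: rhom_def)

lemma rhom_id: "rhom (\<lambda>x. x)"
  by (simp add: rhom_def)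

lemma rhom_int: "rhom of_int"
  by (simp add: rhom_def)

subsection \<open>Evaluation of polynomials\<close>

text \<open>\<open>cst\<close> and \<open>var\<close> generalize \<open>const\<close> and
  \<open>\<xi>\<close> to arbitrary coefficients, since polynomials with polynomial coefficients
  occur below.\<close>

definition cst :: "'a::zero \<Rightarrow> (monom \<Rightarrow>\<^sub>0 'a)" where
  "cst a = Poly_Mapping.single 0 a"

definition var :: "nat \<Rightarrow> (monom \<Rightarrow>\<^sub>0 'a::zero_neq_one)" where
  "var i = Poly_Mapping.single (Poly_Mapping.single i 1) 1"

definition mon :: "(nat \<Rightarrow> 'a::comm_ring_1) \<Rightarrow> monom \<Rightarrow> 'a" where
  "mon x m = (\<Prod>i \<in> Poly_Mapping.keys m. x i ^ Poly_Mapping.lookup m i)"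

definition ev :: "('a::comm_ring_1 \<Rightarrow> 'b::comm_ring_1) \<Rightarrow> (nat \<Rightarrow> 'b) \<Rightarrow> (monom \<Rightarrow>\<^sub>0 'a) \<Rightarrow> 'b" where
  "ev \<phi> x p = (\<Sum>m \<in> Poly_Mapping.keys p. \<phi> (Poly_Mapping.lookup p m) * mon x m)"

lemma mon_superset:
  assumes "finite A" "Poly_Mapping.keys m \<subseteq> A"
  shows "mon x m = (\<Prod>i \<in> A. x i ^ Poly_Mapping.lookup m i)"
  unfolding mon_def using assms
  by (intro prod.mono_neutral_left) (auto simp: in_keys_iff)

lemma mon_0 [simp]: "mon x 0 = 1"
  by (simp add: mon_def)

lemma mon_single [simp]: "mon x (Poly_Mapping.single i k) = x i ^ k"
  by (simp add: mon_def)

lemma mon_add: "mon x (m + m') = mon x m * mon x m'"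
proof -
  let ?A = "Poly_Mapping.keys m \<union> Poly_Mapping.keys m'"
  have "mon x (m + m') = (\<Prod>i \<in> ?A. x i ^ Poly_Mapping.lookup (m + m') i)"
    using Poly_Mapping.keys_add[of m m'] by (intro mon_superset) auto
  then show ?thesis
    by (simp add: lookup_add power_add prod.distrib mon_superset[of ?A])
qed

lemma mon_cong:
  "(\<And>i. i \<in> Poly_Mapping.keys m \<Longrightarrow> x i = y i) \<Longrightarrow> mon x m = mon y m"
  by (simp add: mon_def)

lemma mon_eq_0:
  "i \<in> Poly_Mapping.keys m \<Longrightarrow> x i = 0 \<Longrightarrow> mon x m = 0"
  unfolding mon_def
  by (rule prod_zero) (auto intro!: bexI[of _ i] zero_power simp: in_keys_iff)

lemma rhom_mon: "rhom \<phi> \<Longrightarrow> \<phi> (mon x m) = mon (\<lambda>i. \<phi> (x i)) m"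
  by (simp add: mon_def rhom_prod rhom_power)

lemma single_eq_mon: "Poly_Mapping.single m c = cst c * mon var m" for c :: "'a::comm_ring_1"
proof -
  have pow: "(var i :: monom \<Rightarrow>\<^sub>0 'a) ^ k = Poly_Mapping.single (Poly_Mapping.single i k) 1" for i k
    by (induction k) (simp_all add: var_def mult_single flip: single_add)
  have "(\<Prod>i \<in> A. (var i :: monom \<Rightarrow>\<^sub>0 'a) ^ f i) =
      Poly_Mapping.single (\<Sum>i \<in> A. Poly_Mapping.single i (f i)) 1"
    if "finite A" for A and f :: "nat \<Rightarrow> nat"
    using that by (induction A) (simp_all add: pow mult_single)
  moreover have "m = (\<Sum>i \<in> Poly_Mapping.keys m. Poly_Mapping.single i (Poly_Mapping.lookup m i))"
    by (rule poly_mapping_eqI) (simp add: lookup_sum lookup_single when_def in_keys_iff)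
  ultimately show ?thesis
    by (simp add: mon_def cst_def mult_single)
qed

lemma mon_var: "mon var m = (Poly_Mapping.single m 1 :: monom \<Rightarrow>\<^sub>0 'a::comm_ring_1)"
  by (simp add: single_eq_mon[of m 1]) (simp add: cst_def)

lemma rhom_cst: "rhom cst"
  by (rule rhomI) (simp_all add: cst_def mult_single single_add)

lemma lookup_cst_mult: "Poly_Mapping.lookup (cst c * p) m = c * Poly_Mapping.lookup p m"
  for c :: "'a::comm_ring_1"
  unfolding cst_def mult_map_scale_conv_mult[symmetric]
  by (simp add: Poly_Mapping.map.rep_eq when_def)

lemma ev_superset:
  assumes "finite A" "Poly_Mapping.keys p \<subseteq> A" "rhom \<phi>"
  shows "ev \<phi> x p = (\<Sum>m \<in> A. \<phi> (Poly_Mapping.lookup p m) * mon x m)"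
  unfolding ev_def using assms
  by (intro sum.mono_neutral_left) (auto simp: in_keys_iff rhom_0)

context
  fixes \<phi> :: "'a::comm_ring_1 \<Rightarrow> 'b::comm_ring_1" and x :: "nat \<Rightarrow> 'b"
  assumes h: "rhom \<phi>"
begin

lemma ev_single: "ev \<phi> x (Poly_Mapping.single m c) = \<phi> c * mon x m"
  using h by (cases "c = 0") (simp_all add: ev_def rhom_0)

lemma ev_cst: "ev \<phi> x (cst c) = \<phi> c"
  by (simp add: cst_def ev_single)

lemma ev_var: "ev \<phi> x (var i) = x i"
  by (simp add: var_def ev_single rhom_1[OF h])

lemma ev_add: "ev \<phi> x (p + q) = ev \<phi> x p + ev \<phi> x q"
  unfolding ev_def
  by (rule setsum_keys_plus_distrib) (auto simp: rhom_add[OF h] rhom_0[OF h] distrib_right)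

lemma ev_sum: "ev \<phi> x (sum f I) = (\<Sum>i \<in> I. ev \<phi> x (f i))"
  by (induction I rule: infinite_finite_induct) (auto simp: ev_add ev_def[of _ _ 0])

lemma ev_mult: "ev \<phi> x (p * q) = ev \<phi> x p * ev \<phi> x q"
proof -
  have single: "ev \<phi> x (Poly_Mapping.single m c * Poly_Mapping.single m' c') =
      ev \<phi> x (Poly_Mapping.single m c) * ev \<phi> x (Poly_Mapping.single m' c')" for m c m' c'
    by (simp add: mult_single ev_single rhom_mult[OF h] mon_add mult_ac)
  let ?s = "\<lambda>p m. Poly_Mapping.single m (Poly_Mapping.lookup p m)"
  have "ev \<phi> x ((\<Sum>m \<in> Poly_Mapping.keys p. ?s p m) * (\<Sum>m \<in> Poly_Mapping.keys q. ?s q m)) =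
      ev \<phi> x (\<Sum>m \<in> Poly_Mapping.keys p. ?s p m) * ev \<phi> x (\<Sum>m \<in> Poly_Mapping.keys q. ?s q m)"
    by (simp only: sum_product ev_sum single)
  then show ?thesis
    by (simp only: poly_eq_sum_single[symmetric])
qed

lemma rhom_ev: "rhom (ev \<phi> x)"
  by (rule rhomI) (simp_all add: ev_add ev_mult, metis cst_def ev_cst single_one rhom_1[OF h])

end

text \<open>Uniqueness in the universal property of a polynomial ring; identities between
  substitutions reduce to constants and variables.\<close>

lemma rhom_ext:
  fixes F H :: "(monom \<Rightarrow>\<^sub>0 'a::comm_ring_1) \<Rightarrow> 'b::comm_ring_1"
  assumes F: "rhom F" and H: "rhom H" and "\<And>a. F (cst a) = H (cst a)" "\<And>i. F (var i) = H (var i)"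
  shows "F p = H p"
proof -
  have "F (Poly_Mapping.single m c) = H (Poly_Mapping.single m c)" for m c
    by (simp add: single_eq_mon rhom_mult[OF F] rhom_mult[OF H] rhom_mon[OF F] rhom_mon[OF H] assms)
  then have "F (\<Sum>m \<in> Poly_Mapping.keys p. Poly_Mapping.single m (Poly_Mapping.lookup p m)) =
      H (\<Sum>m \<in> Poly_Mapping.keys p. Poly_Mapping.single m (Poly_Mapping.lookup p m))"
    by (simp add: rhom_sum[OF F] rhom_sum[OF H])
  then show ?thesis
    by (simp only: poly_eq_sum_single[symmetric])
qed

text \<open>This evaluation leaves the variables alone and applies \<open>\<phi>\<close> to each
  coefficient.\<close>

lemma lookup_ev_var:
  assumes "rhom \<phi>"
  shows "Poly_Mapping.lookup (ev (\<lambda>a. cst (\<phi> a)) var p) m = \<phi> (Poly_Mapping.lookup p m)"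
proof -
  have "ev (\<lambda>a. cst (\<phi> a)) var p =
      (\<Sum>m \<in> Poly_Mapping.keys p. Poly_Mapping.single m (\<phi> (Poly_Mapping.lookup p m)))"
    unfolding ev_def by (simp add: single_eq_mon)
  then show ?thesis
    by (auto simp: lookup_sum lookup_single when_def in_keys_iff rhom_0[OF assms])
qed

lemma lookup_mult_sum:
  fixes p q :: "monom \<Rightarrow>\<^sub>0 'a::comm_ring_1"
  shows "Poly_Mapping.lookup (p * q) m =
    (\<Sum>a \<in> Poly_Mapping.keys p. \<Sum>b \<in> Poly_Mapping.keys q.
       Poly_Mapping.lookup p a * Poly_Mapping.lookup q b when a + b = m)"
proof -
  let ?s = "\<lambda>p m. Poly_Mapping.single m (Poly_Mapping.lookup p m)"
  have "Poly_Mapping.lookup ((\<Sum>m \<in> Poly_Mapping.keys p. ?s p m) * (\<Sum>m \<in> Poly_Mapping.keys q. ?s q m)) m =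
    (\<Sum>a \<in> Poly_Mapping.keys p. \<Sum>b \<in> Poly_Mapping.keys q.
       Poly_Mapping.lookup p a * Poly_Mapping.lookup q b when a + b = m)"
    by (simp only: sum_product mult_single lookup_sum lookup_single)
  then show ?thesis
    by (simp only: poly_eq_sum_single[symmetric])
qed

lemma lookup_of_nat_mult: "Poly_Mapping.lookup (of_nat k * p) m = of_nat k * Poly_Mapping.lookup p m"
  for p :: "monom \<Rightarrow>\<^sub>0 'a::comm_ring_1"
  using lookup_cst_mult[of "of_nat k" p m] by (simp add: rhom_of_nat[OF rhom_cst])

subsection \<open>Hurwitz series\<close>

text \<open>A function \<open>f\<close> stands for the formal series \<open>\<Sum>m. f m * x ^ m / m!\<close>.  Then \<open>hurwitz\<close> is the product, \<open>shift\<close>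
  the derivative, \<open>dpow l f\<close> the divided power \<open>f ^ l / l!\<close> (for \<open>f 0 = 0\<close>; its coefficients are the
  partial Bell polynomials, defined here through its derivative), and \<open>scomp g f\<close> is \<open>g\<close> composed with \<open>f\<close>.\<close>

definition hurwitz :: "(nat \<Rightarrow> 'a::comm_ring_1) \<Rightarrow> (nat \<Rightarrow> 'a) \<Rightarrow> nat \<Rightarrow> 'a" where
  "hurwitz u v m = (\<Sum>i\<le>m. of_nat (m choose i) * u i * v (m - i))"

abbreviation (input) shift :: "(nat \<Rightarrow> 'a) \<Rightarrow> nat \<Rightarrow> 'a" where
  "shift u \<equiv> \<lambda>m. u (Suc m)"

fun dpow :: "nat \<Rightarrow> (nat \<Rightarrow> 'a::comm_ring_1) \<Rightarrow> nat \<Rightarrow> 'a" where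
  "dpow 0 f m = (if m = 0 then 1 else 0)"
| "dpow (Suc l) f 0 = 0"
| "dpow (Suc l) f (Suc m) = (\<Sum>i\<le>m. of_nat (m choose i) * dpow l f i * f (Suc (m - i)))"

definition scomp :: "(nat \<Rightarrow> 'a::comm_ring_1) \<Rightarrow> (nat \<Rightarrow> 'a) \<Rightarrow> nat \<Rightarrow> 'a" where
  "scomp g f m = (\<Sum>l\<le>m. g l * dpow l f m)"

lemma hurwitz_add_left: "hurwitz (\<lambda>m. u m + v m) w m = hurwitz u w m + hurwitz v w m"
  and hurwitz_add_right: "hurwitz w (\<lambda>m. u m + v m) m = hurwitz w u m + hurwitz w v m"
  by (simp_all add: hurwitz_def algebra_simps sum.distrib)

lemma hurwitz_scale_left: "hurwitz (\<lambda>m. c * u m) w m = c * hurwitz u w m"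
  by (simp add: hurwitz_def algebra_simps sum_distrib_left)

text \<open>The Leibniz rule, from Pascal's rule. It allows product identities to be proved by
  comparing constant terms and derivatives, that is, by induction on the coefficient index with
  arbitrary series.\<close>

lemma hurwitz_shift: "hurwitz u v (Suc m) = hurwitz (shift u) v m + hurwitz u (shift v) m"
proof -
  have "hurwitz u v (Suc m) = u 0 * v (Suc m) +
      (\<Sum>i\<le>m. of_nat (Suc m choose Suc i) * u (Suc i) * v (m - i))"
    unfolding hurwitz_def by (subst sum.atMost_Suc_shift) simp
  also have "(\<Sum>i\<le>m. of_nat (Suc m choose Suc i) * u (Suc i) * v (m - i)) =
      hurwitz (shift u) v m + (\<Sum>i\<le>m. of_nat (m choose Suc i) * u (Suc i) * v (m - i))"
    by (simp add: hurwitz_def algebra_simps sum.distrib)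
  also have "(\<Sum>i\<le>m. of_nat (m choose Suc i) * u (Suc i) * v (m - i)) =
      (\<Sum>i<m. of_nat (m choose Suc i) * u (Suc i) * v (Suc (m - Suc i)))"
    by (subst lessThan_Suc_atMost[symmetric]) (simp add: Suc_diff_Suc binomial_eq_0)
  also have "u 0 * v (Suc m) + (hurwitz (shift u) v m + \<dots>) = hurwitz (shift u) v m + hurwitz u (shift v) m"
    by (cases m) (simp_all add: hurwitz_def sum.atMost_Suc_shift lessThan_Suc_atMost del: sum.atMost_Suc binomial_Suc_Suc)
  finally show ?thesis .
qed

lemma hurwitz_commute: "hurwitz u v m = hurwitz v u m"
  by (induction m arbitrary: u v) (simp add: hurwitz_def mult.commute, simp add: hurwitz_shift add.commute)

lemma hurwitz_assoc: "hurwitz (hurwitz u v) w m = hurwitz u (hurwitz v w) m"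
proof (induction m arbitrary: u v w)
  case (Suc m)
  then show ?case
    by (simp add: hurwitz_shift hurwitz_add_left hurwitz_add_right add_ac)
qed (simp add: hurwitz_def mult_ac)

lemma dpow_shift: "dpow (Suc l) f (Suc m) = hurwitz (dpow l f) (shift f) m"
  by (simp add: hurwitz_def)

lemma dpow_eq_0: "m < l \<Longrightarrow> dpow l f m = 0"
proof (induction l arbitrary: m)
  case (Suc l)
  then show ?case by (cases m) auto
qed simp

text \<open>Both sides have the same derivative, by \<open>dpow_shift\<close> and the Leibniz rule,
  and both vanish in degree \<open>0\<close>. Hence \<open>dpow\<close> is indeed the divided power,
  defined without division.\<close>

lemma dpow_mult:
  assumes "f 0 = 0"
  shows "of_nat (Suc l) * dpow (Suc l) f m = hurwitz (dpow l f) f m"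
proof (induction l arbitrary: m)
  case 0
  have "dpow (Suc 0) f m = f m"
    using assms by (cases m) (auto simp: if_distrib[of "\<lambda>x. x * _"] if_distrib[of "\<lambda>x. _ * x"] cong: if_cong)
  moreover have "hurwitz (dpow 0 f) f m = f m"
    by (auto simp: hurwitz_def if_distrib[of "\<lambda>x. x * _"] if_distrib[of "\<lambda>x. _ * x"] cong: if_cong)
  ultimately show ?case by (simp del: dpow.simps)
next
  case (Suc l)
  show ?case
  proof (cases m)
    case 0
    then show ?thesis using assms by (simp add: hurwitz_def)
  next
    case (Suc m')
    have "hurwitz (hurwitz (dpow l f) (shift f)) f m' = hurwitz (hurwitz (dpow l f) f) (shift f) m'"
    proof -
      have "hurwitz (shift f) f = hurwitz f (shift f)"
        by (rule ext) (rule hurwitz_commute)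
      then show ?thesis by (simp only: hurwitz_assoc)
    qed
    have eq: "hurwitz (hurwitz (dpow l f) f) (shift f) m' = of_nat (Suc l) * hurwitz (dpow (Suc l) f) (shift f) m'"
    proof -
      have "hurwitz (dpow l f) f = (\<lambda>m. of_nat (Suc l) * dpow (Suc l) f m)"
        by (rule ext) (rule Suc.IH[symmetric])
      then show ?thesis by (simp only: hurwitz_scale_left)
    qed
    have "hurwitz (dpow (Suc l) f) f m = hurwitz (hurwitz (dpow l f) (shift f)) f m' + hurwitz (dpow (Suc l) f) (shift f) m'"
      unfolding Suc hurwitz_shift by (simp only: dpow_shift)
    also have "hurwitz (hurwitz (dpow l f) (shift f)) f m' = hurwitz (hurwitz (dpow l f) f) (shift f) m'"
      by fact
    also note eq
    also have "of_nat (Suc l) * hurwitz (dpow (Suc l) f) (shift f) m' + hurwitz (dpow (Suc l) f) (shift f) m' =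
        of_nat (Suc (Suc l)) * hurwitz (dpow (Suc l) f) (shift f) m'"
      by (simp add: algebra_simps)
    finally show ?thesis unfolding Suc by (simp only: dpow_shift)
  qed
qed

lemma dpow_1: "f 0 = 0 \<Longrightarrow> dpow (Suc 0) f m = f m"
  using dpow_mult[of f 0 m]
  by (auto simp: hurwitz_def if_distrib[of "\<lambda>x. x * _"] if_distrib[of "\<lambda>x. _ * x"] cong: if_cong)

text \<open>A product of \<open>l\<close> factors of \<open>f\<close> with two or more of them of degree at least \<open>r\<close> has degree at least
  \<open>l + 2 * (r - 1)\<close>; below that bound at most one factor is not linear.\<close>

lemma dpow_gap:
  assumes "f 0 = 0" "f 1 = 1" "\<And>i. 2 \<le> i \<Longrightarrow> i < r \<Longrightarrow> f i = 0" "2 \<le> r" "m < Suc l + 2 * (r - 1)"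
  shows "dpow (Suc l) f m = (if m \<le> l then 0 else if m = Suc l then 1 else of_nat (m choose l) * f (m - l))"
  using assms(5)
proof (induction l arbitrary: m)
  case 0
  then show ?case using assms(1,2) by (auto simp: dpow_1)
next
  case (Suc l)
  show ?case
  proof (cases m)
    case (Suc m')
    have m': "m' < Suc l + 2 * (r - 1)" using Suc.prems Suc by simp
    have IH: "dpow (Suc l) f i = (if i \<le> l then 0 else if i = Suc l then 1 else of_nat (i choose l) * f (i - l))"
      if "i \<le> m'" for i using Suc.IH[of i] that m' by simp
    let ?t = "\<lambda>i. of_nat (m' choose i) * dpow (Suc l) f i * f (Suc (m' - i))"
    consider "m' \<le> l" | "m' = Suc l" | "m' > Suc l" by linarith
    then show ?thesis
    proof cases
      case 1
      then show ?thesis unfolding Suc by (auto simp: IH simp del: dpow.simps(3) simp add: dpow.simps(3)[of "Suc l"])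
    next
      case 2
      have "(\<Sum>i\<le>m'. ?t i) = (\<Sum>i\<in>{Suc l}. ?t i)"
        using 2 by (intro sum.mono_neutral_right) (auto simp: IH)
      then show ?thesis using 2 assms(2) unfolding Suc dpow.simps(3)[of "Suc l"] by (simp add: IH)
    next
      case 3
      have "(\<Sum>i\<le>m'. ?t i) = (\<Sum>i\<in>{Suc l, m'}. ?t i)"
      proof (intro sum.mono_neutral_right ballI)
        fix i assume i: "i \<in> {..m'} - {Suc l, m'}"
        show "?t i = 0"
        proof (cases "i \<le> l")
          case False
          \<comment> \<open>If both \<open>i - l\<close> and \<open>Suc (m' - i)\<close> were at
            least \<open>r\<close>, then \<open>m'\<close> would be at least
            \<open>l + 2 * r - 1\<close>, against the degree bound.\<close>
          then have "i - l < r \<or> Suc (m' - i) < r" using i m' by auto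
          then have "f (i - l) = 0 \<or> f (Suc (m' - i)) = 0"
            using i False by (auto intro!: assms(3))
          then show ?thesis using i False by (auto simp: IH)
        qed (use i in \<open>auto simp: IH\<close>)
      qed (use 3 in auto)
      \<comment> \<open>In the two surviving terms the nonlinear factor is the last one or among the
        first \<open>Suc l\<close>; Pascal's rule combines them.\<close>
      also have "\<dots> = of_nat (m' choose Suc l) * f (Suc (m' - Suc l)) + of_nat (m' choose l) * f (m' - l)"
        using 3 assms(2) by (simp add: IH del: dpow.simps)
      also have "\<dots> = of_nat (Suc m' choose Suc l) * f (m' - l)"
        using 3 by (simp add: Suc_diff_Suc algebra_simps)
      finally show ?thesis using 3 unfolding Suc dpow.simps(3)[of "Suc l"] by simp
    qed
  qed simp
qed

lemma scomp_eq_sum: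
  assumes "g 0 = 0"
  shows "scomp g f m = (\<Sum>l<m. g (Suc l) * dpow (Suc l) f m)"
proof (cases m)
  case (Suc m')
  then show ?thesis
    unfolding scomp_def Suc by (subst sum.atMost_Suc_shift) (simp add: assms lessThan_Suc_atMost)
qed (simp add: scomp_def assms)

lemma scomp_0: "scomp g f 0 = g 0"
  by (simp add: scomp_def)

subsection \<open>Dyadic integers\<close>

lemma residue_bounds: "0 \<le> residue x n" "residue x n < 2 ^ n"
  using residue[of x] by auto

lemma residue_mod_Suc: "residue x (Suc n) mod 2 ^ n = residue x n"
  using residue[of x] by auto

lemma residue_mod: "n \<le> k \<Longrightarrow> residue x k mod 2 ^ n = residue x n"
proof (induction k rule: dec_induct)
  case base
  then show ?case using residue_bounds[of x n] by simp
next
  case (step k)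
  have "residue x (Suc k) mod 2 ^ n = residue x (Suc k) mod 2 ^ k mod 2 ^ n"
    using step by (simp add: mod_mod_cancel le_imp_power_dvd)
  then show ?case using step by (simp add: residue_mod_Suc)
qed

lemma residue_eqI: "(\<And>n. residue x n = residue y n) \<Longrightarrow> x = y"
  by (rule residue_inject[THEN iffD1]) (rule ext)

lemma residue_of_nat: "residue (of_nat k) n = int k mod 2 ^ n"
  by (induction k) (simp_all add: zero_dyadic.rep_eq one_dyadic.rep_eq plus_dyadic.rep_eq mod_simps)

lemma residue_of_int: "residue (of_int k) n = k mod 2 ^ n"
proof (cases k)
  case (neg m)
  have "residue (- of_nat (Suc m)) n = (- int (Suc m)) mod 2 ^ n"
    by (simp only: uminus_dyadic.rep_eq residue_of_nat mod_minus_eq)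
  then show ?thesis unfolding neg by (simp del: of_nat_Suc)
qed (simp add: residue_of_nat)

section \<open>Inverses of odd integers\<close>

lemma odd_power_cong:
  fixes c :: int
  assumes "odd c"
  shows "2 ^ n dvd c ^ (2 ^ n) - 1"
proof (induction n)
  case (Suc n)
  have "c ^ (2 ^ Suc n) - 1 = (c ^ (2 ^ n) + 1) * (c ^ (2 ^ n) - 1)"
  proof -
    have "c ^ (2 ^ Suc n) = c ^ (2 ^ n) * c ^ (2 ^ n)"
      unfolding power_add[symmetric] by (simp add: mult_2)
    then show ?thesis by (simp only:) (simp add: algebra_simps)
  qed
  moreover have "2 dvd c ^ (2 ^ n) + 1"
    using assms by simp
  ultimately show ?case
    using Suc by (simp add: mult_dvd_mono)
qed simp

text \<open>The powers \<open>c ^ (2 ^ n - 1)\<close> invert \<open>c\<close> modulo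
  \<open>2 ^ n\<close> by \<open>odd_power_cong\<close>, and they are coherent for the same
  reason.\<close>

lemma odd_unit:
  assumes "odd c"
  obtains y :: dyadic where "of_int c * y = 1"
proof
  define z where "z n = c ^ (2 ^ n - 1)" for n :: nat
  have cz: "2 ^ n dvd c * z n - 1" for n
    using odd_power_cong[OF assms, of n] unfolding z_def
    by (metis power_eq_if zero_neq_numeral power_not_zero)
  have "z (Suc n) mod 2 ^ n = z n mod 2 ^ n" for n
  proof -
    have e: "2 ^ Suc n - 1 = (2 ^ n - 1) + (2 ^ n :: nat)" by simp
    have "z (Suc n) - z n = z n * (c ^ (2 ^ n) - 1)"
      unfolding z_def e power_add by (simp add: algebra_simps)
    then show ?thesis
      using odd_power_cong[OF assms, of n] by (simp add: mod_eq_dvd_iff)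
  qed
  then have mem: "(\<lambda>n. z n mod 2 ^ n) \<in> {x. \<forall>n. x n \<in> {0..<2 ^ n} \<and> x (Suc n) mod 2 ^ n = x n}"
    using coherent_mod[of z] by blast
  show "of_int c * Abs_dyadic (\<lambda>n. z n mod 2 ^ n) = 1"
  proof (rule residue_eqI)
    fix n
    have "c * z n mod 2 ^ n = 1 mod 2 ^ n"
      using cz[of n] by (simp only: mod_eq_dvd_iff)
    then show "residue (of_int c * Abs_dyadic (\<lambda>n. z n mod 2 ^ n)) n = residue 1 n"
      by (simp add: times_dyadic.rep_eq residue_of_int Abs_dyadic_inverse[OF mem] one_dyadic.rep_eq mod_simps)
  qed
qed

text \<open>Identities for divided powers are first proved multiplied by a positive integer; this
  class permits cancelling it, also in iterated polynomial rings over the dyadic integers.\<close>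

class torsion_free = comm_ring_1 +
  assumes torsion: "of_nat (Suc k) * x = 0 \<Longrightarrow> x = 0"

lemma of_nat_cancel:
  fixes x y :: "'a::torsion_free"
  assumes "0 < k" "of_nat k * x = of_nat k * y"
  shows "x = y"
proof -
  obtain j where j: "k = Suc j" using assms(1) by (cases k) auto
  have "of_nat (Suc j) * (x - y) = 0"
    using assms(2) unfolding j right_diff_distrib by (simp only: diff_self)
  from torsion[OF this] show ?thesis by simp
qed

lemma nat_odd_part:
  assumes "0 < n"
  obtains v c :: nat where "n = 2 ^ v * c" "odd c"
  using assms
proof (induction n arbitrary: thesis rule: less_induct)
  case (less n)
  show ?case
  proof (cases "odd n")
    case True
    then show ?thesis using less.prems(1)[of 0 n] by simp
  next
    case False
    then obtain k where k: "n = 2 * k" by auto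
    with less.prems(2) have "k < n" "0 < k" by auto
    with less.IH obtain v c where "k = 2 ^ v * c" "odd c" by metis
    then show ?thesis using less.prems(1)[of "Suc v" c] k by simp
  qed
qed

instance dyadic :: torsion_free
proof
  fix k :: nat and x :: dyadic
  assume *: "of_nat (Suc k) * x = 0"
  obtain v c where k: "Suc k = 2 ^ v * c" "odd c"
    using nat_odd_part[of "Suc k"] by auto
  show "x = 0"
  proof (rule residue_eqI)
    fix n
    \<comment> \<open>Cancelling \<open>2 ^ v\<close> costs \<open>v\<close> binary digits, so
      \<open>residue x n\<close> is read off from the residue at \<open>n + v\<close>.\<close>
    have "residue (of_nat (Suc k) * x) (n + v) = 0"
      by (simp only: *) (simp add: zero_dyadic.rep_eq)
    then have "(2 ^ (n + v) :: int) dvd int (Suc k) * residue x (n + v)"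
      by (simp only: times_dyadic.rep_eq residue_of_nat mod_mult_left_eq mod_eq_0_iff_dvd)
    then have "(2 ^ v * 2 ^ n :: int) dvd 2 ^ v * (int c * residue x (n + v))"
      unfolding k by (simp add: power_add mult_ac)
    then have "(2 ^ n :: int) dvd int c * residue x (n + v)"
      by simp
    then have "(2 ^ n :: int) dvd residue x (n + v)"
      using k(2) by (simp add: coprime_dvd_mult_right_iff)
    then show "residue x n = residue 0 n"
      using residue_mod[of n "n + v" x] by (simp add: zero_dyadic.rep_eq)
  qed
qed

instance poly_mapping :: (comm_monoid_add, torsion_free) torsion_free
proof
  fix k :: nat and x :: "'a \<Rightarrow>\<^sub>0 'b"
  assume *: "of_nat (Suc k) * x = 0"
  have lookup: "Poly_Mapping.lookup (of_nat n * x) a = of_nat n * Poly_Mapping.lookup x a" for n a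
    by (induction n) (simp_all add: distrib_right lookup_add)
  show "x = 0"
  proof (rule poly_mapping_eqI)
    fix a
    have "Poly_Mapping.lookup (of_nat (Suc k) * x) a = 0"
      by (simp only: * lookup_zero)
    then have "of_nat (Suc k) * Poly_Mapping.lookup x a = 0"
      by (simp only: lookup)
    then have "Poly_Mapping.lookup x a = 0"
      by (rule torsion)
    then show "Poly_Mapping.lookup x a = Poly_Mapping.lookup 0 a"
      by (simp only: lookup_zero)
  qed
qed

section \<open>Dyadic divisibility of factorials\<close>

text \<open>\<open>c\<close> is the product of the odd numbers below \<open>2 * j\<close>.\<close>

lemma fact_double: "\<exists>c. odd c \<and> fact (2 * j) = 2 ^ j * fact j * (c :: nat)"
proof (induction j)
  case (Suc j)
  then obtain c where "odd c" "fact (2 * j) = 2 ^ j * fact j * (c :: nat)" by auto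
  then show ?case
    by (intro exI[of _ "(2 * j + 1) * c"]) (simp add: algebra_simps)
qed simp

text \<open>Halving \<open>k\<close> with \<open>fact_double\<close> shows that the exponent of two
  in \<open>k!\<close> is at most \<open>k - 1\<close>; after inversion of the odd part this makes
  \<open>2 ^ (k - 1) / k!\<close> dyadic.\<close>

lemma fact_dvd: "0 < k \<Longrightarrow> \<exists>c. odd c \<and> fact k dvd 2 ^ (k - 1) * (c :: nat)"
proof (induction k rule: less_induct)
  case (less k)
  show ?case
  proof (cases "k = 1")
    case False
    define j where "j = k div 2"
    from less.prems False have j: "0 < j" "j < k" by (auto simp: j_def)
    obtain c where c: "odd c" "fact j dvd 2 ^ (j - 1) * (c :: nat)" using less.IH[OF j(2,1)] by blast
    obtain d where d: "odd d" "fact (2 * j) = 2 ^ j * fact j * (d :: nat)" using fact_double[of j] by blast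
    have "fact (2 * j) dvd 2 ^ j * (2 ^ (j - 1) * c) * d"
      unfolding d(2) by (intro mult_dvd_mono dvd_refl c)
    also have "2 ^ j * (2 ^ (j - 1) * c) * d = 2 ^ (2 * j - 1) * (c * d)"
    proof -
      have "2 * j - 1 = j + (j - 1)" using j by simp
      then show ?thesis by (simp only: power_add mult_ac)
    qed
    finally have *: "fact (2 * j) dvd 2 ^ (2 * j - 1) * (c * d)" .
    show ?thesis
    proof (cases "even k")
      case True
      then have k: "k = 2 * j" by (simp add: j_def)
      show ?thesis unfolding k using * c(1) d(1) by (intro exI[of _ "c * d"]) simp
    next
      case False
      then have k: "k = Suc (2 * j)" by (simp add: j_def)
      have "fact k dvd k * (2 ^ (2 * j - 1) * (c * d))"
        unfolding k fact_Suc of_nat_id using * by (intro mult_dvd_mono) auto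
      also have "\<dots> dvd 2 ^ (k - 1) * (k * (c * d))"
        using k j by (subst mult.left_commute) (intro mult_dvd_mono le_imp_power_dvd dvd_refl, simp)
      finally show ?thesis using c(1) d(1) False by (intro exI[of _ "k * (c * d)"]) simp
    qed
  qed (auto intro: exI[of _ 1])
qed

lemma fact_dvd_dyadic: "\<exists>x :: dyadic. 0 < k \<longrightarrow> of_nat (fact k) * x = 2 ^ (k - 1)"
proof (cases "0 < k")
  case True
  then obtain c where c: "odd c" "fact k dvd 2 ^ (k - 1) * (c :: nat)" using fact_dvd by blast
  then obtain d where d: "2 ^ (k - 1) * c = fact k * d" by (auto elim: dvdE)
  obtain y :: dyadic where y: "of_int (int c) * y = 1" using odd_unit[of "int c"] c by auto
  have "of_nat (fact k) * (of_nat d * y) = of_nat (2 ^ (k - 1) * c) * y"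
    unfolding d by (simp only: of_nat_mult mult.assoc)
  also have "\<dots> = 2 ^ (k - 1)"
    using y by (simp add: mult.assoc)
  finally show ?thesis by blast
qed simp

text \<open>The dyadic integer \<open>2 ^ (k - 1) / k!\<close>; the value at \<open>0\<close> is a convention.\<close>

definition lam :: "nat \<Rightarrow> dyadic" where
  "lam k = (if k = 0 then 0 else SOME x. of_nat (fact k) * x = 2 ^ (k - 1))"

lemma lam_0 [simp]: "lam 0 = 0"
  by (simp add: lam_def)

lemma fact_lam: "0 < k \<Longrightarrow> of_nat (fact k) * lam k = 2 ^ (k - 1)"
proof -
  assume k: "0 < k"
  then have "\<exists>x :: dyadic. of_nat (fact k) * x = 2 ^ (k - 1)"
    using fact_dvd_dyadic[of k] by blast
  from someI_ex[OF this] k show ?thesis by (simp only: lam_def if_not_P neq0_conv)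
qed

lemma lam_1 [simp]: "lam (Suc 0) = 1"
proof -
  have "of_nat (fact 1) * lam 1 = 2 ^ (1 - 1)"
    by (rule fact_lam) (rule zero_less_one)
  then have "lam 1 = 1"
    by (simp only: fact_1 of_nat_1 mult_1 diff_self_eq_0 power_0)
  then show ?thesis
    by (simp only: One_nat_def)
qed

lemma lam_2 [simp]: "lam 2 = 1"
proof (rule of_nat_cancel)
  show "of_nat 2 * lam 2 = of_nat 2 * 1"
    using fact_lam[OF zero_less_numeral, of "num.Bit0 num.One"] by (simp only: fact_2) simp
qed simp

lemma lam_Suc: 
  assumes "0 < k"
  shows "of_nat (Suc k) * lam (Suc k) = 2 * lam k"
proof (rule of_nat_cancel)
  have "of_nat (fact k) * (of_nat (Suc k) * lam (Suc k)) = of_nat (fact (Suc k)) * lam (Suc k)"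
    by (metis fact_Suc of_nat_id of_nat_mult mult.assoc mult.commute)
  also have "\<dots> = 2 * 2 ^ (k - 1)"
    unfolding fact_lam[OF zero_less_Suc] using assms by (cases k) simp_all
  also have "\<dots> = of_nat (fact k) * (2 * lam k)"
    unfolding fact_lam[OF assms, symmetric] by (simp only: mult.left_commute)
  finally show "of_nat (fact k) * (of_nat (Suc k) * lam (Suc k)) = of_nat (fact k) * (2 * lam k)" .
qed (simp add: fact_gt_zero)

text \<open>The exponents of two in \<open>lam i * lam j\<close> and \<open>lam (i + j)\<close>
  differ by one, whence the factor \<open>2\<close>. For a zero index the convention
  \<open>lam 0 = 0\<close> would break the identity.\<close>

lemma lam_mult:
  assumes "0 < i" "0 < j"
  shows "2 * (lam i * lam j) = of_nat (i + j choose i) * lam (i + j)"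
proof (rule of_nat_cancel)
  have "of_nat (fact i * fact j) * (2 * (lam i * lam j)) =
      2 * ((of_nat (fact i) * lam i) * (of_nat (fact j) * lam j))"
    unfolding of_nat_mult by (simp add: ac_simps)
  also have "\<dots> = 2 ^ (i + j - 1)"
    unfolding fact_lam[OF assms(1)] fact_lam[OF assms(2)]
    using assms by (cases i; cases j) (simp_all add: power_add)
  also have "\<dots> = of_nat (fact i * fact j * (i + j choose i)) * lam (i + j)"
  proof -
    have "fact i * fact j * (i + j choose i) = (fact (i + j) :: nat)"
      using binomial_fact_lemma[of i "i + j"] by simp
    moreover have "0 < i + j" using assms by simp
    ultimately show ?thesis by (simp only: fact_lam)
  qed
  finally show "of_nat (fact i * fact j) * (2 * (lam i * lam j)) =
      of_nat (fact i * fact j) * (of_nat (i + j choose i) * lam (i + j))"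
    unfolding of_nat_mult by (simp add: ac_simps)
qed (simp add: fact_gt_zero)

subsection \<open>Parity of binomial coefficients\<close>

text \<open>The last binary digit in Lucas' theorem for the prime two; of two applications of
  Pascal's rule only the outer terms remain modulo two.\<close>

lemma parity_choose_double:
  shows "even (2 * n choose (2 * k)) \<longleftrightarrow> even (n choose k)"
    and "even (2 * n choose Suc (2 * k))"
proof (induction n arbitrary: k)
  case (Suc n)
  have two: "Suc (Suc m) choose Suc (Suc j) = (m choose j) + 2 * (m choose Suc j) + (m choose Suc (Suc j))" for m j :: nat
    by simp
  have n: "2 * Suc n = Suc (Suc (2 * n))" and k: "2 * Suc j = Suc (Suc (2 * j))" for j by simp_all
  { case 1
    show ?case
    proof (cases k)
      case (Suc j)
      have "even (2 * Suc n choose (2 * Suc j)) \<longleftrightarrow> even (2 * n choose (2 * j)) = even (2 * n choose (2 * Suc j))"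
        unfolding n k two by simp
      then show ?thesis unfolding Suc Suc.IH by simp
    qed simp
  next
    case 2
    show ?case
    proof (cases k)
      case (Suc j)
      have "even (2 * Suc n choose Suc (2 * Suc j)) \<longleftrightarrow>
          even (2 * n choose Suc (2 * j)) = even (2 * n choose Suc (2 * Suc j))"
        unfolding n k two by simp
      then show ?thesis unfolding Suc using Suc.IH(2)[of j] Suc.IH(2)[of "Suc j"] by blast
    qed simp
  }
next
  case 0
  { case 1
    show ?case by (cases k) auto
  next
    case 2
    show ?case by simp
  }
qed

lemma parity_choose_Suc_double: "even (Suc (2 * n) choose (2 * k)) \<longleftrightarrow> even (n choose k)"
proof (cases k)
  case (Suc k')
  have "Suc (2 * n) choose (2 * Suc k') = (2 * n choose Suc (2 * k')) + (2 * n choose (2 * Suc k'))"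
    by simp
  then show ?thesis
    unfolding Suc using parity_choose_double[of n] by (metis even_add)
qed simp

lemma parity_choose_power: "even (2 ^ v * m choose (2 ^ v * i)) \<longleftrightarrow> even (m choose i)"
  by (induction v) (simp_all add: parity_choose_double mult.assoc)

lemma odd_choose_odd_part: "odd m \<Longrightarrow> odd (2 ^ v * m choose 2 ^ v)"
  using parity_choose_power[of v m 1] by simp

lemma even_choose_odd:
  assumes "even n" "odd k"
  shows "even (n choose k)"
  using assms parity_choose_double(2)[of "n div 2" "k div 2"] by simp

lemma odd_choose_mid: "odd (2 * 2 ^ e - 1 choose 2 ^ e)"
proof (induction e)
  case (Suc e)
  have "2 * 2 ^ Suc e - 1 = Suc (2 * (2 * 2 ^ e - 1 :: nat))"
    by (rule nat.inject[THEN iffD1]) (cases "(2::nat) ^ e"; simp)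
  then show ?case
    using Suc parity_choose_Suc_double[of "2 * 2 ^ e - 1" "2 ^ e"] by simp
qed simp

text \<open>The witness is the power of two dividing whichever of \<open>k\<close> and
  \<open>Suc k\<close> is even. That number is not itself a power of two, so its odd part is at
  least \<open>3\<close>, which leaves room below \<open>k\<close>.\<close>

lemma odd_choose_exists:
  assumes "\<And>e. k \<noteq> 2 ^ e" "\<And>e. Suc k \<noteq> 2 ^ e" "1 \<le> k"
  obtains a where "2 \<le> a" "a < k" "odd (Suc k choose a)"
proof -
  define n where "n = (if even k then k else Suc k)"
  have n: "even n" "0 < n" "n \<noteq> 2 ^ e" for e
    using assms by (auto simp: n_def)
  obtain v c :: nat where vc: "n = 2 ^ v * c" "odd c" by (rule nat_odd_part[OF n(2)])
  have "v \<noteq> 0" using vc n(1) by (intro notI) auto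
  then obtain v' where v': "v = Suc v'" by (cases v) auto
  have "c \<noteq> 1" using vc n(3)[of v] by auto
  then have "3 \<le> c" using vc(2) by (cases c; cases "c = 2"; auto simp: numeral_eq_Suc intro: Suc_leI)
  then have le: "3 * 2 ^ v \<le> n" using vc(1) by simp
  have "(1 :: nat) \<le> 2 ^ v'" by simp
  then have two: "2 \<le> (2 :: nat) ^ v" by (simp add: v')
  have o: "odd (n choose 2 ^ v)" unfolding vc(1) by (rule odd_choose_odd_part) fact
  \<comment> \<open>For even \<open>k\<close>, Pascal's rule adds
    \<open>k choose (2 ^ v - 1)\<close>, which is even because its lower entry is odd.\<close>
  have "odd (Suc k choose 2 ^ v)"
  proof (cases "even k")
    case True
    obtain u where u: "2 ^ v = Suc u" using two by (cases "(2 :: nat) ^ v") auto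
    have "even ((2 :: nat) ^ v)" by (simp add: v')
    then have "odd u" unfolding u by simp
    then have "even (k choose u)" using True by (intro even_choose_odd)
    then show ?thesis using o True unfolding u n_def by simp
  qed (use o in \<open>simp add: n_def\<close>)
  moreover have "2 ^ v < k" using le two unfolding n_def by (auto split: if_splits)
  ultimately show thesis using two that by blast
qed

text \<open>Duality over the field with two elements, with Nakayama's lemma built in: elimination of one coordinate at a
  time finds a nonzero linear functional modulo two, given as the set \<open>G\<close> of coordinates it adds up.\<close>

lemma odd_saturated_subgroup:
  fixes A :: "('a \<Rightarrow> int) set"
  assumes "finite P"
    and zero: "(\<lambda>_. 0) \<in> A"
    and add: "\<And>a b. a \<in> A \<Longrightarrow> b \<in> A \<Longrightarrow> (\<lambda>x. a x + b x) \<in> A"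
    and scale: "\<And>c a. a \<in> A \<Longrightarrow> (\<lambda>x. c * a x) \<in> A"
    and odd: "\<And>c a. odd c \<Longrightarrow> (\<lambda>x. c * a x) \<in> A \<Longrightarrow> a \<in> A"
    and local: "\<And>a b. (\<And>x. x \<in> P \<Longrightarrow> a x = b x) \<Longrightarrow> a \<in> A \<Longrightarrow> b \<in> A"
    and "v \<notin> A"
  shows "\<exists>G \<subseteq> P. G \<noteq> {} \<and> (\<forall>a \<in> A. even (\<Sum>x\<in>G. a x))"
  using assms
proof (induction P arbitrary: A v rule: finite_induct)
  case empty
  from empty(5)[of "\<lambda>_. 0" v] empty(1,6) show ?case by simp
next
  case (insert y P)
  note zero = insert.prems(1) and add = insert.prems(2) and scale = insert.prems(3)
    and odd = insert.prems(4) and local = insert.prems(5)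
  show ?case
  proof (cases "\<forall>a \<in> A. even (a y)")
    case True
    then show ?thesis by (intro exI[of _ "{y}"]) auto
  next
    case False
    then obtain a where a: "a \<in> A" "odd (a y)" by auto
    \<comment> \<open>\<open>?red\<close> eliminates the coordinate \<open>y\<close> with the pivot
      \<open>a\<close>; \<open>B\<close> consists of the \<open>b\<close> that lie in
      \<open>A\<close> after their coordinate \<open>y\<close> is set to zero.\<close>
    let ?cut = "\<lambda>b x. if x = y then 0 else b x"
    let ?red = "\<lambda>b x. a y * b x - b y * a x"
    define B where "B = {b. ?cut b \<in> A}"
    have red: "?red b \<in> B" if "b \<in> A" for b
    proof -
      have "?cut (?red b) = (\<lambda>x. a y * b x + (- b y) * a x)" by auto
      then show ?thesis using add[OF scale[OF that, of "a y"] scale[OF a(1), of "- b y"]] unfolding B_def by simp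
    qed
    have "\<exists>G \<subseteq> P. G \<noteq> {} \<and> (\<forall>b \<in> B. even (\<Sum>x\<in>G. b x))"
    proof (rule insert.IH)
      show "(\<lambda>_. 0) \<in> B" using zero by (simp add: B_def)
      show "(\<lambda>x. b x + c x) \<in> B" if "b \<in> B" "c \<in> B" for b c
      proof -
        have "?cut (\<lambda>x. b x + c x) = (\<lambda>x. ?cut b x + ?cut c x)" by auto
        then show ?thesis using that add[of "?cut b" "?cut c"] by (simp add: B_def)
      qed
      have sc: "?cut (\<lambda>x. k * b x) = (\<lambda>x. k * ?cut b x)" for b and k :: int by auto
      show "(\<lambda>x. k * b x) \<in> B" if "b \<in> B" for b k
        using that scale[of "?cut b" k] by (simp only: B_def sc mem_Collect_eq)
      show "b \<in> B" if "odd k" "(\<lambda>x. k * b x) \<in> B" for b k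
        using that odd[of k "?cut b"] unfolding B_def mem_Collect_eq sc by blast
      show "c \<in> B" if "\<And>x. x \<in> P \<Longrightarrow> b x = c x" "b \<in> B" for b c
        using local[of "?cut b" "?cut c"] that unfolding B_def mem_Collect_eq by fastforce
      show "?red v \<notin> B"
      proof
        assume "?red v \<in> B"
        moreover have "?cut (?red v) = ?red v" by auto
        ultimately have "?red v \<in> A" by (simp add: B_def)
        \<comment> \<open>Undoing the elimination gives \<open>a y * v\<close>; the odd pivot
          cancels by the saturation hypothesis.\<close>
        from add[OF this scale[OF a(1), of "v y"]] have "(\<lambda>x. a y * v x) \<in> A" by simp
        with odd[OF a(2)] insert.prems(6) show False by blast
      qed
    qed
    then obtain G where G: "G \<subseteq> P" "G \<noteq> {}" "\<And>b. b \<in> B \<Longrightarrow> even (\<Sum>x\<in>G. b x)" by auto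
    then have fin: "finite G" "y \<notin> G" using insert.hyps finite_subset by auto
    \<comment> \<open>Modulo two, the sum of \<open>b\<close> over \<open>G\<close> equals
      \<open>b y\<close> times the sum of \<open>a\<close> over \<open>G\<close>. Depending on the
      parity of the latter sum, \<open>G\<close> works unchanged or with \<open>y\<close>
      added.\<close>
    have ev: "even (a y * (\<Sum>x\<in>G. b x) - b y * (\<Sum>x\<in>G. a x))" if "b \<in> A" for b
      using G(3)[OF red[OF that]] by (simp add: sum_subtractf sum_distrib_left)
    show ?thesis
    proof (cases "even (\<Sum>x\<in>G. a x)")
      case True
      then have "even (\<Sum>x\<in>G. b x)" if "b \<in> A" for b
        using ev[OF that] a(2) by simp
      with G show ?thesis by (intro exI[of _ G]) auto
    next
      case False
      then have "even (\<Sum>x\<in>insert y G. b x)" if "b \<in> A" for b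
        using ev[OF that] a(2) fin by simp
      with G show ?thesis by (intro exI[of _ "insert y G"]) auto
    qed
  qed
qed

subsection \<open>Additive polynomials modulo two\<close>

text \<open>\<open>series K x\<close> is \<open>X + \<Sum>k = 2..K. x k * X ^ k / k!\<close>; the values \<open>x 0\<close> and \<open>x 1\<close> are ignored.\<close>

definition series :: "nat \<Rightarrow> (nat \<Rightarrow> 'a::comm_ring_1) \<Rightarrow> nat \<Rightarrow> 'a" where
  "series K x k = (if k = 0 \<or> K < k then 0 else if k = 1 then 1 else x k)"

text \<open>In the composition grading \<open>var k\<close> has degree \<open>k - 1\<close>. Integer
  values keep this exact for index \<open>0\<close>, where it is \<open>-1\<close>.\<close>

definition weight :: "monom \<Rightarrow> int" where
  "weight m = (\<Sum>i \<in> Poly_Mapping.keys m. int (Poly_Mapping.lookup m i) * (int i - 1))"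

definition monoms :: "nat \<Rightarrow> monom set" where
  "monoms n = {m. Poly_Mapping.keys m \<subseteq> {2..} \<and> weight m = int n}"

lemma series_simps [simp]: "series K x 0 = 0" "1 \<le> K \<Longrightarrow> series K x 1 = 1" "1 \<le> K \<Longrightarrow> series K x (Suc 0) = 1"
  "2 \<le> k \<Longrightarrow> k \<le> K \<Longrightarrow> series K x k = x k"
  by (auto simp: series_def)

section \<open>Compositions of sparse series\<close>

text \<open>By \<open>dpow_gap\<close> no product of two nonlinear terms of \<open>f\<close> reaches
  degree \<open>m\<close>, so the composite is affine in their coefficients.\<close>

lemma scomp_gap:
  assumes "g 0 = 0" "f 0 = 0" "f 1 = 1" "\<And>i. 2 \<le> i \<Longrightarrow> i < r \<Longrightarrow> f i = 0" "2 \<le> r"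
    and m: "0 < m" "m < 2 * r - 1"
  shows "scomp g f m = g m + (\<Sum>l<m - 1. of_nat (m choose l) * g (Suc l) * f (m - l))"
proof -
  obtain m' where m': "m = Suc m'" using m(1) by (cases m) auto
  have d: "dpow (Suc l) f m = (if l = m' then 1 else of_nat (m choose l) * f (m - l))" if "l < Suc m'" for l
    using dpow_gap[OF assms(2-5), of m l] m(2) assms(5) that by (auto simp: m')
  have "scomp g f m = (\<Sum>l<Suc m'. g (Suc l) * dpow (Suc l) f m)"
    unfolding scomp_eq_sum[of g, OF assms(1)] m' by simp
  also have "\<dots> = (\<Sum>l<m'. g (Suc l) * dpow (Suc l) f m) + g m"
    unfolding sum.lessThan_Suc using d[of m'] by (simp add: m' del: dpow.simps)
  also have "(\<Sum>l<m'. g (Suc l) * dpow (Suc l) f m) = (\<Sum>l<m'. of_nat (m choose l) * g (Suc l) * f (m - l))"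
    by (intro sum.cong) (simp_all add: d mult_ac del: dpow.simps)
  finally show ?thesis by (simp add: m')
qed

definition one_term :: "nat \<Rightarrow> nat \<Rightarrow> 'a::comm_ring_1 \<Rightarrow> nat \<Rightarrow> 'a" where
  "one_term K a s = series K (\<lambda>i. if i = a then s else 0)"

lemma one_term_eq: "2 \<le> a \<Longrightarrow> a \<le> K \<Longrightarrow> one_term K a s i = (if i = 1 then 1 else if i = a then s else 0)"
  by (auto simp: one_term_def series_def)

lemma dpow_diag: "f 0 = 0 \<Longrightarrow> f 1 = 1 \<Longrightarrow> dpow l f l = 1"
  using dpow_gap[of f 2 l "l - 1"] by (cases l) auto

lemma scomp_one_term:
  assumes "2 \<le> a" "a \<le> K" "f 0 = 0"
  shows "scomp (one_term K a s) f m = f m + s * dpow a f m"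
proof -
  have g: "one_term K a s i = (if i = 1 then 1 else if i = a then s else 0)" for i
    by (rule one_term_eq) fact+
  have "scomp (one_term K a s) f m = (\<Sum>l\<le>m. (if l = 1 then dpow l f m else 0) + (if l = a then s * dpow l f m else 0))"
    unfolding scomp_def using assms(1) by (intro sum.cong) (auto simp: g)
  also have "\<dots> = f m + s * dpow a f m"
    using assms(3) dpow_eq_0[of m a f]
    by (cases m) (auto simp: sum.distrib dpow_1[of f] simp del: dpow.simps)
  finally show ?thesis .
qed

lemma dpow_one_term:
  assumes "2 \<le> b" "b \<le> K" "1 \<le> l" "m < l + 2 * (b - 1)"
  shows "dpow l (one_term K b t) m =
    (if m = l then 1 else if m = l + (b - 1) then of_nat (m choose (l - 1)) * t else 0)"
proof -
  obtain l' where l: "l = Suc l'" using assms(3) by (cases l) auto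
  have "dpow (Suc l') (one_term K b t) m = (if m \<le> l' then 0 else if m = Suc l' then 1
      else of_nat (m choose l') * one_term K b t (m - l'))"
    by (rule dpow_gap[of _ b]) (use assms l in \<open>auto simp: one_term_eq\<close>)
  then show ?thesis
    unfolding l using assms by (auto simp: one_term_eq simp del: dpow.simps)
qed

text \<open>Degree \<open>2 * b\<close> is the first one out of reach of
  \<open>dpow_one_term\<close>; the square of the second term contributes
  \<open>(2 * b)! / (2 * b! * b!)\<close>, which is \<open>2 * b - 1 choose b\<close>.\<close>

lemma dpow_2_one_term:
  assumes "2 \<le> b" "b \<le> K"
  shows "dpow 2 (one_term K b t) (2 * b) = of_nat (2 * b - 1 choose b) * t ^ 2"
proof -
  obtain c where c: "2 * b = Suc c" "c = 2 * b - 1" using assms by (cases b) auto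
  let ?f = "one_term K b t"
  have "dpow 2 ?f (2 * b) = dpow (Suc (Suc 0)) ?f (Suc c)"
    by (simp only: c(1)[symmetric] numeral_2_eq_2)
  also have "\<dots> = (\<Sum>i\<le>c. of_nat (c choose i) * ?f i * ?f (2 * b - i))"
    unfolding c(1) dpow.simps(3)[of "Suc 0"]
    by (intro sum.cong) (auto simp: dpow_1 one_term_def Suc_diff_le simp del: dpow.simps)
  also have "\<dots> = (\<Sum>i\<in>{b}. of_nat (c choose i) * ?f i * ?f (2 * b - i))"
    using assms c by (intro sum.mono_neutral_right) (auto simp: one_term_eq)
  also have "\<dots> = of_nat (2 * b - 1 choose b) * t ^ 2"
    using assms by (simp add: one_term_eq c power2_eq_square mult_ac)
  finally show ?thesis .
qed

text \<open>Homogeneity: the series is that of \<open>c\<close> after the dilation by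
  \<open>s\<close>, divided by \<open>s\<close>. Where \<open>m - l\<close> truncates,
  \<open>dpow l c m\<close> vanishes.\<close>

lemma dpow_of_int_weighted:
  "dpow l (\<lambda>i. of_int (c i) * s ^ (i - Suc 0)) m = of_int (dpow l c m) * s ^ (m - l)" if "c 0 = 0"
  for s :: "'a::comm_ring_1"
proof (induction l arbitrary: m)
  case (Suc l)
  show ?case
  proof (cases m)
    case (Suc m')
    have "of_nat (m' choose i) * (of_int (dpow l c i) * s ^ (i - l)) * (of_int (c (Suc (m' - i))) * s ^ (m' - i)) =
        of_int (of_nat (m' choose i) * dpow l c i * c (Suc (m' - i))) * s ^ (m' - l)" if "i \<le> m'" for i
    proof (cases "i < l")
      case False
      then have "m' - l = (i - l) + (m' - i)" using that by simp
      then show ?thesis by (simp add: power_add mult_ac)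
    qed (simp add: dpow_eq_0)
    then have "(\<Sum>i\<le>m'. of_nat (m' choose i) * (of_int (dpow l c i) * s ^ (i - l)) *
          (of_int (c (Suc (m' - i))) * s ^ (m' - i))) =
        (\<Sum>i\<le>m'. of_int (of_nat (m' choose i) * dpow l c i * c (Suc (m' - i))) * s ^ (m' - l))"
      by (intro sum.cong) auto
    then show ?thesis
      unfolding Suc dpow.simps Suc.IH by (simp add: sum_distrib_right)
  qed simp
qed simp

section \<open>Polynomials over the field with two elements\<close>

type_synonym bpoly = "monom \<Rightarrow>\<^sub>0 bit"

lemma bpoly_add_self [simp]: "x + x = (0 :: bpoly)"
proof (rule poly_mapping_eqI)
  fix m
  have "b + b = 0" for b :: bit
    by (simp only: mult_2[symmetric] bit_2_eq_0 mult_zero_left)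
  then show "Poly_Mapping.lookup (x + x) m = Poly_Mapping.lookup 0 m"
    by (simp only: lookup_add lookup_zero)
qed

lemma bit_of_nat: "(of_nat n :: bit) = (if even n then 0 else 1)"
  by (induction n) auto

lemma bpoly_of_nat: "(of_nat n :: bpoly) = (if even n then 0 else 1)"
  by (induction n) auto

lemma bpoly_of_int: "(of_int n :: bpoly) = (if even n then 0 else 1)"
proof -
  have "(of_int (2 * k) :: bpoly) = 0" for k
    by (simp only: mult_2 of_int_add bpoly_add_self)
  then show ?thesis by (auto elim!: evenE oddE)
qed

lemma bpoly_frobenius: "(x + y :: bpoly) ^ (2 ^ e) = x ^ (2 ^ e) + y ^ (2 ^ e)"
proof (induction e)
  case (Suc e)
  have double: "z ^ (2 ^ Suc e) = z ^ (2 ^ e) * z ^ (2 ^ e)" for z :: bpoly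
    unfolding power_add[symmetric] by (simp add: mult_2)
  have "(a + b) * (a + b) = a * a + b * b + (a * b + a * b)" for a b :: bpoly
    by (simp only: algebra_simps)
  then show ?case
    unfolding double Suc by (simp only: bpoly_add_self add_0_right)
qed simp

lemma var_power: "var i ^ k = (Poly_Mapping.single (Poly_Mapping.single i k) 1 :: monom \<Rightarrow>\<^sub>0 'a::comm_ring_1)"
  using mon_var[of "Poly_Mapping.single i k"] by simp

lemma var_power_mult:
  "var i ^ k * var j ^ l = (Poly_Mapping.single (Poly_Mapping.single i k + Poly_Mapping.single j l) 1 :: monom \<Rightarrow>\<^sub>0 'a::comm_ring_1)"
  by (simp add: var_power mult_single)

lemma single_pair_eq_iff:
  "i \<noteq> j \<Longrightarrow> Poly_Mapping.single i (k::nat) + Poly_Mapping.single j l = Poly_Mapping.single i k' + Poly_Mapping.single j l' \<longleftrightarrow> k = k' \<and> l = l'"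
proof
  assume ij: "i \<noteq> j" and eq: "Poly_Mapping.single i k + Poly_Mapping.single j l = Poly_Mapping.single i k' + Poly_Mapping.single j l'"
  from arg_cong[OF eq, of "\<lambda>m. Poly_Mapping.lookup m i"] arg_cong[OF eq, of "\<lambda>m. Poly_Mapping.lookup m j"] ij
  show "k = k' \<and> l = l'"
    by (simp add: lookup_add lookup_single)
qed simp

text \<open>If \<open>N\<close> exceeds the largest power \<open>2 ^ v\<close> dividing it, the
  mixed monomial with exponents \<open>2 ^ v\<close> and \<open>N - 2 ^ v\<close> has an odd
  coefficient by \<open>odd_choose_odd_part\<close>.\<close>

lemma additive_power:
  assumes "0 < N" "(var 0 + var 1 :: bpoly) ^ N = var 0 ^ N + var 1 ^ N"
  shows "\<exists>e. N = 2 ^ e"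
proof -
  obtain v c :: nat where vc: "N = 2 ^ v * c" "odd c" using nat_odd_part[OF assms(1)] by blast
  have "c = 1"
  proof (rule ccontr)
    assume "c \<noteq> 1"
    then have lt: "2 ^ v < N" using vc by (cases c) auto
    let ?m = "\<lambda>i. Poly_Mapping.single 0 i + Poly_Mapping.single (1::nat) (N - i)"
    have "(var 0 + var 1 :: bpoly) ^ N = (\<Sum>i\<le>N. of_nat (N choose i) * Poly_Mapping.single (?m i) 1)"
      unfolding binomial_ring by (simp only: mult.assoc var_power_mult)
    moreover have "Poly_Mapping.lookup (of_nat (N choose i) * Poly_Mapping.single (?m i) 1) (?m (2 ^ v)) =
        (if i = 2 ^ v then of_nat (N choose i) else (0 :: bit))" if "i \<le> N" for i
      unfolding lookup_of_nat_mult lookup_single by (simp add: single_pair_eq_iff when_def)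
    ultimately have "Poly_Mapping.lookup ((var 0 + var 1 :: bpoly) ^ N) (?m (2 ^ v)) =
        (\<Sum>i\<le>N. if i = 2 ^ v then of_nat (N choose i) else 0)"
      by (simp only: lookup_sum) (intro sum.cong, auto)
    also have "\<dots> = of_nat (N choose 2 ^ v)" using lt by simp
    also have "\<dots> = 1" using odd_choose_odd_part[OF vc(2), of v] unfolding vc(1) bit_of_nat by (simp only: if_False)
    finally have "Poly_Mapping.lookup (var 0 ^ N + var 1 ^ N :: bpoly) (?m (2 ^ v)) = 1"
      unfolding assms(2) .
    moreover have *: "var 0 ^ N = (Poly_Mapping.single (Poly_Mapping.single 0 N + Poly_Mapping.single 1 0) 1 :: bpoly)"
      "var 1 ^ N = (Poly_Mapping.single (Poly_Mapping.single 0 0 + Poly_Mapping.single 1 N) 1 :: bpoly)"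
      by (simp_all add: var_power)
    have "Poly_Mapping.lookup (var 0 ^ N + var 1 ^ N :: bpoly) (?m (2 ^ v)) = 0"
      unfolding * lookup_add lookup_single single_pair_eq_iff[OF zero_neq_one] when_def
      using lt by auto
    ultimately show False by simp
  qed
  with vc show ?thesis by auto
qed

section \<open>Monomials of given weight\<close>

lemma weight_superset:
  "finite A \<Longrightarrow> Poly_Mapping.keys m \<subseteq> A \<Longrightarrow> weight m = (\<Sum>i \<in> A. int (Poly_Mapping.lookup m i) * (int i - 1))"
  unfolding weight_def by (intro sum.mono_neutral_left) (auto simp: in_keys_iff)

lemma weight_add: "weight (a + b) = weight a + weight b"
proof -
  let ?A = "Poly_Mapping.keys a \<union> Poly_Mapping.keys b"
  have "weight (a + b) = (\<Sum>i \<in> ?A. int (Poly_Mapping.lookup (a + b) i) * (int i - 1))"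
    using Poly_Mapping.keys_add[of a b] by (intro weight_superset) auto
  then show ?thesis
    by (simp add: lookup_add sum.distrib weight_superset[of ?A] distrib_right)
qed

lemma weight_0 [simp]: "weight 0 = 0"
  by (simp add: weight_def)

lemma weight_single [simp]: "weight (Poly_Mapping.single k j) = int j * (int k - 1)"
  by (simp add: weight_def)

lemma monoms_term_le:
  assumes "m \<in> monoms n" "i \<in> Poly_Mapping.keys m"
  shows "int (Poly_Mapping.lookup m i) * (int i - 1) \<le> int n"
proof -
  have "int (Poly_Mapping.lookup m i) * (int i - 1) \<le> weight m"
    unfolding weight_def using assms by (intro member_le_sum) (auto simp: monoms_def)
  then show ?thesis using assms by (simp add: monoms_def)
qed

text \<open>The bound \<open>n + 1\<close> on the indices makes every cutoff \<open>K > n\<close>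
  harmless, and the bounds together make \<open>monoms n\<close> finite.\<close>

lemma monoms_bounds:
  assumes "m \<in> monoms n" "i \<in> Poly_Mapping.keys m"
  shows "2 \<le> i" "i \<le> n + 1" "Poly_Mapping.lookup m i \<le> n"
proof -
  show i: "2 \<le> i" using assms by (auto simp: monoms_def)
  have pos: "1 \<le> int (Poly_Mapping.lookup m i)" using assms(2) by (simp add: in_keys_iff)
  have "int i - 1 \<le> int (Poly_Mapping.lookup m i) * (int i - 1)"
    using mult_right_mono[OF pos, of "int i - 1"] i by simp
  with monoms_term_le[OF assms] show "i \<le> n + 1" by simp
  have "int (Poly_Mapping.lookup m i) * 1 \<le> int (Poly_Mapping.lookup m i) * (int i - 1)"
    using i by (intro mult_left_mono) auto
  with monoms_term_le[OF assms] show "Poly_Mapping.lookup m i \<le> n" by simp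
qed

lemma monoms_keys_nonempty: "m \<in> monoms n \<Longrightarrow> 1 \<le> n \<Longrightarrow> Poly_Mapping.keys m \<noteq> {}"
  by (auto simp: monoms_def weight_def)

lemma keys_subset_singleton:
  assumes "Poly_Mapping.keys m \<subseteq> {k}"
  shows "m = Poly_Mapping.single k (Poly_Mapping.lookup m k)"
  using assms by (intro poly_mapping_eqI) (auto simp: lookup_single when_def in_keys_iff)

lemma monoms_single:
  assumes "m \<in> monoms n" "Poly_Mapping.keys m \<subseteq> {k}" "int n = int N * (int k - 1)" "2 \<le> k"
  shows "m = Poly_Mapping.single k N"
proof -
  let ?j = "Poly_Mapping.lookup m k"
  have m: "m = Poly_Mapping.single k ?j" by (rule keys_subset_singleton) fact
  have "weight m = int n" using assms(1) by (simp add: monoms_def)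
  then have "int ?j * (int k - 1) = int N * (int k - 1)"
    by (subst (asm) m) (simp add: assms(3))
  then have "?j = N" using assms(4) by simp
  with m show ?thesis by simp
qed

text \<open>Up to degree \<open>a + b - 1\<close> the two nonlinear terms interact only through a
  multiple of \<open>s * t\<close> in that top degree.\<close>

lemma scomp_one_term_one_term:
  assumes "2 \<le> a" "a \<le> K" "2 \<le> b" "b \<le> K" "i \<le> a + b - 1"
  shows "scomp (one_term K a s) (one_term K b t) i =
    one_term K b t i + s * (if i = a then 1 else if i = a + b - 1 then of_nat (i choose (a - 1)) * t else 0)"
proof -
  have "scomp (one_term K a s) (one_term K b t) i = one_term K b t i + s * dpow a (one_term K b t) i"
    using assms by (intro scomp_one_term) (auto simp: one_term_def)
  moreover have "dpow a (one_term K b t) i =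
      (if i = a then 1 else if i = a + (b - 1) then of_nat (i choose (a - 1)) * t else 0)"
    using assms by (intro dpow_one_term) auto
  ultimately show ?thesis using assms(3) by simp
qed

definition eval_set :: "monom set \<Rightarrow> (nat \<Rightarrow> 'a::comm_ring_1) \<Rightarrow> 'a" where
  "eval_set G f = (\<Sum>m \<in> G. mon f m)"

lemma eval_set_cong:
  "(\<And>m i. m \<in> G \<Longrightarrow> i \<in> Poly_Mapping.keys m \<Longrightarrow> f i = g i) \<Longrightarrow> eval_set G f = eval_set G g"
  unfolding eval_set_def by (intro sum.cong mon_cong) auto

lemma var_neq_0: "var i \<noteq> (0 :: monom \<Rightarrow>\<^sub>0 'a::zero_neq_one)"
  by (metis lookup_single_eq lookup_zero var_def zero_neq_one)

text \<open>Coefficients of the series \<open>w\<close> in \<open>eliminate\<close>. Above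
  \<open>b\<close> they solve \<open>e i = c i + i * e (i - 1)\<close>, which makes
  \<open>c i + e i + i * e (i - 1)\<close> even.\<close>

primrec elim_coeff :: "(nat \<Rightarrow> int) \<Rightarrow> nat \<Rightarrow> nat \<Rightarrow> int" where
  "elim_coeff c b 0 = 0"
| "elim_coeff c b (Suc i) = (if Suc i \<le> b then 0 else c (Suc i) + int (Suc i) * elim_coeff c b i)"

lemma elim_coeff_le: "i \<le> b \<Longrightarrow> elim_coeff c b i = 0"
  by (cases i) auto

text \<open>Separates auxiliary terms from \<open>test_monom\<close>, in which \<open>var 1\<close>
  has twice the exponent of \<open>var 0\<close>; the property survives products.\<close>

definition steep :: "bpoly \<Rightarrow> bool" where
  "steep x \<longleftrightarrow> (\<forall>m \<in> Poly_Mapping.keys x. Poly_Mapping.lookup m (Suc 0) \<le> Poly_Mapping.lookup m 0)"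

lemma steep_0: "steep 0" and steep_1: "steep 1"
  by (simp_all add: steep_def)

lemma steep_mult:
  assumes "steep x" "steep y"
  shows "steep (x * y)"
  unfolding steep_def
proof
  fix m assume "m \<in> Poly_Mapping.keys (x * y)"
  then obtain a b where "m = a + b" "a \<in> Poly_Mapping.keys x" "b \<in> Poly_Mapping.keys y"
    using Poly_Mapping.keys_mult[of x y] by blast
  with assms show "Poly_Mapping.lookup m (Suc 0) \<le> Poly_Mapping.lookup m 0"
    by (simp add: steep_def lookup_add add_mono)
qed

lemma steep_mon: "(\<And>i. steep (x i)) \<Longrightarrow> steep (mon x m)"
proof -
  assume x: "\<And>i. steep (x i)"
  have "steep (x i ^ k)" for i k
    by (induction k) (auto intro: steep_1 steep_mult x)
  then have "steep (\<Prod>i\<in>A. x i ^ f i)" for A and f :: "nat \<Rightarrow> nat"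
    by (induction A rule: infinite_finite_induct) (auto intro: steep_1 steep_mult)
  then show ?thesis by (simp add: mon_def)
qed

text \<open>A set of monomials stands for the sum of its elements, a polynomial over the field with two elements.\<close>

locale additive_monomials =
  fixes G :: "monom set" and n K :: nat
  assumes fin: "finite G" and G: "G \<subseteq> monoms n" "G \<noteq> {}" and n: "1 \<le> n" and K: "n < K"
    and additive: "\<And>x y :: nat \<Rightarrow> bpoly. eval_set G (scomp (series K x) (series K y)) = eval_set G (series K x) + eval_set G (series K y)"
begin

section \<open>The leading variable and its exponent\<close>

definition lead :: nat where
  "lead = Max (\<Union>m \<in> G. Poly_Mapping.keys m)"

lemma keys_G:
  assumes "m \<in> G" "i \<in> Poly_Mapping.keys m"
  shows "2 \<le> i" "i \<le> lead" "i \<le> K"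
  using monoms_bounds[of m n i] assms G(1) K fin unfolding lead_def by (auto intro!: Max_ge)

lemma lead_key: "\<exists>m \<in> G. lead \<in> Poly_Mapping.keys m"
proof -
  have "lead \<in> (\<Union>m \<in> G. Poly_Mapping.keys m)"
    unfolding lead_def using fin G monoms_keys_nonempty[OF _ n] by (intro Max_in) auto
  then show ?thesis by blast
qed

lemma lead: "2 \<le> lead" "lead \<le> K"
  using lead_key keys_G by auto

lemma eval_set_local:
  "(\<And>i. 2 \<le> i \<Longrightarrow> i \<le> lead \<Longrightarrow> f i = g i) \<Longrightarrow> eval_set G f = eval_set G g"
  using keys_G by (intro eval_set_cong) auto

lemma eval_set_series: "eval_set G (series K x) = eval_set G x"
  using lead by (intro eval_set_local) auto

text \<open>Composing with \<open>X + z * X ^ lead / lead!\<close> on the left changes no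
  coefficient below \<open>lead\<close> and adds \<open>z\<close> to the one at \<open>lead\<close>;
  additivity then splits off the second summand.\<close>

lemma eval_set_upd_lead: "eval_set G (x(lead := x lead + z)) = eval_set G x + eval_set G (one_term K lead z)" for x :: "nat \<Rightarrow> bpoly"
proof -
  let ?f = "series K x"
  have "eval_set G (scomp (one_term K lead z) ?f) = eval_set G (x(lead := x lead + z))"
  proof (rule eval_set_local)
    fix i assume i: "2 \<le> i" "i \<le> lead"
    have "scomp (one_term K lead z) ?f i = ?f i + z * dpow lead ?f i"
      using lead by (intro scomp_one_term) auto
    moreover have "dpow lead ?f i = (if i = lead then 1 else 0)"
      using i lead by (auto intro!: dpow_eq_0 dpow_diag)
    ultimately show "scomp (one_term K lead z) ?f i = (x(lead := x lead + z)) i"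
      using i lead by auto
  qed
  then show ?thesis
    using additive[of "\<lambda>i. if i = lead then z else 0" x] by (simp add: one_term_def[symmetric] eval_set_series add.commute)
qed

lemma mon_one_term:
  assumes "2 \<le> a" "a \<le> K" "m \<in> G"
  shows "mon (one_term K a z) m = (if Poly_Mapping.keys m \<subseteq> {a} then z ^ Poly_Mapping.lookup m a else 0)"
proof (cases "Poly_Mapping.keys m \<subseteq> {a}")
  case True
  from keys_subset_singleton[OF this] show ?thesis
    using True mon_single[of "one_term K a z" a "Poly_Mapping.lookup m a"] one_term_eq[OF assms(1,2), of z a] assms(1) by simp
next
  case False
  then obtain i where i: "i \<in> Poly_Mapping.keys m" "i \<noteq> a" by auto
  then have "one_term K a z i = 0" using keys_G[OF assms(3) i(1)] by (simp add: one_term_eq[OF assms(1,2)])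
  then have "mon (one_term K a z) m = 0" using i(1) by (intro mon_eq_0)
  with False show ?thesis by simp
qed

text \<open>Let \<open>eval_set_upd_lead\<close> restore the coordinate \<open>lead\<close> of
  generic coefficients after it was set to zero. A monomial containing \<open>lead\<close> can only
  come from the second summand, so it is a power of \<open>var lead\<close>, and its weight
  \<open>n\<close> fixes the exponent.\<close>

lemma exponent: "\<exists>N. Poly_Mapping.single lead N \<in> G \<and> 0 < N \<and> int n = int N * (int lead - 1) \<and>
    (\<forall>m \<in> G. lead \<in> Poly_Mapping.keys m \<longrightarrow> m = Poly_Mapping.single lead N)"
proof -
  obtain m0 where m0: "m0 \<in> G" "lead \<in> Poly_Mapping.keys m0" using lead_key by blast
  define N where "N = Poly_Mapping.lookup m0 lead"
  have single: "m = Poly_Mapping.single lead (Poly_Mapping.lookup m lead)"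
    if m: "m \<in> G" "lead \<in> Poly_Mapping.keys m" for m
  proof -
    let ?x = "var(lead := 0) :: nat \<Rightarrow> bpoly"
    have 1: "Poly_Mapping.lookup (eval_set G var :: bpoly) m = 1"
      using m fin by (simp add: eval_set_def mon_var lookup_sum lookup_single when_def)
    have "Poly_Mapping.lookup (mon ?x m') m = 0" for m'
    proof (cases "lead \<in> Poly_Mapping.keys m'")
      case True
      then show ?thesis by (simp add: mon_eq_0[of lead])
    next
      case False
      then have "mon ?x m' = mon var m'" by (intro mon_cong) auto
      with False m(2) show ?thesis by (auto simp: mon_var lookup_single when_def)
    qed
    then have 2: "Poly_Mapping.lookup (eval_set G ?x) m = 0" by (simp add: eval_set_def lookup_sum)
    have "eval_set G (var :: nat \<Rightarrow> bpoly) = eval_set G ?x + eval_set G (one_term K lead (var lead))"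
      using eval_set_upd_lead[of ?x "var lead"] by simp
    from 1[unfolded this lookup_add 2]
    have "Poly_Mapping.lookup (eval_set G (one_term K lead (var lead :: bpoly))) m \<noteq> 0"
      by (simp only: add_0) (simp only: one_neq_zero not_False_eq_True)
    then obtain m' where m': "m' \<in> G" "Poly_Mapping.lookup (mon (one_term K lead (var lead :: bpoly)) m') m \<noteq> 0"
      unfolding eval_set_def lookup_sum by (meson sum.neutral)
    have k: "Poly_Mapping.keys m' \<subseteq> {lead}"
    proof (rule ccontr)
      assume "\<not> Poly_Mapping.keys m' \<subseteq> {lead}"
      then have "mon (one_term K lead (var lead :: bpoly)) m' = 0"
        by (simp only: mon_one_term[OF lead m'(1)] if_False)
      with m'(2) show False by (simp only: lookup_zero simp_thms)
    qed
    have "Poly_Mapping.lookup ((var lead :: bpoly) ^ Poly_Mapping.lookup m' lead) m \<noteq> 0"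
      using m'(2) by (simp only: mon_one_term[OF lead m'(1)] k if_True simp_thms)
    then have "m = Poly_Mapping.single lead (Poly_Mapping.lookup m' lead)"
      by (auto simp: var_power lookup_single when_def split: if_splits)
    then show ?thesis by (metis lookup_single_eq)
  qed
  have m0': "m0 = Poly_Mapping.single lead N" using single[OF m0] by (simp add: N_def)
  have n: "int n = int N * (int lead - 1)"
    using m0(1) G(1) unfolding m0' by (auto simp: monoms_def)
  have "m = Poly_Mapping.single lead N" if "m \<in> G" "lead \<in> Poly_Mapping.keys m" for m
  proof -
    have "Poly_Mapping.keys m \<subseteq> {lead}" by (subst single[OF that]) simp
    then show ?thesis using that(1) G(1) n lead(1) by (intro monoms_single) auto
  qed
  moreover have "0 < N" using m0(2) by (simp add: N_def in_keys_iff)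
  ultimately show ?thesis
    using m0(1) n unfolding m0' by blast
qed

definition N :: nat where
  "N = (SOME N. Poly_Mapping.single lead N \<in> G \<and> 0 < N \<and> int n = int N * (int lead - 1) \<and>
    (\<forall>m \<in> G. lead \<in> Poly_Mapping.keys m \<longrightarrow> m = Poly_Mapping.single lead N))"

lemma N: "Poly_Mapping.single lead N \<in> G" "0 < N" "int n = int N * (int lead - 1)"
  "m \<in> G \<Longrightarrow> lead \<in> Poly_Mapping.keys m \<Longrightarrow> m = Poly_Mapping.single lead N"
  using someI_ex[OF exponent] unfolding N_def by blast+

definition H :: "monom set" where
  "H = G - {Poly_Mapping.single lead N}"

lemma keys_H:
  assumes "m \<in> H" "i \<in> Poly_Mapping.keys m"
  shows "2 \<le> i" "i < lead"
proof -
  have "m \<in> G" using assms(1) by (simp add: H_def)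
  with keys_G assms(2) show "2 \<le> i" by blast
  have "i \<noteq> lead" using N(4)[of m] assms by (auto simp: H_def)
  with keys_G[OF \<open>m \<in> G\<close> assms(2)] show "i < lead" by simp
qed

lemma eval_set_split: "eval_set G f = eval_set H f + f lead ^ N"
  unfolding eval_set_def H_def using sum.remove[OF fin N(1), of "mon f"] by (simp add: add.commute)

lemma eval_set_H_local:
  "(\<And>i. 2 \<le> i \<Longrightarrow> i < lead \<Longrightarrow> f i = g i) \<Longrightarrow> eval_set H f = eval_set H g"
  using keys_H by (intro eval_set_cong) auto

text \<open>On \<open>one_term K lead z\<close> the remaining monomials \<open>H\<close> vanish, so
  additivity of \<open>G\<close> becomes additivity of \<open>z ^ N\<close>.\<close>

lemma N_power: "\<exists>e. N = 2 ^ e"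
proof (rule additive_power)
  have H0: "eval_set H (one_term K lead z) = 0" for z :: bpoly
  proof -
    have "mon (one_term K lead z) m = 0" if m: "m \<in> H" for m
    proof -
      have "m \<in> G" using m by (simp add: H_def)
      then have "Poly_Mapping.keys m \<noteq> {}" using monoms_keys_nonempty[OF _ n] G(1) by blast
      with keys_H[OF m] have "\<not> Poly_Mapping.keys m \<subseteq> {lead}" by fastforce
      then show ?thesis using mon_one_term[OF lead \<open>m \<in> G\<close>] by simp
    qed
    then show ?thesis by (simp add: eval_set_def)
  qed
  have one_term: "eval_set G (one_term K lead z) = z ^ N" for z :: bpoly
    using lead by (simp add: eval_set_split H0 one_term_eq)
  have "eval_set G ((one_term K lead (var 0))(lead := one_term K lead (var 0) lead + var 1)) = eval_set G (one_term K lead (var 0 + var 1 :: bpoly))"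
    using lead by (intro eval_set_local) (auto simp: one_term_eq)
  with eval_set_upd_lead[of "one_term K lead (var 0)" "var 1"] show "(var 0 + var 1 :: bpoly) ^ N = var 0 ^ N + var 1 ^ N"
    by (simp only: one_term)
qed (rule N)

section \<open>Excluding leading indices above two\<close>

lemma power_add_N: "(x + y :: bpoly) ^ N = x ^ N + y ^ N"
  using N_power bpoly_frobenius by auto

lemma power_add_N2: "(x + y :: bpoly) ^ (N * 2) = x ^ (N * 2) + y ^ (N * 2)"
  unfolding power_mult power_add_N using bpoly_frobenius[of "x ^ N" "y ^ N" 1] by (simp only: power_one_right)

text \<open>Additivity has a symmetric right-hand side, so \<open>G\<close> cannot see the order of
  composition.\<close>

lemma eval_set_comm: "eval_set G (scomp (one_term K a s) (one_term K b t)) = eval_set G (scomp (one_term K b t) (one_term K a s))"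
  for s t :: bpoly
  unfolding one_term_def by (simp only: additive add.commute)

lemma st_N: "(var 0 ^ i * var (Suc 0) ^ j :: bpoly) ^ N = Poly_Mapping.single (Poly_Mapping.single 0 (i * N) + Poly_Mapping.single (Suc 0) (j * N)) 1"
  unfolding power_mult_distrib power_mult[symmetric] by (rule var_power_mult)

text \<open>Contradicts maximality through the leading coefficient of a commutator.\<close>

lemma lead_not_linear:
  assumes a: "2 \<le> a" "a < lead" "odd (Suc lead choose a)"
  shows False
proof -
  \<comment> \<open>With this \<open>b\<close> the two one-term series first interact in degree
    \<open>lead = a + b - 1\<close>.\<close>
  define b where "b = Suc lead - a"
  have b: "2 \<le> b" "b < lead" "lead = a + b - 1" using a by (auto simp: b_def)
  let ?s = "var 0 :: bpoly" and ?t = "var (Suc 0) :: bpoly"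
  let ?u = "scomp (one_term K a ?s) (one_term K b ?t)" and ?v = "scomp (one_term K b ?t) (one_term K a ?s)"
  have aK: "a \<le> K" "b \<le> K" using a b lead by auto
  have "eval_set H ?u = eval_set H ?v"
    using a b aK by (intro eval_set_H_local) (auto simp: scomp_one_term_one_term one_term_eq)
  with eval_set_comm[of a ?s b ?t] have eq: "?u lead ^ N = ?v lead ^ N" by (simp add: eval_set_split)
  have uv: "?u lead = of_nat (lead choose (a - 1)) * (?s * ?t)" "?v lead = of_nat (lead choose (b - 1)) * (?s * ?t)"
    using a b aK by (simp_all add: scomp_one_term_one_term one_term_eq mult_ac)
  \<comment> \<open>The coefficients at \<open>lead\<close> for the two orders add up to the odd
    number \<open>Suc lead choose a\<close>, so exactly one of them is nonzero modulo two.\<close>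
  have "Suc lead choose a = (lead choose (a - 1)) + (lead choose (b - 1))"
  proof -
    have "b - 1 = lead - a" using b by simp
    then have "lead choose (b - 1) = lead choose a" using a by (simp add: binomial_symmetric[of a lead])
    then show ?thesis using a by (cases a) auto
  qed
  with a(3) have "even (lead choose (a - 1)) \<noteq> even (lead choose (b - 1))" by simp
  moreover have "(0 :: bpoly) ^ N = 0" "(?s * ?t) ^ N \<noteq> 0" using N(2) by (simp_all add: var_neq_0)
  ultimately show False
    using eq unfolding uv bpoly_of_nat
    by (cases "even (lead choose (a - 1))"; cases "even (lead choose (b - 1))")
       (simp_all only: if_True if_False mult_1 mult_zero_left simp_thms)
qed

text \<open>Composing the series with terms \<open>s\<close> and \<open>t\<close> in degree
  \<open>b\<close> gives, below \<open>lead\<close>, the series with term \<open>s + t\<close>, and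
  modulo two \<open>s * t\<close> at \<open>lead\<close>. As \<open>H\<close> is additive on these
  series, \<open>(s * t) ^ N\<close> would have to vanish.\<close>

lemma lead_not_mersenne:
  assumes "lead = 2 * b - 1" "b = 2 ^ e" "1 \<le> e"
  shows False
proof -
  have "(2::nat) ^ 1 \<le> 2 ^ e" using assms(3) by (intro power_increasing) auto
  then have b: "2 \<le> b" "b < lead" "b \<le> K" using assms lead by auto
  let ?s = "var 0 :: bpoly" and ?t = "var (Suc 0) :: bpoly"
  let ?u = "scomp (one_term K b ?s) (one_term K b ?t)"
  have u: "?u i = one_term K b ?t i + ?s * (if i = b then 1 else if i = lead then of_nat (lead choose (b - 1)) * ?t else 0)"
    if "i \<le> lead" for i
    using scomp_one_term_one_term[of b K b i ?s ?t] that b assms(1) by simp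
  have H: "eval_set H ?u = eval_set H (one_term K b (?s + ?t))"
    using b by (intro eval_set_H_local) (auto simp: u one_term_eq)
  have add: "eval_set H (one_term K b (?s + ?t)) = eval_set H (one_term K b ?s) + eval_set H (one_term K b ?t)"
    unfolding eval_set_def sum.distrib[symmetric]
  proof (rule sum.cong[OF refl])
    fix m assume "m \<in> H"
    then have m: "m \<in> G" by (simp add: H_def)
    show "mon (one_term K b (?s + ?t)) m = mon (one_term K b ?s) m + mon (one_term K b ?t) m"
    proof (cases "Poly_Mapping.keys m \<subseteq> {b}")
      case True
      \<comment> \<open>Since \<open>lead - 1 = 2 * (b - 1)\<close>, a power of \<open>var b\<close>
        of weight \<open>n\<close> has exponent \<open>2 * N\<close>, again a power of two.\<close>
      have "int n = int (2 * N) * (int b - 1)"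
        using N(3) assms(1) b by (simp add: of_nat_diff algebra_simps)
      from monoms_single[OF _ True this b(1)] m G(1) have "Poly_Mapping.lookup m b = N * 2"
        by auto
      then show ?thesis
        by (simp only: mon_one_term[OF b(1,3) m] True if_True power_add_N2)
    next
      case False
      then show ?thesis by (simp add: mon_one_term[OF b(1,3) m])
    qed
  qed
  have "eval_set G ?u = eval_set G (one_term K b ?s) + eval_set G (one_term K b ?t)"
    unfolding one_term_def by (rule additive)
  moreover have "one_term K b ?s lead = 0" "one_term K b ?t lead = 0" using b by (simp_all add: one_term_eq)
  moreover have "?u lead = ?s * ?t"
  proof -
    have "lead - b = b - 1" "b \<le> lead" using assms(1) b(2) by auto
    then have "lead choose (b - 1) = lead choose b"
      using binomial_symmetric[of b lead] by (simp only:)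
    moreover have "odd (2 * b - 1 choose b)" unfolding assms(2) by (rule odd_choose_mid)
    ultimately have "odd (lead choose (b - 1))" by (simp only: assms(1) simp_thms)
    then show ?thesis using b by (simp add: u one_term_eq bpoly_of_nat)
  qed
  moreover have z: "(0 :: bpoly) ^ N = 0" and "(?s * ?t) ^ N \<noteq> 0" using N(2) by (simp_all add: var_neq_0)
  ultimately show False
    by (simp add: eval_set_split H add z)
qed

text \<open>The monomial \<open>(s * t ^ 2) ^ N\<close> for \<open>s = var 0\<close> and
  \<open>t = var 1\<close>; in \<open>lead_not_power\<close> it tells the two orders of composition
  apart.\<close>

definition test_monom :: monom where
  "test_monom = Poly_Mapping.single 0 N + Poly_Mapping.single (Suc 0) (2 * N)"

text \<open>Composing with a series \<open>x + w\<close>, whose coefficients do not involve \<open>test_monom\<close>, removes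
  the coefficients of degree strictly between \<open>b\<close> and \<open>2 * b\<close>.\<close>

lemma eliminate:
  fixes f :: "nat \<Rightarrow> bpoly" and c :: "nat \<Rightarrow> int"
  assumes b: "lead = 2 * b" "3 \<le> b" "even (2 * b choose (b - 1))"
    and f: "f 2 = var 0" "f b = var (Suc 0)" "\<And>i. 2 < i \<Longrightarrow> i < b \<Longrightarrow> f i = 0"
      "\<And>i. b < i \<Longrightarrow> i < 2 * b \<Longrightarrow> f i = of_int (c i) * (var (Suc 0) * var 0 ^ (i - b))"
  shows "Poly_Mapping.lookup (eval_set G f) test_monom =
    Poly_Mapping.lookup (eval_set H (\<lambda>i. if i = 2 then var 0 else if i = b then var (Suc 0) else 0 :: bpoly)) test_monom +
    Poly_Mapping.lookup (f lead ^ N) test_monom"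
proof -
  let ?base = "\<lambda>i. if i = 2 then var 0 else if i = b then var (Suc 0) else 0 :: bpoly"
  define w :: "nat \<Rightarrow> bpoly" where
    "w i = (if b < i \<and> i < 2 * b then of_int (elim_coeff c b i) * (var (Suc 0) * var 0 ^ (i - b)) else 0)" for i
  have bK: "2 * b \<le> K" using b lead by simp
  have gap: "scomp (series K f) (series K w) i =
      f i + (\<Sum>l<i - 1. of_nat (i choose l) * series K f (Suc l) * w (i - l))" if "2 \<le> i" "i \<le> lead" for i
  proof -
    have "scomp (series K f) (series K w) i =
        series K f i + (\<Sum>l<i - 1. of_nat (i choose l) * series K f (Suc l) * series K w (i - l))"
      using that b bK by (intro scomp_gap[where r = "b + 1"]) (auto simp: w_def series_def)
    also have "(\<Sum>l<i - 1. of_nat (i choose l) * series K f (Suc l) * series K w (i - l)) =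
        (\<Sum>l<i - 1. of_nat (i choose l) * series K f (Suc l) * w (i - l))"
      using that b bK by (intro sum.cong) (auto simp: series_def)
    also have "series K f i = f i" using that b bK by simp
    finally show ?thesis .
  qed
  have low: "scomp (series K f) (series K w) i = ?base i" if i: "2 \<le> i" "i < lead" for i
  proof (cases "i \<le> b")
    case True
    have "(\<Sum>l<i - 1. of_nat (i choose l) * series K f (Suc l) * w (i - l)) = 0"
      using True by (intro sum.neutral) (auto simp: w_def)
    then show ?thesis using gap[of i] i True f b(2) by auto
  next
    case False
    \<comment> \<open>Only the linear coefficient of \<open>f\<close> and \<open>f 2\<close> meet a
      nonzero \<open>w\<close>: for \<open>2 \<le> l\<close> either \<open>w (i - l)\<close> or
      \<open>f (Suc l)\<close> is zero.\<close>
    have "(\<Sum>l<i - 1. of_nat (i choose l) * series K f (Suc l) * w (i - l)) =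
        (\<Sum>l\<in>{0, 1}. of_nat (i choose l) * series K f (Suc l) * w (i - l))"
    proof (intro sum.mono_neutral_right ballI)
      fix l assume l: "l \<in> {..<i - 1} - {0, 1}"
      show "of_nat (i choose l) * series K f (Suc l) * w (i - l) = 0"
      proof (cases "b < i - l")
        case True
        then have "f (Suc l) = 0" using l i b by (intro f(3)) auto
        then show ?thesis using l i bK b by (simp add: series_def)
      qed (simp add: w_def)
    qed (use False b in auto)
    also have "\<dots> = w i + of_nat i * (var 0 * w (i - 1))"
      using bK b by (simp add: f(1)[unfolded numeral_2_eq_2] series_def mult_ac)
    also have "of_nat i * (var 0 * w (i - 1)) =
        of_int (int i * elim_coeff c b (i - 1)) * (var (Suc 0) * var 0 ^ (i - b))"
    proof (cases "i - 1 \<le> b")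
      case True
      then show ?thesis by (simp add: w_def elim_coeff_le)
    next
      case False
      then have "i - b = Suc (i - 1 - b)" by simp
      then show ?thesis using False i b by (simp add: w_def mult_ac)
    qed
    also have "w i + \<dots> = of_int (elim_coeff c b i + int i * elim_coeff c b (i - 1)) * (var (Suc 0) * var 0 ^ (i - b))"
      using False i b by (simp add: w_def distrib_right)
    finally have "scomp (series K f) (series K w) i =
        of_int (c i + (elim_coeff c b i + int i * elim_coeff c b (i - 1))) * (var (Suc 0) * var 0 ^ (i - b))"
      using gap[of i] f(4)[of i] False i b by (simp add: distrib_right)
    \<comment> \<open>The recursion turns the total into \<open>2 * elim_coeff c b i\<close>, which
      is zero modulo two.\<close>
    moreover have "elim_coeff c b i = c i + int i * elim_coeff c b (i - 1)"
      using False by (cases i) auto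
    ultimately show ?thesis using False b by (simp add: bpoly_of_int)
  qed
  \<comment> \<open>In degree \<open>lead\<close> nothing is added: \<open>w lead\<close> is zero by
    its strict bound, the term with \<open>f 2\<close> carries the even factor \<open>lead\<close>,
    the one with \<open>f b\<close> an even binomial coefficient, and all others contain a
    zero.\<close>
  have "(\<Sum>l<lead - 1. of_nat (lead choose l) * series K f (Suc l) * w (lead - l)) = 0"
  proof (intro sum.neutral ballI)
    fix l assume l: "l \<in> {..<lead - 1}"
    consider "l = 0" | "l = 1" | "2 \<le> l" "l < b - 1" | "l = b - 1" | "b \<le> l" by linarith
    then show "of_nat (lead choose l) * series K f (Suc l) * w (lead - l) = 0"
    proof cases
      case 3
      then have "f (Suc l) = 0" using b by (intro f(3)) auto
      then show ?thesis using 3 bK by (simp add: series_def)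
    qed (use b in \<open>simp_all add: w_def bpoly_of_nat\<close>)
  qed
  then have high: "scomp (series K f) (series K w) lead = f lead"
    using gap[of lead] lead by simp
  have "eval_set H (scomp (series K f) (series K w)) = eval_set H ?base"
    using low by (intro eval_set_H_local) blast
  with high have *: "eval_set G f + eval_set G (series K w) = eval_set H ?base + f lead ^ N"
    using additive[of f w] by (simp only: eval_set_split[of "scomp (series K f) (series K w)"] eval_set_series)
  \<comment> \<open>Here \<open>0 < j\<close> matters: \<open>w\<close> starts only above degree
    \<open>b\<close>, so its terms contain \<open>var 0\<close> at least as often as
    \<open>var 1\<close>.\<close>
  have "steep (var (Suc 0) * var 0 ^ j)" if "0 < j" for j
    using that by (simp add: var_power_mult[of "Suc 0" 1, simplified] steep_def lookup_add lookup_single)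
  then have "steep (w i)" for i
    by (auto simp: w_def bpoly_of_int steep_0)
  then have "steep (series K w i)" for i
    by (auto simp: series_def steep_0 steep_1)
  then have "steep (mon (series K w) m)" for m
    by (rule steep_mon)
  moreover have "\<not> Poly_Mapping.lookup test_monom (Suc 0) \<le> Poly_Mapping.lookup test_monom 0"
    using N(2) by (simp add: test_monom_def lookup_add lookup_single)
  ultimately have "Poly_Mapping.lookup (mon (series K w) m) test_monom = 0" for m
    unfolding steep_def by (meson in_keys_iff)
  then have "Poly_Mapping.lookup (eval_set G (series K w)) test_monom = 0"
    by (simp add: eval_set_def lookup_sum)
  then show ?thesis
    using arg_cong[OF *, of "\<lambda>x. Poly_Mapping.lookup x test_monom"] by (simp only: lookup_add add_0_right)
qed

text \<open>The series \<open>X + s * X ^ 2 / 2\<close> and \<open>X + t * X ^ b / b!\<close> are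
  composed in both orders. At \<open>lead\<close> one order gives \<open>s * t ^ 2\<close>, the
  other a multiple of \<open>s ^ b * t\<close>. Below \<open>lead\<close> the composites already
  agree if \<open>b = 2\<close>; otherwise \<open>eliminate\<close> reduces both to the same values,
  as far as the coefficient of \<open>test_monom\<close> is concerned.\<close>

lemma lead_not_power:
  assumes "lead = 2 * b" "b = 2 ^ e" "1 \<le> e"
  shows False
proof -
  have "(2::nat) ^ 1 \<le> 2 ^ e" using assms(3) by (intro power_increasing) auto
  then have b: "2 \<le> b" "b < lead" "b \<le> K" "2 \<le> K" using assms lead by auto
  let ?s = "var 0 :: bpoly" and ?t = "var (Suc 0) :: bpoly"
  have sym: "scomp (one_term K 2 x) (one_term K b y) i =
      one_term K b y i + x * (if i = 2 then 1 else if i = b + 1 then of_nat i * y else if i = lead then y ^ 2 else 0)"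
    if "i \<le> lead" for i and x y :: bpoly
  proof -
    have "dpow 2 (one_term K b y) i =
        (if i = 2 then 1 else if i = b + 1 then of_nat i * y else if i = lead then y ^ 2 else 0)"
    proof (cases "i = lead")
      case True
      have "odd (2 * b - 1 choose b)" unfolding assms(2) by (rule odd_choose_mid)
      then have "dpow 2 (one_term K b y) lead = y ^ 2"
        using dpow_2_one_term[OF b(1,3), of y] by (simp only: assms(1) bpoly_of_nat if_False mult_1)
      moreover have "lead \<noteq> 2" "lead \<noteq> b + 1" using b assms(1) by auto
      ultimately show ?thesis using True by simp
    next
      case False
      then show ?thesis
        using dpow_one_term[of b K 2 i y] b assms(1) that by simp
    qed
    then show ?thesis using scomp_one_term[of 2 K "one_term K b y" x i] b by (simp add: one_term_def)
  qed
  let ?u = "scomp (one_term K 2 ?s) (one_term K b ?t)" and ?v = "scomp (one_term K b ?t) (one_term K 2 ?s)"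
  have st: "?s * ?t ^ 2 = ?s ^ 1 * ?t ^ 2" "?s ^ 2 * ?t = ?s ^ 2 * ?t ^ 1" by simp_all
  have ne: "lead \<noteq> 2" "lead \<noteq> b + 1" using b assms(1) by auto
  then have u_lead: "?u lead = ?s * ?t ^ 2" using b by (simp add: sym one_term_eq)
  show False
  proof (cases "b = 2")
    case True
    have "eval_set H ?u = eval_set H ?v"
      using b assms(1) sym unfolding True by (intro eval_set_H_local) (auto simp: one_term_eq bpoly_of_nat)
    moreover have "?v lead = ?s ^ 2 * ?t" using b ne sym[of lead ?t ?s] unfolding True by (simp add: one_term_eq mult_ac)
    ultimately have "(?s * ?t ^ 2) ^ N = (?s ^ 2 * ?t) ^ N"
      using eval_set_comm[of 2 ?s b ?t] u_lead by (simp only: eval_set_split add_left_imp_eq)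
    from arg_cong[OF this, of "\<lambda>x. Poly_Mapping.lookup x test_monom"] show False
      unfolding st st_N using N(2)
      by (simp add: lookup_single test_monom_def single_pair_eq_iff when_def)
  next
    case False
    have "even b" using assms(2,3) by simp
    then have "b \<noteq> 3" by (intro notI) simp
    with False b have b4: "4 \<le> b" by simp
    have even: "even (2 * b choose (b - 1))"
      using assms b by (intro even_choose_odd) auto
    let ?base = "\<lambda>i. if i = 2 then ?s else if i = b then ?t else 0"
    have u: "Poly_Mapping.lookup (eval_set G ?u) test_monom =
        Poly_Mapping.lookup (eval_set H ?base) test_monom + Poly_Mapping.lookup (?u lead ^ N) test_monom"
      by (rule eliminate[where c = "\<lambda>i. if i = b + 1 then int (b + 1) else 0"])
         (use assms(1) b b4 even in \<open>auto simp: sym one_term_eq mult_ac\<close>)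
    let ?c = "\<lambda>i. if i = 1 \<or> i = 2 then 1 else 0 :: int"
    have "one_term K 2 ?s = (\<lambda>i. of_int (?c i) * ?s ^ (i - Suc 0))"
      using b by (auto simp: one_term_eq)
    \<comment> \<open>By homogeneity in \<open>s\<close> the coefficients of \<open>?v\<close> above
      \<open>b\<close> get the shape required by \<open>eliminate\<close>.\<close>
    then have dp: "dpow b (one_term K 2 ?s) i = of_int (dpow b ?c i) * ?s ^ (i - b)" for i
      using dpow_of_int_weighted[of ?c b ?s i] by simp
    have v: "?v i = one_term K 2 ?s i + of_int (dpow b ?c i) * (?t * ?s ^ (i - b))" for i
    proof -
      have "one_term K 2 ?s 0 = 0" by (simp add: one_term_def)
      from scomp_one_term[where f = "one_term K 2 ?s", OF b(1,3) this] show ?thesis by (simp only: dp mult_ac)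
    qed
    have v': "Poly_Mapping.lookup (eval_set G ?v) test_monom =
        Poly_Mapping.lookup (eval_set H ?base) test_monom + Poly_Mapping.lookup (?v lead ^ N) test_monom"
    proof (rule eliminate[where c = "dpow b ?c"])
      have "dpow b ?c i = 0" if "i < b" for i using that by (rule dpow_eq_0)
      moreover have "dpow b ?c b = 1" by (rule dpow_diag) auto
      ultimately show "?v 2 = ?s" "?v b = ?t" "\<And>i. 2 < i \<Longrightarrow> i < b \<Longrightarrow> ?v i = 0"
        "\<And>i. b < i \<Longrightarrow> i < 2 * b \<Longrightarrow> ?v i = of_int (dpow b ?c i) * (?t * ?s ^ (i - b))"
        using b b4 by (auto simp: v one_term_eq)
    qed (use assms(1) b4 even in auto)
    have "?v lead = 0 \<or> ?v lead = ?s ^ b * ?t ^ 1"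
      using b assms(1) by (auto simp: v one_term_eq bpoly_of_int mult.commute)
    then have "Poly_Mapping.lookup (?v lead ^ N) test_monom = 0"
      using N(2) st_N[of b 1] by (auto simp: lookup_single test_monom_def single_pair_eq_iff when_def zero_power)
    moreover have "Poly_Mapping.lookup (?u lead ^ N) test_monom = 1"
      unfolding u_lead st st_N by (simp add: lookup_single test_monom_def mult.commute)
    moreover have "Poly_Mapping.lookup (?u lead ^ N) test_monom = Poly_Mapping.lookup (?v lead ^ N) test_monom"
      by (rule add_left_imp_eq[of "Poly_Mapping.lookup (eval_set H ?base) test_monom"])
         (simp only: u[symmetric] v'[symmetric] eval_set_comm[of 2 ?s b ?t])
    ultimately show False by simp
  qed
qed

theorem classification: "\<exists>e. n = 2 ^ e \<and> G = {Poly_Mapping.single 2 n}"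
proof (cases "lead = 2")
  case True
  have "m = Poly_Mapping.single lead N" if m: "m \<in> G" for m
  proof -
    obtain i where i: "i \<in> Poly_Mapping.keys m" using monoms_keys_nonempty[OF _ n, of m] m G(1) by blast
    with keys_G[OF m i] True show ?thesis using N(4)[OF m] by auto
  qed
  with N(1) have "G = {Poly_Mapping.single lead N}" by blast
  moreover have "n = N" using N(3) True by simp
  ultimately show ?thesis using N_power True by simp
next
  case False
  with lead have top3: "3 \<le> lead" by simp
  \<comment> \<open>Every case is contradictory; in the last one \<open>odd_choose_exists\<close>
    supplies the odd binomial coefficient for \<open>lead_not_linear\<close>.\<close>
  consider d where "lead = 2 ^ d" | d where "Suc lead = 2 ^ d" | "\<And>d. lead \<noteq> 2 ^ d" "\<And>d. Suc lead \<noteq> 2 ^ d"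
    by blast
  then show ?thesis
  proof cases
    case (1 d)
    then have d: "d \<noteq> 0" "d \<noteq> Suc 0" using top3 by (intro notI; simp)+
    obtain e where "d = Suc (Suc e)"
    proof (cases d)
      case (Suc d')
      then show ?thesis using d that by (cases d') auto
    qed (use d in simp)
    then show ?thesis using 1 lead_not_power[of "2 ^ Suc e" "Suc e"] by simp
  next
    case (2 d)
    then have d: "d \<noteq> 0" "d \<noteq> Suc 0" using top3 by (intro notI; simp)+
    obtain e where "d = Suc (Suc e)"
    proof (cases d)
      case (Suc d')
      then show ?thesis using d that by (cases d') auto
    qed (use d in simp)
    then have "Suc lead = 2 * 2 ^ Suc e" using 2 by simp
    then have "lead = 2 * 2 ^ Suc e - 1" by simp
    then show ?thesis using lead_not_mersenne[of "2 ^ Suc e" "Suc e"] by simp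
  next
    case 3
    have "1 \<le> lead" using top3 by simp
    from odd_choose_exists[OF 3 this] show ?thesis using lead_not_linear by blast
  qed
qed

end

subsection \<open>Substitution of series\<close>

text \<open>With \<open>c = series K x\<close> and \<open>\<iota>\<close> the structure map, this is \<open>z + \<Sum>k = 2..K. x k * 2 ^ (k - 1) * z ^ k / k!\<close>:
  the series \<open>c\<close> conjugated by the dilation by two.\<close>

definition series_subst :: "(dyadic \<Rightarrow> 'b::comm_ring_1) \<Rightarrow> (nat \<Rightarrow> 'b) \<Rightarrow> nat \<Rightarrow> 'b \<Rightarrow> 'b" where
  "series_subst \<iota> c K z = (\<Sum>k = 1..K. \<iota> (lam k) * c k * z ^ k)"

lemma rhom_series_subst: "rhom \<psi> \<Longrightarrow> \<psi> (series_subst \<iota> c K z) = series_subst (\<lambda>a. \<psi> (\<iota> a)) (\<lambda>k. \<psi> (c k)) K (\<psi> z)"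
  by (simp add: series_subst_def rhom_sum rhom_mult rhom_power)

text \<open>If \<open>F\<close> is the series of \<open>f\<close>, then
  \<open>Y = F(2 * z) / 2\<close>, and both sides are a coefficient of
  \<open>2 ^ (k - 1) * Y ^ k / k! = F(2 * z) ^ k / (2 * k!)\<close>. Induction on \<open>k\<close>
  and cancellation replace the fractions.\<close>

lemma coeff_series_power:
  fixes \<iota> :: "dyadic \<Rightarrow> 'b::torsion_free"
  assumes "rhom \<iota>" "f 0 = 0" and Y: "\<And>m. coeff Y m = \<iota> (lam m) * f m" and "1 \<le> k"
  shows "\<iota> (lam k) * coeff (Y ^ k) m = \<iota> (lam m) * dpow k f m"
  using assms(4)
proof (induction k arbitrary: m rule: nat_induct_at_least)
  case base
  show ?case by (simp add: Y rhom_1[OF assms(1)] dpow_1[where f = f, OF assms(2)] del: dpow.simps)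
next
  case (Suc k)
  have lamk: "of_nat (Suc k) * \<iota> (lam (Suc k)) = 2 * \<iota> (lam k)"
  proof -
    have "\<iota> (of_nat (Suc k) * lam (Suc k)) = \<iota> (2 * lam k)"
      using Suc.hyps by (simp only: lam_Suc)
    then show ?thesis
      by (simp only: rhom_mult[OF assms(1)] rhom_of_nat[OF assms(1)] mult_2 rhom_add[OF assms(1)])
  qed
  have summand: "2 * (\<iota> (lam i) * dpow k f i) * (\<iota> (lam (m - i)) * f (m - i)) =
      \<iota> (lam m) * (of_nat (m choose i) * dpow k f i * f (m - i))" if i: "i \<le> m" for i
  \<comment> \<open>The extreme indices are outside \<open>lam_mult\<close>; there the summands
    vanish since \<open>f 0 = 0\<close> and \<open>dpow k f 0 = 0\<close>.\<close>
  proof (cases "i = 0 \<or> i = m")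
    case True
    then show ?thesis using assms(2) Suc.hyps by (auto simp: dpow_eq_0)
  next
    case False
    then have "2 * (lam i * lam (m - i)) = of_nat (m choose i) * lam m"
      using lam_mult[of i "m - i"] i by simp
    then have "\<iota> (2 * (lam i * lam (m - i))) = \<iota> (of_nat (m choose i) * lam m)" by simp
    then have *: "2 * (\<iota> (lam i) * \<iota> (lam (m - i))) = of_nat (m choose i) * \<iota> (lam m)"
      by (simp only: rhom_mult[OF assms(1)] rhom_of_nat[OF assms(1)] mult_2 rhom_add[OF assms(1)])
    have "2 * (\<iota> (lam i) * dpow k f i) * (\<iota> (lam (m - i)) * f (m - i)) =
        (2 * (\<iota> (lam i) * \<iota> (lam (m - i)))) * (dpow k f i * f (m - i))"
      by (simp only: mult_ac)
    also have "\<dots> = \<iota> (lam m) * (of_nat (m choose i) * dpow k f i * f (m - i))"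
      unfolding * by (simp only: mult_ac)
    finally show ?thesis .
  qed
  show ?case
  proof (rule of_nat_cancel)
    have "of_nat (Suc k) * (\<iota> (lam (Suc k)) * coeff (Y ^ Suc k) m) =
        (of_nat (Suc k) * \<iota> (lam (Suc k))) * coeff (Y ^ k * Y) m"
      by (simp only: power_Suc2 mult.assoc)
    also have "\<dots> = (\<Sum>i\<le>m. 2 * (\<iota> (lam k) * coeff (Y ^ k) i) * coeff Y (m - i))"
      unfolding lamk coeff_mult sum_distrib_left by (simp only: mult.assoc)
    also have "\<dots> = (\<Sum>i\<le>m. \<iota> (lam m) * (of_nat (m choose i) * dpow k f i * f (m - i)))"
      unfolding Suc.IH Y by (intro sum.cong refl summand) simp
    also have "\<dots> = \<iota> (lam m) * hurwitz (dpow k f) f m"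
      by (simp only: hurwitz_def sum_distrib_left)
    also have "\<dots> = of_nat (Suc k) * (\<iota> (lam m) * dpow (Suc k) f m)"
      unfolding dpow_mult[where f = f, OF assms(2), symmetric] by (simp only: mult.left_commute)
    finally show "of_nat (Suc k) * (\<iota> (lam (Suc k)) * coeff (Y ^ Suc k) m) =
        of_nat (Suc k) * (\<iota> (lam m) * dpow (Suc k) f m)" .
  qed simp
qed

text \<open>The dilation by two turns substitution into composition of Hurwitz series, whose
  coefficients are integral polynomials in those of \<open>f\<close> and \<open>g\<close>. The
  cutoff \<open>K * K\<close> bounds the degree of the composite.\<close>

lemma series_subst_scomp:
  fixes \<iota> :: "dyadic \<Rightarrow> 'b::torsion_free"
  assumes \<iota>: "rhom \<iota>" and f: "f 0 = 0" "\<And>k. K < k \<Longrightarrow> f k = 0" and g: "g 0 = 0" "\<And>k. K < k \<Longrightarrow> g k = 0"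
  shows "series_subst \<iota> g K (series_subst \<iota> f K z) = series_subst \<iota> (scomp g f) (K * K) z"
proof -
  define Y where "Y = (\<Sum>k = 1..K. Polynomial.monom (\<iota> (lam k) * f k) k)"
  have Y: "coeff Y m = \<iota> (lam m) * f m" for m
    using f by (cases "m = 0") (auto simp: Y_def coeff_sum)
  have pY: "poly Y z = series_subst \<iota> f K z"
    by (simp add: Y_def series_subst_def poly_sum poly_monom)
  have "degree Y \<le> K"
    by (rule degree_le) (use f(2) in \<open>simp add: Y\<close>)
  have "\<iota> (lam k) * series_subst \<iota> f K z ^ k = (\<Sum>m\<le>K * K. \<iota> (lam m) * dpow k f m * z ^ m)" if k: "1 \<le> k" "k \<le> K" for k
  proof -
    have "degree (Y ^ k) \<le> degree Y * k" by (rule degree_power_le)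
    also have "\<dots> \<le> K * K" using k \<open>degree Y \<le> K\<close> by (intro mult_le_mono)
    finally have "poly (Y ^ k) z = (\<Sum>m\<le>K * K. coeff (Y ^ k) m * z ^ m)"
      unfolding poly_altdef by (intro sum.mono_neutral_left) (auto simp: coeff_eq_0)
    then have "\<iota> (lam k) * series_subst \<iota> f K z ^ k = (\<Sum>m\<le>K * K. \<iota> (lam k) * coeff (Y ^ k) m * z ^ m)"
      by (simp only: pY[symmetric] poly_power[symmetric] sum_distrib_left mult.assoc)
    then show ?thesis
      using coeff_series_power[OF \<iota> f(1) Y k(1)] by (simp only:)
  qed
  note expand = this
  have "series_subst \<iota> g K (series_subst \<iota> f K z) = (\<Sum>k = 1..K. g k * (\<iota> (lam k) * series_subst \<iota> f K z ^ k))"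
    unfolding series_subst_def[of \<iota> g] by (simp only: mult_ac)
  also have "\<dots> = (\<Sum>k = 1..K. \<Sum>m\<le>K * K. g k * (\<iota> (lam m) * dpow k f m * z ^ m))"
    by (intro sum.cong refl) (simp add: expand sum_distrib_left)
  also have "\<dots> = (\<Sum>m\<le>K * K. \<iota> (lam m) * (\<Sum>k = 1..K. g k * dpow k f m) * z ^ m)"
    by (subst sum.swap) (simp add: sum_distrib_left sum_distrib_right mult_ac)
  also have "\<dots> = (\<Sum>m\<le>K * K. \<iota> (lam m) * scomp g f m * z ^ m)"
  proof (intro sum.cong refl)
    fix m
    have "(\<Sum>k = 1..K. g k * dpow k f m) = (\<Sum>k \<in> {..K + m}. g k * dpow k f m)"
      using g by (intro sum.mono_neutral_left) (auto simp: not_le)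
    also have "\<dots> = scomp g f m"
      unfolding scomp_def by (intro sum.mono_neutral_right) (auto simp: dpow_eq_0)
    finally show "\<iota> (lam m) * (\<Sum>k = 1..K. g k * dpow k f m) * z ^ m = \<iota> (lam m) * scomp g f m * z ^ m"
      by simp
  qed
  also have "\<dots> = series_subst \<iota> (scomp g f) (K * K) z"
    unfolding series_subst_def by (intro sum.mono_neutral_right) (auto simp: scomp_0 g(1) not_le)
  finally show ?thesis .
qed

lemma rhom_dpow: "rhom \<phi> \<Longrightarrow> \<phi> (dpow l f m) = dpow l (\<lambda>i. \<phi> (f i)) m"
proof (induction l arbitrary: m)
  case (Suc l)
  then show ?case by (cases m) (simp_all add: rhom_0 rhom_sum rhom_mult rhom_of_nat)
qed (simp add: rhom_0 rhom_1)

lemma rhom_scomp: "rhom \<phi> \<Longrightarrow> \<phi> (scomp g f m) = scomp (\<lambda>i. \<phi> (g i)) (\<lambda>i. \<phi> (f i)) m"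
  by (simp add: scomp_def rhom_sum rhom_mult rhom_dpow)

lemma rhom_series: "rhom \<phi> \<Longrightarrow> \<phi> (series K x i) = series K (\<lambda>i. \<phi> (x i)) i"
  by (simp add: series_def rhom_0 rhom_1)

subsection \<open>Universal substitution\<close>

lemma const_eq_cst: "const = cst"
  by (rule ext) (simp add: const_def cst_def)

lemma xi_eq_var: "\<xi> i = var i"
  by (simp add: \<xi>_def var_def)

lemma rhom_const: "rhom const"
  unfolding const_eq_cst by (rule rhom_cst)

definition coeff_subst :: "(dpoly \<Rightarrow> 'b::comm_ring_1) \<Rightarrow> (nat \<Rightarrow> 'b) \<Rightarrow> nat \<Rightarrow> dpoly \<Rightarrow> 'b" where
  "coeff_subst \<epsilon> c K = ev (\<lambda>a. \<epsilon> (const a)) (\<lambda>i. series_subst (\<lambda>a. \<epsilon> (const a)) (series K c) K (\<epsilon> (\<xi> i)))"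

text \<open>The substitution with indeterminate coefficients \<open>var k\<close>; its coefficients
  with respect to these indeterminates become the operators \<open>Psi\<close>.\<close>

definition usubst :: "nat \<Rightarrow> dpoly \<Rightarrow> (monom \<Rightarrow>\<^sub>0 dpoly)" where
  "usubst K = coeff_subst cst var K"

lemma rhom_coeff_subst: "rhom \<epsilon> \<Longrightarrow> rhom (coeff_subst \<epsilon> c K)"
  unfolding coeff_subst_def by (intro rhom_ev rhom_comp[OF rhom_const])

lemma rhom_usubst: "rhom (usubst K)"
  unfolding usubst_def by (intro rhom_coeff_subst rhom_cst)

lemma coeff_subst_const: "rhom \<epsilon> \<Longrightarrow> coeff_subst \<epsilon> c K (const a) = \<epsilon> (const a)"
  unfolding coeff_subst_def const_eq_cst by (rule ev_cst[OF rhom_comp[OF rhom_cst]])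

lemma coeff_subst_xi: "rhom \<epsilon> \<Longrightarrow> coeff_subst \<epsilon> c K (\<xi> i) = series_subst (\<lambda>a. \<epsilon> (const a)) (series K c) K (\<epsilon> (\<xi> i))"
  unfolding coeff_subst_def xi_eq_var by (rule ev_var[OF rhom_comp[OF rhom_const]])

lemma dpoly_rhom_ext:
  fixes F F' :: "dpoly \<Rightarrow> 'b::comm_ring_1"
  assumes "rhom F" "rhom F'" "\<And>a. F (const a) = F' (const a)" "\<And>i. F (\<xi> i) = F' (\<xi> i)"
  shows "F p = F' p"
  by (rule rhom_ext) (use assms in \<open>simp_all add: const_eq_cst xi_eq_var\<close>)

text \<open>Universality: every \<open>coeff_subst\<close> arises from \<open>usubst\<close> by
  specializing the indeterminates.\<close>

lemma coeff_subst_eq_ev: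
  assumes "rhom \<epsilon>"
  shows "coeff_subst \<epsilon> c K p = ev \<epsilon> c (usubst K p)"
proof (rule dpoly_rhom_ext)
  note h = rhom_ev[OF assms, of c]
  show "rhom (\<lambda>p. ev \<epsilon> c (usubst K p))" by (rule rhom_comp[OF rhom_usubst h])
  show "coeff_subst \<epsilon> c K (const a) = ev \<epsilon> c (usubst K (const a))" for a
    by (simp add: usubst_def coeff_subst_const[OF assms] coeff_subst_const[OF rhom_cst] ev_cst[OF assms])
  show "coeff_subst \<epsilon> c K (\<xi> i) = ev \<epsilon> c (usubst K (\<xi> i))" for i
    by (simp add: usubst_def coeff_subst_xi[OF assms] coeff_subst_xi[OF rhom_cst] rhom_series_subst[OF h] rhom_series[OF h]
        ev_cst[OF assms] ev_var[OF assms])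
qed (rule rhom_coeff_subst[OF assms])

text \<open>Substitutes in the coefficients only: the first family of indeterminates stays outside,
  the second one becomes the inner variables.\<close>

definition usubst2 :: "nat \<Rightarrow> (monom \<Rightarrow>\<^sub>0 dpoly) \<Rightarrow> (monom \<Rightarrow>\<^sub>0 (monom \<Rightarrow>\<^sub>0 dpoly))" where
  "usubst2 K = ev (\<lambda>q. cst (usubst K q)) var"

abbreviation (input) generic_scomp :: "nat \<Rightarrow> nat \<Rightarrow> (monom \<Rightarrow>\<^sub>0 (monom \<Rightarrow>\<^sub>0 'a::comm_ring_1))" where
  "generic_scomp K \<equiv> scomp (series K var) (series K (\<lambda>i. cst (var i)))"

text \<open>Substituting twice is substituting the composite series, by
  \<open>series_subst_scomp\<close>; it suffices to compare constants and variables.\<close>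

lemma usubst2_usubst:
  assumes "1 \<le> K"
  shows "usubst2 K (usubst K p) = ev (\<lambda>q. cst (cst q)) (generic_scomp K) (usubst (K * K) p)"
proof -
  have h1: "rhom (\<lambda>q. cst (usubst K q))" by (rule rhom_comp[OF rhom_usubst rhom_cst])
  have h2: "rhom (usubst2 K)" unfolding usubst2_def by (rule rhom_ev[OF h1])
  have h3: "rhom (\<lambda>q. cst (cst q))" by (rule rhom_comp[OF rhom_cst rhom_cst])
  have cst: "usubst2 K (cst q) = cst (usubst K q)" and var: "usubst2 K (var i) = var i" for q i
    unfolding usubst2_def by (rule ev_cst[OF h1], rule ev_var[OF h1])
  let ?\<iota> = "\<lambda>a. cst (cst (const a))"
  have \<iota>: "rhom ?\<iota>" by (rule rhom_comp[OF rhom_const h3])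
  have "usubst2 K (usubst K p) = coeff_subst (\<lambda>q. cst (cst q)) (generic_scomp K) (K * K) p"
  proof (rule dpoly_rhom_ext)
    show "rhom (\<lambda>p. usubst2 K (usubst K p))" by (rule rhom_comp[OF rhom_usubst h2])
    show "rhom (coeff_subst (\<lambda>q. cst (cst q)) (generic_scomp K) (K * K))" by (rule rhom_coeff_subst[OF h3])
    show "usubst2 K (usubst K (const a)) = coeff_subst (\<lambda>q. cst (cst q)) (generic_scomp K) (K * K) (const a)" for a
      by (simp add: usubst_def coeff_subst_const[OF rhom_cst] coeff_subst_const[OF h3] cst[unfolded usubst_def])
    fix i
    have inner: "usubst K (\<xi> i) = series_subst (\<lambda>a. cst (const a)) (series K var) K (cst (\<xi> i))"
      unfolding usubst_def by (rule coeff_subst_xi[OF rhom_cst])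
    have "usubst2 K (usubst K (\<xi> i)) = series_subst (\<lambda>a. cst (usubst K (const a))) (series K var) K (cst (usubst K (\<xi> i)))"
      by (subst (1) inner) (simp only: rhom_series_subst[OF h2] rhom_series[OF h2] cst var)
    also have "\<dots> = series_subst ?\<iota> (series K var) K (cst (usubst K (\<xi> i)))"
      by (simp only: usubst_def coeff_subst_const[OF rhom_cst])
    also have "cst (usubst K (\<xi> i)) = series_subst ?\<iota> (series K (\<lambda>i. cst (var i))) K (cst (cst (\<xi> i)))"
      unfolding inner by (simp only: rhom_series_subst[OF rhom_cst] rhom_series[OF rhom_cst])
    also have "series_subst ?\<iota> (series K var) K \<dots> = series_subst ?\<iota> (generic_scomp K) (K * K) (cst (cst (\<xi> i)))"
      by (rule series_subst_scomp[OF \<iota>]) (simp_all add: series_def)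
    also have "\<dots> = series_subst ?\<iota> (series (K * K) (generic_scomp K)) (K * K) (cst (cst (\<xi> i)))"
    proof -
      have "generic_scomp K (Suc 0) = (1 :: monom \<Rightarrow>\<^sub>0 (monom \<Rightarrow>\<^sub>0 dpoly))"
        using assms by (simp add: scomp_def)
      then show ?thesis unfolding series_subst_def by (intro sum.cong) (auto simp: series_def)
    qed
    finally show "usubst2 K (usubst K (\<xi> i)) = coeff_subst (\<lambda>q. cst (cst q)) (generic_scomp K) (K * K) (\<xi> i)"
      by (simp only: coeff_subst_xi[OF h3])
  qed
  also have "\<dots> = ev (\<lambda>q. cst (cst q)) (generic_scomp K) (usubst (K * K) p)"
    by (rule coeff_subst_eq_ev[OF h3])
  finally show ?thesis .
qed

text \<open>The coefficient of \<open>\<alpha> \<otimes> \<beta>\<close> in the coproduct of \<open>\<gamma>\<close> of the Hopf algebra dual to composition.\<close>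

definition structure_coeff :: "nat \<Rightarrow> monom \<Rightarrow> monom \<Rightarrow> monom \<Rightarrow> int" where
  "structure_coeff K \<gamma> \<alpha> \<beta> = Poly_Mapping.lookup (Poly_Mapping.lookup (mon (generic_scomp K) \<gamma>) \<alpha>) \<beta>"

text \<open>The composite is built from variables by integral operations, so its coefficients over
  any ring are images of those over the integers.\<close>

lemma lookup_mon_generic_scomp:
  "Poly_Mapping.lookup (Poly_Mapping.lookup (mon (generic_scomp K) \<gamma>) \<alpha>) \<beta> =
    (of_int (structure_coeff K \<gamma> \<alpha> \<beta>) :: 'a::comm_ring_1)"
proof -
  define J1 :: "(monom \<Rightarrow>\<^sub>0 int) \<Rightarrow> (monom \<Rightarrow>\<^sub>0 'a)" where "J1 = ev (\<lambda>a. cst (of_int a)) var"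
  define J2 where "J2 = ev (\<lambda>x. cst (J1 x)) var"
  have h0: "rhom (\<lambda>a. cst (of_int a) :: monom \<Rightarrow>\<^sub>0 'a)" by (rule rhom_comp[OF rhom_int rhom_cst])
  have h1: "rhom J1" unfolding J1_def by (rule rhom_ev[OF h0])
  have h1': "rhom (\<lambda>x. cst (J1 x))" by (rule rhom_comp[OF h1 rhom_cst])
  have h2: "rhom J2" unfolding J2_def by (rule rhom_ev[OF h1'])
  have v1: "J1 (var i) = var i" for i unfolding J1_def by (rule ev_var[OF h0])
  have v2: "J2 (var i) = var i" "J2 (cst x) = cst (J1 x)" for i x
    unfolding J2_def by (rule ev_var[OF h1'], rule ev_cst[OF h1'])
  have "mon (generic_scomp K) \<gamma> = J2 (mon (generic_scomp K) \<gamma>)"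
    by (simp only: rhom_mon[OF h2] rhom_scomp[OF h2] rhom_series[OF h2] v1 v2)
  then show ?thesis
    unfolding structure_coeff_def J2_def J1_def
    by (simp only: lookup_ev_var[OF h1[unfolded J1_def]] lookup_ev_var[OF rhom_int])
qed

lemma lookup_usubst_usubst:
  assumes "1 \<le> K"
  shows "Poly_Mapping.lookup (usubst K (Poly_Mapping.lookup (usubst K p) \<alpha>)) \<beta> =
    (\<Sum>\<gamma> \<in> Poly_Mapping.keys (usubst (K * K) p).
      of_int (structure_coeff K \<gamma> \<alpha> \<beta>) * Poly_Mapping.lookup (usubst (K * K) p) \<gamma>)"
proof -
  have "usubst K (Poly_Mapping.lookup (usubst K p) \<alpha>) = Poly_Mapping.lookup (usubst2 K (usubst K p)) \<alpha>"
    unfolding usubst2_def by (rule lookup_ev_var[OF rhom_usubst, symmetric])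
  then show ?thesis
    unfolding usubst2_usubst[OF assms] ev_def
    by (simp only: lookup_sum lookup_cst_mult lookup_mon_generic_scomp mult.commute)
qed

subsection \<open>Gradings\<close>

text \<open>One notion for several purposes: \<open>v\<close> is the joint weight for
  \<open>structure_coeff\<close>, polynomial degree minus weight for \<open>usubst\<close>, and zero
  where only the occurring variables matter.\<close>

definition graded ::
  "nat set \<Rightarrow> nat set \<Rightarrow> (monom \<Rightarrow> monom \<Rightarrow> int) \<Rightarrow> int \<Rightarrow> (monom \<Rightarrow>\<^sub>0 (monom \<Rightarrow>\<^sub>0 'a::comm_ring_1)) \<Rightarrow> bool" where
  "graded A B v d x \<longleftrightarrow> (\<forall>\<alpha> \<beta>. Poly_Mapping.lookup (Poly_Mapping.lookup x \<alpha>) \<beta> \<noteq> 0 \<longrightarrow>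
     Poly_Mapping.keys \<alpha> \<subseteq> A \<and> Poly_Mapping.keys \<beta> \<subseteq> B \<and> v \<alpha> \<beta> = d)"

definition additive2 :: "(monom \<Rightarrow> monom \<Rightarrow> int) \<Rightarrow> bool" where
  "additive2 v \<longleftrightarrow> (\<forall>\<alpha> \<alpha>' \<beta> \<beta>'. v (\<alpha> + \<alpha>') (\<beta> + \<beta>') = v \<alpha> \<beta> + v \<alpha>' \<beta>')"

lemma graded_0: "graded A B v d 0"
  by (simp add: graded_def)

lemma graded_add: "graded A B v d x \<Longrightarrow> graded A B v d y \<Longrightarrow> graded A B v d (x + y)"
  unfolding graded_def lookup_add by (metis add_0)

lemma graded_sum: "(\<And>i. i \<in> I \<Longrightarrow> graded A B v d (f i)) \<Longrightarrow> graded A B v d (sum f I)"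
  by (induction I rule: infinite_finite_induct) (auto intro: graded_0 graded_add)

lemma graded_single:
  assumes "Poly_Mapping.keys \<alpha> \<subseteq> A" "Poly_Mapping.keys \<beta> \<subseteq> B" "v \<alpha> \<beta> = d"
  shows "graded A B v d (Poly_Mapping.single \<alpha> (Poly_Mapping.single \<beta> c))"
  using assms by (auto simp: graded_def lookup_single when_def split: if_splits)

lemma graded_mult:
  assumes v: "additive2 v" and x: "graded A B v d x" and y: "graded A B v e y"
  shows "graded A B v (d + e) (x * y)"
  unfolding graded_def
proof (intro allI impI)
  fix \<alpha> \<beta> assume "Poly_Mapping.lookup (Poly_Mapping.lookup (x * y) \<alpha>) \<beta> \<noteq> 0"
  then have "(\<Sum>a \<in> Poly_Mapping.keys x. \<Sum>b \<in> Poly_Mapping.keys y. Poly_Mapping.lookup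
      (Poly_Mapping.lookup x a * Poly_Mapping.lookup y b when a + b = \<alpha>) \<beta>) \<noteq> 0"
    by (simp only: lookup_mult_sum[of x y] lookup_sum) simp
  then obtain a b where ab: "Poly_Mapping.lookup
      (Poly_Mapping.lookup x a * Poly_Mapping.lookup y b when a + b = \<alpha>) \<beta> \<noteq> 0"
    by (meson sum.neutral)
  then have \<alpha>: "\<alpha> = a + b" by (auto simp: when_def split: if_splits)
  then have "\<beta> \<in> Poly_Mapping.keys (Poly_Mapping.lookup x a * Poly_Mapping.lookup y b)"
    using ab by (simp add: in_keys_iff)
  then obtain a' b' where "\<beta> = a' + b'" "a' \<in> Poly_Mapping.keys (Poly_Mapping.lookup x a)"
      "b' \<in> Poly_Mapping.keys (Poly_Mapping.lookup y b)"
    using Poly_Mapping.keys_mult by blast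
  moreover from this have "Poly_Mapping.keys a \<subseteq> A \<and> Poly_Mapping.keys a' \<subseteq> B \<and> v a a' = d"
    "Poly_Mapping.keys b \<subseteq> A \<and> Poly_Mapping.keys b' \<subseteq> B \<and> v b b' = e"
    using x y unfolding graded_def by (auto simp: in_keys_iff)
  ultimately show "Poly_Mapping.keys \<alpha> \<subseteq> A \<and> Poly_Mapping.keys \<beta> \<subseteq> B \<and> v \<alpha> \<beta> = d + e"
    using v Poly_Mapping.keys_add[of a b] Poly_Mapping.keys_add[of a' b'] unfolding \<alpha> additive2_def by auto
qed

lemma graded_1: "additive2 v \<Longrightarrow> graded A B v 0 1"
proof -
  assume "additive2 v"
  then have "v (0 + 0) (0 + 0) = v 0 0 + v 0 0" unfolding additive2_def by blast
  then have "v 0 0 = 0" by simp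
  then have "graded A B v 0 (Poly_Mapping.single 0 (Poly_Mapping.single 0 1))"
    by (intro graded_single) auto
  then show ?thesis by simp
qed

lemma graded_power: "additive2 v \<Longrightarrow> graded A B v d x \<Longrightarrow> graded A B v (int k * d) (x ^ k)"
proof (induction k)
  case (Suc k)
  then have "graded A B v (d + int k * d) (x * x ^ k)" by (intro graded_mult) auto
  then show ?case by (simp add: distrib_right)
qed (simp add: graded_1)

lemma graded_of_nat_mult: "graded A B v d x \<Longrightarrow> graded A B v d (of_nat k * x)"
  by (induction k) (auto simp: distrib_right intro: graded_0 graded_add)

lemma graded_prod:
  "additive2 v \<Longrightarrow> (\<And>i. i \<in> I \<Longrightarrow> graded A B v (d i) (f i)) \<Longrightarrow> graded A B v (sum d I) (prod f I)"
  by (induction I rule: infinite_finite_induct) (auto intro: graded_1 graded_mult)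

lemma graded_mon:
  assumes "additive2 v" "\<And>i. i \<in> Poly_Mapping.keys m \<Longrightarrow> graded A B v (d i) (x i)"
  shows "graded A B v (\<Sum>i \<in> Poly_Mapping.keys m. int (Poly_Mapping.lookup m i) * d i) (mon x m)"
  unfolding mon_def using assms by (intro graded_prod graded_power) auto

lemma additive2_weight: "additive2 (\<lambda>\<alpha> \<beta>. weight \<alpha> + weight \<beta>)"
  and additive2_deg: "additive2 (\<lambda>\<alpha> \<beta>. int (monom_deg \<beta>) - weight \<alpha>)"
  and additive2_0: "additive2 (\<lambda>_ _. 0)"
  by (simp_all add: additive2_def weight_add monom_deg_add)

lemma graded_dpow:
  assumes v: "additive2 v" and f: "\<And>i. graded A B v (int i - 1) (f i)"
  shows "graded A B v (int m - int l) (dpow l f m)"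
proof (induction l arbitrary: m)
  case 0
  then show ?case by (cases "m = 0") (simp_all add: graded_0 graded_1[OF v])
next
  case (Suc l)
  show ?case
  proof (cases m)
    case 0
    then show ?thesis by (simp add: graded_0)
  next
    case (Suc m')
    have "graded A B v (int m - int (Suc l)) (of_nat (m' choose i) * (dpow l f i * f (Suc (m' - i))))"
      if "i \<le> m'" for i
    proof -
      have "graded A B v ((int i - int l) + (int (Suc (m' - i)) - 1)) (dpow l f i * f (Suc (m' - i)))"
        by (intro graded_mult v Suc.IH f)
      then show ?thesis using that Suc by (intro graded_of_nat_mult) (simp add: of_nat_diff)
    qed
    then show ?thesis
      unfolding Suc dpow.simps(3) by (intro graded_sum) (auto simp: mult.assoc)
  qed
qed

lemma graded_generic_scomp: "graded {2..} {2..} (\<lambda>\<alpha> \<beta>. weight \<alpha> + weight \<beta>) (int m - 1) (generic_scomp K m)"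
proof -
  note v = additive2_weight
  have 1: "graded {2..} {2..} (\<lambda>\<alpha> \<beta>. weight \<alpha> + weight \<beta>) (int i - 1) (series K var i)" for i
    using graded_1[OF v, of "{2..}" "{2..}"] graded_single[of "Poly_Mapping.single i 1" "{2..}" 0 "{2..}" "\<lambda>\<alpha> \<beta>. weight \<alpha> + weight \<beta>" "int i - 1" 1]
    by (auto simp: series_def graded_0 var_def)
  have 2: "graded {2..} {2..} (\<lambda>\<alpha> \<beta>. weight \<alpha> + weight \<beta>) (int i - 1) (series K (\<lambda>i. cst (var i)) i)" for i
    using graded_1[OF v, of "{2..}" "{2..}"] graded_single[of 0 "{2..}" "Poly_Mapping.single i 1" "{2..}" "\<lambda>\<alpha> \<beta>. weight \<alpha> + weight \<beta>" "int i - 1" 1]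
    by (auto simp: series_def graded_0 var_def cst_def)
  have "graded {2..} {2..} (\<lambda>\<alpha> \<beta>. weight \<alpha> + weight \<beta>) ((int l - 1) + (int m - int l)) (series K var l * dpow l (series K (\<lambda>i. cst (var i))) m)" for l
    by (intro graded_mult v 1 graded_dpow 2)
  then show ?thesis
    unfolding scomp_def by (intro graded_sum) simp
qed

lemma structure_coeff_nonzero:
  assumes "structure_coeff K \<gamma> \<alpha> \<beta> \<noteq> 0"
  shows "Poly_Mapping.keys \<alpha> \<subseteq> {2..}" "Poly_Mapping.keys \<beta> \<subseteq> {2..}" "weight \<gamma> = weight \<alpha> + weight \<beta>"
proof -
  have "graded {2..} {2..} (\<lambda>\<alpha> \<beta>. weight \<alpha> + weight \<beta>) (weight \<gamma>) (mon (generic_scomp K) \<gamma> :: monom \<Rightarrow>\<^sub>0 (monom \<Rightarrow>\<^sub>0 int))"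
    unfolding weight_def[of \<gamma>] by (intro graded_mon additive2_weight graded_generic_scomp)
  with assms have "Poly_Mapping.keys \<alpha> \<subseteq> {2..} \<and> Poly_Mapping.keys \<beta> \<subseteq> {2..} \<and> weight \<alpha> + weight \<beta> = weight \<gamma>"
    unfolding graded_def structure_coeff_def by blast
  then show "Poly_Mapping.keys \<alpha> \<subseteq> {2..}" "Poly_Mapping.keys \<beta> \<subseteq> {2..}" "weight \<gamma> = weight \<alpha> + weight \<beta>"
    by auto
qed

lemma graded_series_subst_xi:
  assumes "additive2 v" "v 0 0 = 0" "i \<in> B" "\<And>k. 1 \<le> k \<Longrightarrow> k \<le> K \<Longrightarrow>
    v (if k = 1 then 0 else Poly_Mapping.single k 1) (Poly_Mapping.single i k) = d"
  shows "graded {2..} B v d (series_subst (\<lambda>a. cst (const a)) (series K var) K (cst (\<xi> i)))"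
  unfolding series_subst_def
proof (rule graded_sum)
  fix k assume k: "k \<in> {1..K}"
  have "cst (const (lam k)) * series K var k * cst (\<xi> i) ^ k =
      Poly_Mapping.single (if k = 1 then 0 else Poly_Mapping.single k 1) (Poly_Mapping.single (Poly_Mapping.single i k) (lam k))"
  proof -
    have "cst (\<xi> i) ^ k = Poly_Mapping.single 0 (Poly_Mapping.single (Poly_Mapping.single i k) 1)"
      unfolding xi_eq_var rhom_power[OF rhom_cst, symmetric] var_power by (simp only: cst_def)
    moreover have "series K var k = Poly_Mapping.single (if k = 1 then 0 else Poly_Mapping.single k 1) (1 :: dpoly)"
      using k by (auto simp: series_def var_def)
    ultimately show ?thesis
      by (simp only: cst_def const_def mult_single) (simp add: mult_single)
  qed
  moreover have "graded {2..} B v d \<dots>"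
    using k assms by (intro graded_single) auto
  ultimately show "graded {2..} B v d (cst (const (lam k)) * series K var k * cst (\<xi> i) ^ k)"
    by simp
qed

lemma usubst_single:
  "usubst K (Poly_Mapping.single m a) =
    cst (const a) * mon (\<lambda>i. series_subst (\<lambda>a. cst (const a)) (series K var) K (cst (\<xi> i))) m"
  unfolding usubst_def coeff_subst_def by (rule ev_single[OF rhom_comp[OF rhom_const rhom_cst]])

text \<open>Each term \<open>var k * \<xi> i ^ k\<close> raises the degree by \<open>k - 1\<close>,
  the weight of \<open>var k\<close>.\<close>

lemma graded_usubst_single:
  assumes "Poly_Mapping.keys m \<subseteq> B"
  shows "graded {2..} B (\<lambda>\<alpha> \<beta>. int (monom_deg \<beta>) - weight \<alpha>) (int (monom_deg m)) (usubst K (Poly_Mapping.single m a))"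
proof -
  let ?v = "\<lambda>\<alpha> \<beta>. int (monom_deg \<beta>) - weight \<alpha>"
  have "graded {2..} B ?v (\<Sum>i \<in> Poly_Mapping.keys m. int (Poly_Mapping.lookup m i) * 1)
      (mon (\<lambda>i. series_subst (\<lambda>a. cst (const a)) (series K var) K (cst (\<xi> i))) m)"
    using assms by (intro graded_mon graded_series_subst_xi additive2_deg) (auto simp: monom_deg_def)
  moreover have "graded {2..} B ?v 0 (cst (const a))"
    unfolding cst_def const_def by (intro graded_single) (auto simp: monom_deg_def)
  ultimately have "graded {2..} B ?v (0 + int (monom_deg m)) (usubst K (Poly_Mapping.single m a))"
    unfolding usubst_single by (intro graded_mult additive2_deg) (auto simp: monom_deg_def)
  then show ?thesis by simp
qed

lemma graded_usubst:
  assumes "p \<in> dpolys N"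
  shows "graded {2..} {1..N} (\<lambda>_ _. 0) 0 (usubst K p)"
proof -
  have "graded {2..} {1..N} (\<lambda>_ _. 0) 0 (usubst K (Poly_Mapping.single m (Poly_Mapping.lookup p m)))"
    if "m \<in> Poly_Mapping.keys p" for m
    using graded_usubst_single[of m "{1..N}" K] that assms unfolding dpolys_def graded_def by blast
  then have "graded {2..} {1..N} (\<lambda>_ _. 0) 0
      (usubst K (\<Sum>m \<in> Poly_Mapping.keys p. Poly_Mapping.single m (Poly_Mapping.lookup p m)))"
    unfolding rhom_sum[OF rhom_usubst] by (rule graded_sum)
  then show ?thesis by (simp only: poly_eq_sum_single[symmetric])
qed

lemma keys_usubst: "\<gamma> \<in> Poly_Mapping.keys (usubst K p) \<Longrightarrow> Poly_Mapping.keys \<gamma> \<subseteq> {2..}"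
proof -
  have "graded {2..} UNIV (\<lambda>_ _. 0) 0 (usubst K (Poly_Mapping.single m (Poly_Mapping.lookup p m)))" for m
    using graded_usubst_single[of m UNIV K] unfolding graded_def by blast
  then have "graded {2..} UNIV (\<lambda>_ _. 0) 0
      (usubst K (\<Sum>m \<in> Poly_Mapping.keys p. Poly_Mapping.single m (Poly_Mapping.lookup p m)))"
    unfolding rhom_sum[OF rhom_usubst] by (rule graded_sum)
  then have *: "graded {2..} UNIV (\<lambda>_ _. 0) 0 (usubst K p)" by (simp only: poly_eq_sum_single[symmetric])
  assume "\<gamma> \<in> Poly_Mapping.keys (usubst K p)"
  then have "Poly_Mapping.lookup (usubst K p) \<gamma> \<noteq> 0" by (simp add: in_keys_iff)
  then obtain \<beta> where "Poly_Mapping.lookup (Poly_Mapping.lookup (usubst K p) \<gamma>) \<beta> \<noteq> 0"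
    by (metis lookup_zero poly_mapping_eqI)
  with * show ?thesis unfolding graded_def by blast
qed

subsection \<open>The operators of the dual lattice\<close>

text \<open>Setting the variables above \<open>K\<close> to zero in \<open>usubst K'\<close> yields
  \<open>usubst K\<close> and does not affect the coefficient at \<open>\<gamma>\<close>.\<close>

lemma usubst_stable:
  assumes "1 \<le> K" "K \<le> K'" "Poly_Mapping.keys \<gamma> \<subseteq> {..K}"
  shows "Poly_Mapping.lookup (usubst K p) \<gamma> = Poly_Mapping.lookup (usubst K' p) \<gamma>"
proof -
  define c :: "nat \<Rightarrow> (monom \<Rightarrow>\<^sub>0 dpoly)" where "c i = (if i \<le> K then var i else 0)" for i
  have "series_subst \<iota> (series K var) K z = series_subst \<iota> (series K' c) K' z" for \<iota> z
    unfolding series_subst_def using assms(1,2) by (intro sum.mono_neutral_cong_left) (auto simp: series_def c_def)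
  then have "usubst K p = coeff_subst cst c K' p"
    by (simp add: usubst_def coeff_subst_def)
  also have "\<dots> = ev cst c (usubst K' p)" by (rule coeff_subst_eq_ev[OF rhom_cst])
  finally have eq: "usubst K p = ev cst c (usubst K' p)" .
  have "Poly_Mapping.lookup (cst q * mon c \<alpha>) \<gamma> = (if \<alpha> = \<gamma> then q else 0)" for q \<alpha>
  proof (cases "Poly_Mapping.keys \<alpha> \<subseteq> {..K}")
    case True
    then have "mon c \<alpha> = mon var \<alpha>" by (intro mon_cong) (auto simp: c_def)
    then show ?thesis by (simp add: lookup_cst_mult mon_var lookup_single)
  next
    case False
    then obtain i where i: "i \<in> Poly_Mapping.keys \<alpha>" "\<not> i \<le> K" by auto
    then have "mon c \<alpha> = 0" by (intro mon_eq_0[of i]) (auto simp: c_def)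
    then show ?thesis using False assms(3) by auto
  qed
  then show ?thesis
    unfolding eq ev_def lookup_sum by (simp add: in_keys_iff)
qed

text \<open>The cutoff of \<open>usubst\<close> is irrelevant by \<open>usubst_stable\<close>, as the variables of \<open>\<gamma>\<close> have index at most
  \<open>weight \<gamma> + 1\<close>.\<close>

definition Psi :: "monom \<Rightarrow> dpoly \<Rightarrow> dpoly" where
  "Psi \<gamma> p = Poly_Mapping.lookup (usubst (nat (weight \<gamma>) + 1) p) \<gamma>"

lemma lookup_usubst_eq_Psi:
  assumes "\<gamma> \<in> monoms n" "n < K"
  shows "Poly_Mapping.lookup (usubst K p) \<gamma> = Psi \<gamma> p"
proof -
  have "weight \<gamma> = int n" using assms(1) by (simp add: monoms_def)
  then show ?thesis
    unfolding Psi_def using assms monoms_bounds(2)[OF assms(1)]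
    by (intro usubst_stable[symmetric]) auto
qed

lemma Psi_sum: "Psi \<gamma> (sum f I) = (\<Sum>i\<in>I. Psi \<gamma> (f i))"
  by (simp add: Psi_def rhom_sum[OF rhom_usubst] lookup_sum)

lemma dpolys_Psi: "p \<in> dpolys N \<Longrightarrow> Psi \<gamma> p \<in> dpolys N"
  using graded_usubst[of p N] unfolding Psi_def graded_def dpolys_def by (auto simp: in_keys_iff)

lemma finite_monoms: "finite (monoms n)"
proof -
  have "Poly_Mapping.lookup ` monoms n \<subseteq> {f. \<forall>i. (i \<in> {..n + 1} \<longrightarrow> f i \<in> {..n}) \<and> (i \<notin> {..n + 1} \<longrightarrow> f i = 0)}"
  proof (rule image_subsetI)
    fix m assume m: "m \<in> monoms n"
    have "Poly_Mapping.lookup m i \<le> n" for i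
      using monoms_bounds(3)[OF m, of i] by (cases "i \<in> Poly_Mapping.keys m") (auto simp: in_keys_iff)
    moreover have "Poly_Mapping.lookup m i = 0" if "\<not> i \<le> n + 1" for i
      using monoms_bounds(2)[OF m, of i] that by (auto simp: in_keys_iff)
    ultimately show "Poly_Mapping.lookup m \<in> {f. \<forall>i. (i \<in> {..n + 1} \<longrightarrow> f i \<in> {..n}) \<and> (i \<notin> {..n + 1} \<longrightarrow> f i = 0)}"
      by simp
  qed
  moreover have "finite {f. \<forall>i. (i \<in> {..n + 1} \<longrightarrow> f i \<in> {..n}) \<and> (i \<notin> {..n + 1} \<longrightarrow> f i = (0::nat))}"
    by (rule finite_set_of_finite_funs) auto
  ultimately have "finite (Poly_Mapping.lookup ` monoms n)" by (rule finite_subset)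
  then show ?thesis by (rule finite_imageD) (auto simp: inj_on_def)
qed

lemma Psi_Psi:
  assumes "\<alpha> \<in> monoms i" "\<beta> \<in> monoms j" "n = i + j"
  shows "Psi \<beta> (Psi \<alpha> p) = (\<Sum>\<gamma> \<in> monoms n. of_int (structure_coeff (n + 1) \<gamma> \<alpha> \<beta>) * Psi \<gamma> p)"
proof -
  let ?K = "n + 1"
  let ?t = "\<lambda>\<gamma>. of_int (structure_coeff ?K \<gamma> \<alpha> \<beta>) * Poly_Mapping.lookup (usubst (?K * ?K) p) \<gamma>"
  have "Psi \<beta> (Psi \<alpha> p) = Poly_Mapping.lookup (usubst ?K (Poly_Mapping.lookup (usubst ?K p) \<alpha>)) \<beta>"
    using assms by (simp add: lookup_usubst_eq_Psi[of \<alpha> i] lookup_usubst_eq_Psi[of \<beta> j])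
  also have "\<dots> = (\<Sum>\<gamma> \<in> Poly_Mapping.keys (usubst (?K * ?K) p). ?t \<gamma>)"
    by (rule lookup_usubst_usubst) simp
  also have "\<dots> = (\<Sum>\<gamma> \<in> Poly_Mapping.keys (usubst (?K * ?K) p) \<union> monoms n. ?t \<gamma>)"
    by (intro sum.mono_neutral_left) (auto simp: finite_monoms in_keys_iff)
  also have "\<dots> = (\<Sum>\<gamma> \<in> monoms n. ?t \<gamma>)"
  proof (intro sum.mono_neutral_right ballI)
    fix \<gamma> assume \<gamma>: "\<gamma> \<in> Poly_Mapping.keys (usubst (?K * ?K) p) \<union> monoms n - monoms n"
    then have "weight \<gamma> \<noteq> int n" using keys_usubst[of \<gamma>] by (auto simp: monoms_def)
    then have "structure_coeff ?K \<gamma> \<alpha> \<beta> = 0"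
      using structure_coeff_nonzero(3)[of ?K \<gamma> \<alpha> \<beta>] assms by (auto simp: monoms_def)
    then show "?t \<gamma> = 0" by simp
  qed (auto simp: finite_monoms)
  also have "\<dots> = (\<Sum>\<gamma> \<in> monoms n. of_int (structure_coeff ?K \<gamma> \<alpha> \<beta>) * Psi \<gamma> p)"
    by (intro sum.cong refl) (simp add: lookup_usubst_eq_Psi[of _ n])
  finally show ?thesis .
qed

section \<open>Integral combinations of the operators\<close>

text \<open>Integer coefficients suit \<open>odd_saturated_subgroup\<close>; dyadic scalars enter
  only through \<open>op_scale\<close>.\<close>

definition lattice_op :: "nat \<Rightarrow> (monom \<Rightarrow> int) \<Rightarrow> operator" where
  "lattice_op n a = (\<lambda>N. \<lambda>p \<in> dpolys N. \<Sum>\<gamma> \<in> monoms n. of_int (a \<gamma>) * Psi \<gamma> p)"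

lemma const_of_int: "const (of_int c) = of_int c"
  by (rule rhom_of_int[OF rhom_const])

lemma lattice_op_zero: "lattice_op n (\<lambda>_. 0) = op_scale 0 op_id"
  by (auto simp: lattice_op_def op_scale_def op_id_def fun_eq_iff const_def)

lemma lattice_op_add: "lattice_op n (\<lambda>x. a x + b x) = op_add (lattice_op n a) (lattice_op n b)"
  by (auto simp: lattice_op_def op_add_def fun_eq_iff distrib_right sum.distrib)

lemma lattice_op_scale: "lattice_op n (\<lambda>x. c * a x) = op_scale (of_int c) (lattice_op n a)"
  by (auto simp: lattice_op_def op_scale_def fun_eq_iff const_of_int sum_distrib_left mult.assoc)

lemma lattice_op_delta:
  assumes "\<gamma> \<in> monoms n" "p \<in> dpolys N"
  shows "lattice_op n (\<lambda>x. if x = \<gamma> then 1 else 0) N p = Psi \<gamma> p"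
proof -
  have "lattice_op n (\<lambda>x. if x = \<gamma> then 1 else 0) N p = (\<Sum>x \<in> monoms n. if x = \<gamma> then Psi x p else 0)"
    using assms(2) unfolding lattice_op_def by (auto intro!: sum.cong)
  then show ?thesis using assms(1) by (simp add: finite_monoms)
qed

lemma op_scale_scale: "op_scale c (op_scale d f) = op_scale (c * d) f"
  by (auto simp: op_scale_def fun_eq_iff const_mult mult.assoc)

lemma op_scale_1: "op_scale 1 (lattice_op n a) = lattice_op n a"
proof -
  have "const 1 = 1" by (rule rhom_1[OF rhom_const])
  then show ?thesis by (auto simp: op_scale_def lattice_op_def fun_eq_iff)
qed

lemma lattice_op_structure_coeff:
  assumes "\<alpha> \<in> monoms i" "\<beta> \<in> monoms j" "n = i + j"
  shows "lattice_op n (\<lambda>\<gamma>. structure_coeff (n + 1) \<gamma> \<alpha> \<beta>) =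
    op_comp (lattice_op j (\<lambda>x. if x = \<beta> then 1 else 0)) (lattice_op i (\<lambda>x. if x = \<alpha> then 1 else 0))"
proof (intro ext)
  fix N p
  show "lattice_op n (\<lambda>\<gamma>. structure_coeff (n + 1) \<gamma> \<alpha> \<beta>) N p =
    op_comp (lattice_op j (\<lambda>x. if x = \<beta> then 1 else 0)) (lattice_op i (\<lambda>x. if x = \<alpha> then 1 else 0)) N p"
  proof (cases "p \<in> dpolys N")
    case True
    then show ?thesis
      using lattice_op_delta[OF assms(1) True] lattice_op_delta[OF assms(2) dpolys_Psi[OF True]]
      by (simp add: op_comp_def compose_def Psi_Psi[OF assms]) (simp add: lattice_op_def)
  next
    case False
    then show ?thesis by (simp add: lattice_op_def op_comp_def compose_def)
  qed
qed

subsection \<open>The components of the total operation\<close>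

lemma single_2_monoms: "Poly_Mapping.single 2 n \<in> monoms n"
  by (simp add: monoms_def)

lemma lookup_usubst_2: "Poly_Mapping.lookup (usubst 2 p) (Poly_Mapping.single 2 n) = Psi (Poly_Mapping.single 2 n) p"
proof -
  have "Poly_Mapping.lookup (usubst 2 p) (Poly_Mapping.single 2 n) =
      Poly_Mapping.lookup (usubst (n + 2) p) (Poly_Mapping.single 2 n)"
    by (rule usubst_stable) auto
  then show ?thesis using lookup_usubst_eq_Psi[OF single_2_monoms, of n "n + 2"] by simp
qed

text \<open>Specializing \<open>var 2\<close> to \<open>1\<close> in \<open>usubst 2\<close> gives
  the substitution of \<open>\<xi> i + \<xi> i ^ 2\<close>, because
  \<open>lam 2 = 1\<close>.\<close>

lemma Jq_total_eq_sum: "Jq_total p = (\<Sum>\<gamma> \<in> Poly_Mapping.keys (usubst 2 p). Poly_Mapping.lookup (usubst 2 p) \<gamma>)"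
proof -
  have id: "rhom (\<lambda>q :: dpoly. q)" by (rule rhom_id)
  have "Jq_total p = coeff_subst (\<lambda>q. q) (\<lambda>_. 1) 2 p"
  proof (rule dpoly_rhom_ext[where F = Jq_total])
    show "rhom Jq_total" by (rule rhomI) (simp_all add: Jq_total_1 Jq_total_add Jq_total_mult)
    show "Jq_total (const a) = coeff_subst (\<lambda>q. q) (\<lambda>_. 1) 2 (const a)" for a
      by (simp add: Jq_total_const coeff_subst_const[OF id])
    have "{1..2} = {Suc 0, 2}" by auto
    moreover have "const 1 = 1" by (rule rhom_1[OF rhom_const])
    ultimately show "Jq_total (\<xi> i) = coeff_subst (\<lambda>q. q) (\<lambda>_. 1) 2 (\<xi> i)" for i
      by (simp add: Jq_total_\<xi> coeff_subst_xi[OF id] series_subst_def)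
    show "rhom (coeff_subst (\<lambda>q :: dpoly. q) (\<lambda>_. 1) 2)" by (rule rhom_coeff_subst[OF id])
  qed
  also have "\<dots> = ev (\<lambda>q. q) (\<lambda>_. 1) (usubst 2 p)" by (rule coeff_subst_eq_ev[OF id])
  also have "\<dots> = (\<Sum>\<gamma> \<in> Poly_Mapping.keys (usubst 2 p). Poly_Mapping.lookup (usubst 2 p) \<gamma>)"
    by (simp add: ev_def mon_def)
  finally show ?thesis .
qed

lemma keys_usubst_bound: "1 \<le> K \<Longrightarrow> \<gamma> \<in> Poly_Mapping.keys (usubst K p) \<Longrightarrow> Poly_Mapping.keys \<gamma> \<subseteq> {..K}"
proof -
  assume K: "1 \<le> K" and \<gamma>: "\<gamma> \<in> Poly_Mapping.keys (usubst K p)"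
  define c :: "nat \<Rightarrow> (monom \<Rightarrow>\<^sub>0 dpoly)" where "c i = (if i \<le> K then var i else 0)" for i
  have "series_subst \<iota> (series K var) K z = series_subst \<iota> (series K c) K z" for \<iota> z
    unfolding series_subst_def by (intro sum.cong) (auto simp: series_def c_def)
  then have "usubst K p = coeff_subst cst c K p"
    by (simp add: usubst_def coeff_subst_def)
  also have "\<dots> = ev cst c (usubst K p)" by (rule coeff_subst_eq_ev[OF rhom_cst])
  finally have "Poly_Mapping.lookup (ev cst c (usubst K p)) \<gamma> \<noteq> 0" using \<gamma> by (simp add: in_keys_iff)
  then obtain \<alpha> q where \<alpha>: "Poly_Mapping.lookup (cst q * mon c \<alpha>) \<gamma> \<noteq> 0"
    unfolding ev_def lookup_sum by (meson sum.neutral)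
  have k: "Poly_Mapping.keys \<alpha> \<subseteq> {..K}"
  proof
    fix i assume i: "i \<in> Poly_Mapping.keys \<alpha>"
    show "i \<in> {..K}"
    proof (rule ccontr)
      assume "i \<notin> {..K}"
      then have "mon c \<alpha> = 0" using i by (intro mon_eq_0[of i]) (auto simp: c_def)
      with \<alpha> show False by simp
    qed
  qed
  then have "mon c \<alpha> = mon var \<alpha>" by (intro mon_cong) (auto simp: c_def)
  with \<alpha> have "\<alpha> = \<gamma>" by (auto simp: lookup_cst_mult mon_var lookup_single when_def split: if_splits)
  with k show ?thesis by simp
qed

text \<open>\<open>usubst 2\<close> involves only powers of \<open>var 2\<close>, and the
  coefficient of the \<open>j\<close>-th power raises the degree by exactly \<open>j\<close>;
  projection to the degree raised by \<open>n\<close> selects the \<open>n\<close>-th.\<close>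

lemma Jq_comp_single: "Jq_comp n (Poly_Mapping.single m a) = Psi (Poly_Mapping.single 2 n) (Poly_Mapping.single m a)"
proof -
  let ?p = "Poly_Mapping.single m a"
  let ?d = "monom_deg m"
  let ?u = "\<lambda>\<gamma>. Poly_Mapping.lookup (usubst 2 ?p) \<gamma>"
  have gr: "int (monom_deg m') = int ?d + weight \<gamma>" if "Poly_Mapping.lookup (?u \<gamma>) m' \<noteq> 0" for \<gamma> m'
    using graded_usubst_single[of m UNIV 2 a] that unfolding graded_def by fastforce
  have key: "\<gamma> = Poly_Mapping.single 2 (Poly_Mapping.lookup \<gamma> 2)" if "\<gamma> \<in> Poly_Mapping.keys (usubst 2 ?p)" for \<gamma>
    by (rule keys_subset_singleton) (use keys_usubst[OF that] keys_usubst_bound[OF _ that] in fastforce)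
  have part: "hom_part (?d + n) (?u \<gamma>) = (if \<gamma> = Poly_Mapping.single 2 n then ?u \<gamma> else 0)"
    if \<gamma>: "\<gamma> \<in> Poly_Mapping.keys (usubst 2 ?p)" for \<gamma>
  proof (rule poly_mapping_eqI)
    fix m'
    have "weight \<gamma> = int n \<longleftrightarrow> \<gamma> = Poly_Mapping.single 2 n"
    proof -
      define j where "j = Poly_Mapping.lookup \<gamma> 2"
      have j: "\<gamma> = Poly_Mapping.single 2 j" using key[OF \<gamma>] by (simp only: j_def)
      have "j = n" if "Poly_Mapping.single 2 j = Poly_Mapping.single (2 :: nat) n"
        using arg_cong[OF that, of "\<lambda>m. Poly_Mapping.lookup m 2"] by simp
      then show ?thesis unfolding j by auto
    qed
    then show "Poly_Mapping.lookup (hom_part (?d + n) (?u \<gamma>)) m' =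
        Poly_Mapping.lookup (if \<gamma> = Poly_Mapping.single 2 n then ?u \<gamma> else 0) m'"
      using gr[of m' \<gamma>] gr[of \<gamma> m']
      by (cases "Poly_Mapping.lookup (?u \<gamma>) m' = 0") (auto simp: lookup_hom_part when_def)
  qed
  have "hom_part d (sum f I) = (\<Sum>i\<in>I. hom_part d (f i))" for d f and I :: "monom set"
    by (induction I rule: infinite_finite_induct) (auto simp: hom_part_add)
  then have "hom_part (?d + n) (Jq_total ?p) =
      (\<Sum>\<gamma> \<in> Poly_Mapping.keys (usubst 2 ?p). if \<gamma> = Poly_Mapping.single 2 n then ?u \<gamma> else 0)"
    unfolding Jq_total_eq_sum by (simp add: part)
  also have "\<dots> = ?u (Poly_Mapping.single 2 n)"
    by (simp add: in_keys_iff)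
  also have "\<dots> = Psi (Poly_Mapping.single 2 n) ?p" by (rule lookup_usubst_2)
  finally show ?thesis
    by (subst Jq_comp_homogeneous[of ?d])
       (auto intro!: poly_mapping_eqI simp: lookup_hom_part lookup_single when_def)
qed

lemma Jq_comp_eq_Psi: "Jq_comp n p = Psi (Poly_Mapping.single 2 n) p"
proof -
  have "Jq_comp n 0 = 0" by (simp add: Jq_comp_def)
  then have sum: "Jq_comp n (sum f A) = (\<Sum>i \<in> A. Jq_comp n (f i))" for f and A :: "monom set"
    by (induction A rule: infinite_finite_induct) (auto simp: Jq_comp_add)
  have "Jq_comp n (\<Sum>m \<in> Poly_Mapping.keys p. Poly_Mapping.single m (Poly_Mapping.lookup p m)) =
      Psi (Poly_Mapping.single 2 n) (\<Sum>m \<in> Poly_Mapping.keys p. Poly_Mapping.single m (Poly_Mapping.lookup p m))"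
    by (simp only: sum Psi_sum Jq_comp_single)
  then show ?thesis by (simp only: poly_eq_sum_single[symmetric])
qed

lemma Jq_eq_lattice_op: "Jq n = lattice_op n (\<lambda>x. if x = Poly_Mapping.single 2 n then 1 else 0)"
proof (intro ext)
  fix N p
  show "Jq n N p = lattice_op n (\<lambda>x. if x = Poly_Mapping.single 2 n then 1 else 0) N p"
    using lattice_op_delta[OF single_2_monoms] by (cases "p \<in> dpolys N") (auto simp: Jq_def Jq_comp_eq_Psi lattice_op_def)
qed

subsection \<open>Generators\<close>

text \<open>Modulo two the mixed coefficients of the coproduct \<open>F\<close> of \<open>G\<close>
  vanish, so \<open>F\<close> is a part depending on \<open>x\<close> plus a part depending on
  \<open>y\<close>. Inserting the identity series for either argument identifies these
  parts.\<close>

lemma eval_set_additive: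
  fixes x y :: "nat \<Rightarrow> bpoly"
  assumes fin: "finite G" and G: "G \<subseteq> monoms n" and n: "1 \<le> n" and K: "n < K"
    and even: "\<And>\<alpha> \<beta> i j. \<alpha> \<in> monoms i \<Longrightarrow> \<beta> \<in> monoms j \<Longrightarrow> n = i + j \<Longrightarrow> 1 \<le> i \<Longrightarrow> 1 \<le> j \<Longrightarrow>
      even (\<Sum>\<gamma> \<in> G. structure_coeff K \<gamma> \<alpha> \<beta>)"
  shows "eval_set G (scomp (series K x) (series K y)) = eval_set G (series K x) + eval_set G (series K y)"
proof -
  define F :: "monom \<Rightarrow>\<^sub>0 (monom \<Rightarrow>\<^sub>0 int)" where "F = eval_set G (generic_scomp K)"
  have F: "Poly_Mapping.lookup (Poly_Mapping.lookup F \<alpha>) \<beta> = (\<Sum>\<gamma> \<in> G. structure_coeff K \<gamma> \<alpha> \<beta>)" for \<alpha> \<beta>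
    by (simp add: F_def eval_set_def lookup_sum structure_coeff_def)
  have F_even: "even (Poly_Mapping.lookup (Poly_Mapping.lookup F \<alpha>) \<beta>)" if "\<alpha> \<noteq> 0" "\<beta> \<noteq> 0" for \<alpha> \<beta>
  proof (cases "\<exists>\<gamma> \<in> G. structure_coeff K \<gamma> \<alpha> \<beta> \<noteq> 0")
    case True
    then obtain \<gamma> where \<gamma>: "\<gamma> \<in> G" "structure_coeff K \<gamma> \<alpha> \<beta> \<noteq> 0" by blast
    have pos: "0 < weight \<delta>" if "Poly_Mapping.keys \<delta> \<subseteq> {2..}" "\<delta> \<noteq> 0" for \<delta>
      unfolding weight_def
    proof (intro sum_pos mult_pos_pos)
      fix i assume i: "i \<in> Poly_Mapping.keys \<delta>"
      then have "2 \<le> i" using that(1) by auto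
      then show "0 < int i - 1" by simp
      show "0 < int (Poly_Mapping.lookup \<delta> i)" using i by (simp add: in_keys_iff)
    qed (use that in auto)
    have a: "0 < weight \<alpha>" "0 < weight \<beta>" using structure_coeff_nonzero[OF \<gamma>(2)] that pos by auto
    have "\<alpha> \<in> monoms (nat (weight \<alpha>))" "\<beta> \<in> monoms (nat (weight \<beta>))"
      using structure_coeff_nonzero[OF \<gamma>(2)] a by (auto simp: monoms_def)
    moreover have "weight \<gamma> = int n" using \<gamma>(1) G by (auto simp: monoms_def)
    then have "n = nat (weight \<alpha>) + nat (weight \<beta>)" using structure_coeff_nonzero(3)[OF \<gamma>(2)] a by simp
    ultimately show ?thesis unfolding F using a by (intro even) auto
  next
    case False
    then have "(\<Sum>\<gamma> \<in> G. structure_coeff K \<gamma> \<alpha> \<beta>) = 0" by (intro sum.neutral) auto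
    then show ?thesis by (simp only: F) simp
  qed
  define E1 where "E1 y = ev of_int y" for y :: "nat \<Rightarrow> bpoly"
  define E2 where "E2 x y = ev (E1 y) x" for x y :: "nat \<Rightarrow> bpoly"
  have h1: "rhom (E1 y)" for y unfolding E1_def by (rule rhom_ev[OF rhom_int])
  have h2: "rhom (E2 x y)" for x y unfolding E2_def by (rule rhom_ev[OF h1])
  have v: "E2 x y (var i) = x i" "E2 x y (cst (var i)) = y i" for x y i
    unfolding E2_def ev_var[OF h1] ev_cst[OF h1] by (simp_all add: E1_def ev_var[OF rhom_int])
  have E2: "eval_set G (scomp (series K x) (series K y)) = E2 x y F" for x y
    by (simp only: F_def eval_set_def rhom_sum[OF h2] rhom_mon[OF h2] rhom_scomp[OF h2] rhom_series[OF h2] v)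
  have E1: "E1 y (Poly_Mapping.lookup F \<alpha>) = E1 (\<lambda>_. 0) (Poly_Mapping.lookup F \<alpha>)" if "\<alpha> \<noteq> 0" for y \<alpha>
    unfolding E1_def ev_def
  proof (rule sum.cong[OF refl])
    fix \<beta>
    show "of_int (Poly_Mapping.lookup (Poly_Mapping.lookup F \<alpha>) \<beta>) * mon y \<beta> =
        of_int (Poly_Mapping.lookup (Poly_Mapping.lookup F \<alpha>) \<beta>) * mon (\<lambda>_. 0) \<beta>"
      using F_even[OF that] by (cases "\<beta> = 0") (simp_all add: bpoly_of_int)
  qed
  have split: "E2 x y F = E1 y (Poly_Mapping.lookup F 0) +
      (\<Sum>\<alpha> \<in> Poly_Mapping.keys F - {0}. E1 (\<lambda>_. 0) (Poly_Mapping.lookup F \<alpha>) * mon x \<alpha>)" for x y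
  proof -
    have "E2 x y F = (\<Sum>\<alpha> \<in> insert 0 (Poly_Mapping.keys F). E1 y (Poly_Mapping.lookup F \<alpha>) * mon x \<alpha>)"
      unfolding E2_def by (rule ev_superset[OF _ _ h1]) auto
    also have "\<dots> = E1 y (Poly_Mapping.lookup F 0) +
        (\<Sum>\<alpha> \<in> Poly_Mapping.keys F - {0}. E1 y (Poly_Mapping.lookup F \<alpha>) * mon x \<alpha>)"
      by (subst sum.insert_remove) auto
    also have "(\<Sum>\<alpha> \<in> Poly_Mapping.keys F - {0}. E1 y (Poly_Mapping.lookup F \<alpha>) * mon x \<alpha>) =
        (\<Sum>\<alpha> \<in> Poly_Mapping.keys F - {0}. E1 (\<lambda>_. 0) (Poly_Mapping.lookup F \<alpha>) * mon x \<alpha>)"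
      by (intro sum.cong refl arg_cong2[of _ _ _ _ "(*)"] E1) auto
    finally show ?thesis .
  qed
  \<comment> \<open>This form of the splitting avoids isolating the constant term; the value at zero
    arguments is shown to vanish in \<open>zero\<close>.\<close>
  have sum: "E2 x y F + E2 (\<lambda>_. 0) (\<lambda>_. 0) F = E2 x (\<lambda>_. 0) F + E2 (\<lambda>_. 0) y F"
    unfolding split[of x y] split[of x "\<lambda>_. 0"] split[of "\<lambda>_. 0" "\<lambda>_. 0"] split[of "\<lambda>_. 0" y]
    by (simp only: ac_simps)
  have id: "series K (\<lambda>_. 0 :: bpoly) = (\<lambda>i. if i = 1 then 1 else 0)"
    using n K by (auto simp: series_def)
  have "scomp (series K x) (series K (\<lambda>_. 0)) m = series K x m" for x :: "nat \<Rightarrow> bpoly" and m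
  proof (cases "m = 0")
    case False
    then have "scomp (series K x) (series K (\<lambda>_. 0)) m =
        series K x m + (\<Sum>l<m - 1. of_nat (m choose l) * series K x (Suc l) * series K (\<lambda>_. 0) (m - l))"
      by (intro scomp_gap[where r = "m + 1"]) (auto simp: id)
    also have "(\<Sum>l<m - 1. of_nat (m choose l) * series K x (Suc l) * series K (\<lambda>_. 0) (m - l)) = 0"
      by (intro sum.neutral) (auto simp: id)
    finally show ?thesis by simp
  qed (simp add: scomp_0)
  then have right: "E2 x (\<lambda>_. 0) F = eval_set G (series K x)" for x
    unfolding E2[symmetric] by (intro eval_set_cong)
  have "scomp (series K (\<lambda>_. 0)) (series K y) m = series K y m" for y :: "nat \<Rightarrow> bpoly" and m
  proof -
    have "scomp (series K (\<lambda>_. 0)) (series K y) m = (\<Sum>l\<le>m. if l = 1 then dpow l (series K y) m else 0)"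
      unfolding scomp_def id by (intro sum.cong) auto
    then show ?thesis by (cases m) (auto simp: dpow_1 simp del: dpow.simps)
  qed
  then have left: "E2 (\<lambda>_. 0) y F = eval_set G (series K y)" for y
    unfolding E2[symmetric] by (intro eval_set_cong)
  have zero: "eval_set G (series K (\<lambda>_. 0 :: bpoly)) = 0"
    unfolding eval_set_def
  proof (rule sum.neutral, rule ballI)
    fix m assume "m \<in> G"
    with G have m: "m \<in> monoms n" by blast
    then obtain i where i: "i \<in> Poly_Mapping.keys m" using monoms_keys_nonempty[OF _ n] by blast
    with monoms_bounds(1)[OF m i] show "mon (series K (\<lambda>_. 0 :: bpoly)) m = 0"
      by (intro mon_eq_0[of i]) (auto simp: id)
  qed
  show ?thesis using sum unfolding E2 left right zero add_0_right .
qed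

lemma lattice_op_mem:
  assumes A: "subalgebra A" and J: "\<And>e. Jq (2 ^ e) \<in> A" and "1 \<le> n"
  shows "lattice_op n a \<in> A"
  using assms(3)
proof (induction n arbitrary: a rule: less_induct)
  case (less n)
  let ?B = "{a. lattice_op n a \<in> A}"
  show ?case
  proof (rule ccontr)
    assume "lattice_op n a \<notin> A"
    have scaleA: "op_scale c f \<in> A" if "f \<in> A" for c f using A that by (auto simp: subalgebra_def)
    have "\<exists>G \<subseteq> monoms n. G \<noteq> {} \<and> (\<forall>a \<in> ?B. even (\<Sum>x\<in>G. a x))"
    proof (rule odd_saturated_subgroup[OF finite_monoms])
      show "(\<lambda>_. 0) \<in> ?B" using A by (simp add: lattice_op_zero scaleA subalgebra_def)
      show "(\<lambda>x. a x + b x) \<in> ?B" if "a \<in> ?B" "b \<in> ?B" for a b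
        using A that by (simp add: lattice_op_add subalgebra_def)
      show "(\<lambda>x. c * a x) \<in> ?B" if "a \<in> ?B" for c a
        using that by (simp add: lattice_op_scale scaleA)
      show "a \<in> ?B" if c: "odd c" "(\<lambda>x. c * a x) \<in> ?B" for c a
      proof -
        obtain y :: dyadic where "of_int c * y = 1" using odd_unit[OF c(1)] by blast
        moreover have "op_scale y (op_scale (of_int c) (lattice_op n a)) \<in> A"
          using c(2) by (simp add: lattice_op_scale scaleA)
        ultimately show ?thesis by (simp add: op_scale_scale mult.commute op_scale_1)
      qed
      show "b \<in> ?B" if "\<And>x. x \<in> monoms n \<Longrightarrow> a x = b x" "a \<in> ?B" for a b
      proof -
        have "lattice_op n a = lattice_op n b" unfolding lattice_op_def using that(1) by (intro ext) (simp cong: sum.cong)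
        with that(2) show ?thesis by simp
      qed
      show "a \<notin> ?B" using \<open>lattice_op n a \<notin> A\<close> by simp
    qed
    then obtain G where G: "G \<subseteq> monoms n" "G \<noteq> {}" and even: "\<And>a. lattice_op n a \<in> A \<Longrightarrow> even (\<Sum>x\<in>G. a x)"
      by blast
    have fin: "finite G" using G(1) finite_monoms finite_subset by blast
    interpret additive_monomials G n "n + 1"
    proof
      show "eval_set G (scomp (series (n + 1) x) (series (n + 1) y)) = eval_set G (series (n + 1) x) + eval_set G (series (n + 1) y)"
        for x y :: "nat \<Rightarrow> bpoly"
      proof (rule eval_set_additive[OF fin G(1) less.prems])
        fix \<alpha> \<beta> i j
        assume *: "\<alpha> \<in> monoms i" "\<beta> \<in> monoms j" "n = i + j" "1 \<le> i" "1 \<le> j"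
        \<comment> \<open>By induction both factors lie in \<open>A\<close>, hence so does their
          product, whose coordinates are the structure coefficients.\<close>
        have "lattice_op i b \<in> A" "lattice_op j b \<in> A" for b using less.IH * by auto
        then have "lattice_op n (\<lambda>\<gamma>. structure_coeff (n + 1) \<gamma> \<alpha> \<beta>) \<in> A"
          unfolding lattice_op_structure_coeff[OF *(1-3)] using A by (simp add: subalgebra_def)
        then show "even (\<Sum>\<gamma>\<in>G. structure_coeff (n + 1) \<gamma> \<alpha> \<beta>)" by (rule even)
      qed simp
    qed (use fin G less.prems in auto)
    obtain e where e: "n = 2 ^ e" "G = {Poly_Mapping.single 2 n}" using classification by blast
    \<comment> \<open>These are the coordinates of \<open>Jq n\<close>, which lies in
      \<open>A\<close> as \<open>n\<close> is a power of two; over \<open>G\<close> they add up to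
      \<open>1\<close>.\<close>
    have "even (\<Sum>x\<in>G. if x = Poly_Mapping.single 2 n then 1 else 0 :: int)"
      using J[of e] by (intro even) (simp only: Jq_eq_lattice_op[symmetric] e(1))
    then show False by (simp add: e(2))
  qed
qed

theorem theorem3p9:
  shows "J2 = generated_algebra {Jq (2 ^ n) | n. n \<ge> 0}"
proof
  let ?A = "generated_algebra {Jq (2 ^ n) | n. n \<ge> 0}"
  have alg: "subalgebra ?A"
    by (rule subalgebra_generated_algebra) (auto simp: Jq_in_operators)
  have J: "Jq (2 ^ e) \<in> ?A" for e
    unfolding generated_algebra_def by (rule hull_inc) auto
  have "Jq k \<in> ?A" for k
  proof (cases "k = 0")
    \<comment> \<open>\<open>Jq 0\<close> has degree zero, outside the range of
      \<open>lattice_op_mem\<close>, but it is the identity.\<close>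
    case True
    then show ?thesis using alg by (simp add: Jq_0 subalgebra_def)
  next
    case False
    then have "lattice_op k (\<lambda>x. if x = Poly_Mapping.single 2 k then 1 else 0) \<in> ?A"
      by (intro lattice_op_mem[OF alg J]) simp
    then show ?thesis by (simp only: Jq_eq_lattice_op[of k])
  qed
  then show "J2 \<subseteq> ?A"
    unfolding J2_def generated_algebra_def[of "{Jq k |k. k \<ge> 0}"]
    by (intro hull_minimal alg) auto
  show "?A \<subseteq> J2"
    unfolding J2_def generated_algebra_def by (rule hull_mono) auto
qed

end
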